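(* Let $A$ be a semisimple complex Banach algebra with identity and $\mathrm{Soc}\,A\neq\{0\}$. (1) $\dim pAp=\mathrm{rank}(p)$ for all finite-rank projections $p$ of $A$ if and only if $\mathrm{Soc}\,A\subseteq Z(A)$. (2) $\dim pAp=[\mathrm{rank}(p)]^2$ for all finite-rank projections $p$ of $A$ if and only if every $a\in\mathrm{Soc}\,A$ with $\mathrm{Tr}(a)=0$ can be expressed as $a=xy-yx$ for some $x,y\in\mathrm{Soc}\,A$.
   Context: $Z(A)$ is the center of $A$. A projection is an element $p$ with $p^2=p$. For $x\in A$, $\sigma(x)$ is the spectrum and $\sigma'(x)=\sigma(x)\setminus\{0\}$. The rank of $a\in A$ is $\mathrm{rank}(a)=\sup_{x\in A}\#\sigma'(xa)\in\{0,1,2,\dots\}\cup\{\infty\}$. $\mathrm{Soc}\,A$ is the socle of $A$ (the sum of all minimal left ideals, $\{0\}$ if there are none); for semisimple $A$ it coincides with the set of elements of finite rank. $\dim$ is complex vector space dimension. Trace: for $a\in\mathrm{Soc}\,A$ put $E(a)=\{x\in A:\#\sigma'(xa)=\mathrm{rank}(a)\}$ (a dense open subset of $A$). For $\lambda\in\sigma(a)$, let $B(\lambda,r)$ be an open disk containing no other point of $\sigma(a)$; there is an open ball $U\subseteq A$ centered at $\mathbf 1$ such that $\#[\sigma(xa)\cap B(\lambda,r)]$ is constant for $x\in E(a)\cap U$, and this constant is the multiplicity $m(\lambda,a)$. Then $\mathrm{Tr}(a)=\sum_{\lambda\in\sigma(a)}\lambda\, m(\lambda,a)$. *)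

theory Defs
  imports "HOL-Analysis.Analysis"
begin

(* The norm of the identity is not required to be 1.  The law scaleC 1 x = x follows from
   scaleR_eq_scaleC. *)
class complex_banach_algebra_1 = real_normed_algebra + real_algebra_1 + banach +
  fixes scaleC :: "complex \<Rightarrow> 'a \<Rightarrow> 'a"  (infixr "*\<^sub>C" 75)
  assumes scaleR_eq_scaleC: "scaleR r x = complex_of_real r *\<^sub>C x"
    and scaleC_add_right: "c *\<^sub>C (x + y) = c *\<^sub>C x + c *\<^sub>C y"
    and scaleC_add_left: "(c + d) *\<^sub>C x = c *\<^sub>C x + d *\<^sub>C x"
    and scaleC_scaleC: "c *\<^sub>C d *\<^sub>C x = (c * d) *\<^sub>C x"
    and mult_scaleC_left: "(c *\<^sub>C x) * y = c *\<^sub>C (x * y)"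
    and mult_scaleC_right: "x * (c *\<^sub>C y) = c *\<^sub>C (x * y)"
    and norm_scaleC: "norm (c *\<^sub>C x) = cmod c * norm x"

global_interpretation cvec: vector_space "scaleC :: complex \<Rightarrow> 'a \<Rightarrow> 'a::complex_banach_algebra_1"
  by unfold_locales
    (simp_all add: scaleC_add_right scaleC_add_left scaleC_scaleC scaleR_eq_scaleC[of 1, simplified, symmetric])

definition ecard :: "'b set \<Rightarrow> enat"
  where "ecard S = (if finite S then enat (card S) else \<infinity>)"

(* Intended for subspaces V.  The library's dimension cvec.dim is 0 on infinite-dimensional
   spaces; here these get the value \<infinity>. *)
definition complex_dim :: "'a::complex_banach_algebra_1 set \<Rightarrow> enat"
  where "complex_dim V =
    (if \<exists>B. finite B \<and> V \<subseteq> cvec.span B then enat (cvec.dim V) else \<infinity>)"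

definition two_sided_invertible :: "'a::ring_1 \<Rightarrow> bool"
  where "two_sided_invertible x \<longleftrightarrow> (\<exists>y. x * y = 1 \<and> y * x = 1)"

definition alg_spectrum :: "'a::complex_banach_algebra_1 \<Rightarrow> complex set"
  where "alg_spectrum x = {\<mu>. \<not> two_sided_invertible (\<mu> *\<^sub>C 1 - x)}"

definition nonzero_spectrum :: "'a::complex_banach_algebra_1 \<Rightarrow> complex set"
  where "nonzero_spectrum x = alg_spectrum x - {0}"

definition spectral_rank :: "'a::complex_banach_algebra_1 \<Rightarrow> enat"
  where "spectral_rank a = (SUP x. ecard (nonzero_spectrum (x * a)))"

definition left_ideal :: "'a::complex_banach_algebra_1 set \<Rightarrow> bool"
  where "left_ideal L \<longleftrightarrow> cvec.subspace L \<and> (\<forall>a. \<forall>x\<in>L. a * x \<in> L)"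

definition maximal_left_ideal :: "'a::complex_banach_algebra_1 set \<Rightarrow> bool"
  where "maximal_left_ideal L \<longleftrightarrow> left_ideal L \<and> L \<noteq> UNIV \<and>
    (\<forall>M. left_ideal M \<and> L \<subseteq> M \<longrightarrow> M = L \<or> M = UNIV)"

definition minimal_left_ideal :: "'a::complex_banach_algebra_1 set \<Rightarrow> bool"
  where "minimal_left_ideal L \<longleftrightarrow> left_ideal L \<and> L \<noteq> {0} \<and>
    (\<forall>M. left_ideal M \<and> M \<subseteq> L \<longrightarrow> M = {0} \<or> M = L)"

definition jacobson_radical :: "'a::complex_banach_algebra_1 set"
  where "jacobson_radical = \<Inter> {L. maximal_left_ideal L}"

(* A sum of linear subspaces is the linear span of their union; the span of {} is {0}. *)
definition socle :: "'a::complex_banach_algebra_1 set"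
  where "socle = cvec.span (\<Union> {L. minimal_left_ideal L})"

definition alg_center :: "'a::ring_1 set"
  where "alg_center = {z. \<forall>x. z * x = x * z}"

definition projection :: "'a::ring_1 \<Rightarrow> bool"
  where "projection p \<longleftrightarrow> p * p = p"

(* pAp *)
definition corner :: "'a::ring_1 \<Rightarrow> 'a set"
  where "corner p = {p * x * p | x. True}"

(* E(a) *)
definition max_rank_set :: "'a::complex_banach_algebra_1 \<Rightarrow> 'a set"
  where "max_rank_set a = {x. ecard (nonzero_spectrum (x * a)) = spectral_rank a}"

(* The multiplicity m(\<mu>, a), for \<mu> in the spectrum of a socle element a.  The closed disk is
   required to avoid the rest of the spectrum: if another spectral point lay on the boundary
   circle of the open disk, the count need not be constant near 1.  Every isolating open disk
   becomes admissible after shrinking its radius. *)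
definition spectral_multiplicity :: "complex \<Rightarrow> 'a::complex_banach_algebra_1 \<Rightarrow> nat"
  where "spectral_multiplicity \<mu> a =
    (THE m. \<exists>r>0. alg_spectrum a \<inter> cball \<mu> r = {\<mu>} \<and>
      (\<exists>\<epsilon>>0. \<forall>x \<in> max_rank_set a \<inter> ball 1 \<epsilon>.
        ecard (alg_spectrum (x * a) \<inter> ball \<mu> r) = enat m))"

(* Meaningful for a in the socle, where the spectrum is finite. *)
definition spectral_trace :: "'a::complex_banach_algebra_1 \<Rightarrow> complex"
  where "spectral_trace a =
    (\<Sum>\<mu>\<in>alg_spectrum a. \<mu> * of_nat (spectral_multiplicity \<mu> a))"

end

theory Submission
  imports
    Defs
    "Jordan_Normal_Form.Schur_Decomposition"
    "HOL-Complex_Analysis.Residue_Theorem"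
begin

text \<open>
  Every finite-rank projection p is a sum of n mutually orthogonal minimal idempotents e with
  e A e = \<complex>e, and p A p splits into full matrix blocks, one for each class of minimal idempotents
  linked by e A f \<noteq> 0. So rank p is the sum of the block sizes and dim p A p the sum of their squares:
  these agree for all p iff all blocks have size one, that is, iff the socle is central, and
  dim p A p = (rank p)^2 for all p iff any two minimal idempotents are linked.

  Suppose all are linked. An element a of the socle lies in some p A p, and counting
  eigenvalues with Rouche's theorem identifies the spectral trace with the matrix trace. A matrix of
  trace zero has zero diagonal with respect to a suitable orthogonal family, and is then a commutator.
  If e and f are not linked, then e - f has trace zero, but the trace on the module A e takes the value
  1 on it, so it is not a commutator in the socle.

  Minimal idempotents are reached without contour integrals: the mean of the resolvents
  (1 - t w x)^{-1} over the n-th roots of unity w equals (1 - t^n x^n)^{-1}, and as a Riemann sum over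
  a circle free of spectrum it converges to a spectral idempotent of x.
\<close>

section \<open>Resolvents and spectral idempotents\<close>

text \<open>The circle means also replace the spectral radius formula and the Gelfand-Mazur theorem.
  Comparing two radii shows that the limits are idempotent and do not change while no spectrum is
  crossed. For an element without nonzero spectrum the radius can shrink to 0, where the limit is 1,
  and this forces its scaled powers to tend to 0. Semisimplicity then removes such elements from the
  corners that matter. The trace is the delicate point. It counts spectral points of x a at those x
  near 1 that attain the rank of a, so the matrices should have exactly that size: in a larger one 0
  would be a root of each characteristic polynomial. Hence a is compressed to a family G whose sum
  generates the right ideal a A. A commutator needs a unit for a on both sides, so the trace is
  carried over to a larger family E; making its diagonal vanish changes the family once more, and
  the trace must be shown to depend only on the sum of the family. The spectral trace adds up all
  blocks, while a commutator has trace zero on each block separately; this is the obstruction when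
  two idempotents are unlinked.\<close>

lemma two_sided_invertibleI: "x * y = 1 \<Longrightarrow> y * x = 1 \<Longrightarrow> two_sided_invertible x"
  unfolding two_sided_invertible_def by blast

lemma two_sided_invertible_mult:
  assumes "two_sided_invertible x" "two_sided_invertible y"
  shows "two_sided_invertible (x * y)"
proof -
  obtain a b where "x * a = 1" "a * x = 1" "y * b = 1" "b * y = 1"
    using assms unfolding two_sided_invertible_def by blast
  then have "(x * y) * (b * a) = 1" "(b * a) * (x * y) = 1"
    by (metis mult.assoc mult_1_right)+
  then show ?thesis by (rule two_sided_invertibleI)
qed

lemma two_sided_invertible_factor:
  assumes "two_sided_invertible (x * y)" "x * y = y * x"
  shows "two_sided_invertible x"
proof -
  obtain a where "x * y * a = 1" "a * (x * y) = 1"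
    using assms unfolding two_sided_invertible_def by blast
  then have r: "x * (y * a) = 1" and l: "(a * y) * x = 1" using assms(2) by (metis mult.assoc)+
  have "a * y = y * a" by (metis l r mult.assoc mult_1_left mult_1_right)
  then show ?thesis using two_sided_invertibleI r l by metis
qed

lemma two_sided_invertible_scaleC:
  fixes x :: "'a::complex_banach_algebra_1"
  assumes "c \<noteq> 0" "two_sided_invertible x"
  shows "two_sided_invertible (c *\<^sub>C x)"
proof -
  obtain a where "x * a = 1" "a * x = 1" using assms unfolding two_sided_invertible_def by blast
  then have "(c *\<^sub>C x) * (inverse c *\<^sub>C a) = 1" "(inverse c *\<^sub>C a) * (c *\<^sub>C x) = 1"
    using assms by (simp_all add: mult_scaleC_left mult_scaleC_right)
  then show ?thesis by (rule two_sided_invertibleI)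
qed

text \<open>The candidate \<open>1 + y * c * x\<close> comes from the formal series 1 + yx + yxyx +
  ... = 1 + y (1 + xy + ...) x, with \<open>c\<close> in place of the inner series.\<close>

lemma two_sided_invertible_one_minus_commute:
  fixes x y :: "'a::ring_1"
  assumes "two_sided_invertible (1 - x * y)"
  shows "two_sided_invertible (1 - y * x)"
proof -
  obtain c where c: "(1 - x * y) * c = 1" "c * (1 - x * y) = 1"
    using assms unfolding two_sided_invertible_def by blast
  then have c1: "x * y * c = c - 1" and c2: "c * (x * y) = c - 1"
    by (simp_all add: algebra_simps)
  have "(1 - y * x) * (1 + y * c * x) = 1 + y * c * x - y * x - y * (x * y * c) * x"
    by (simp add: algebra_simps)
  also have "\<dots> = 1" unfolding c1 by (simp add: algebra_simps)
  finally have 1: "(1 - y * x) * (1 + y * c * x) = 1" .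
  have "(1 + y * c * x) * (1 - y * x) = 1 + y * c * x - y * x - y * (c * (x * y)) * x"
    by (simp add: algebra_simps)
  also have "\<dots> = 1" unfolding c2 by (simp add: algebra_simps)
  finally have 2: "(1 + y * c * x) * (1 - y * x) = 1" .
  show ?thesis using 1 2 by (rule two_sided_invertibleI)
qed

lemma resolvent_rescale:
  fixes x :: "'a::complex_banach_algebra_1"
  assumes "\<mu> \<noteq> 0"
  shows "two_sided_invertible (\<mu> *\<^sub>C 1 - x) \<longleftrightarrow> two_sided_invertible (1 - inverse \<mu> *\<^sub>C x)"
proof -
  have "\<mu> *\<^sub>C (1 - inverse \<mu> *\<^sub>C x) = \<mu> *\<^sub>C 1 - x"
    using assms by (simp add: cvec.scale_right_diff_distrib)
  moreover have "inverse \<mu> *\<^sub>C (\<mu> *\<^sub>C 1 - x) = 1 - inverse \<mu> *\<^sub>C x"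
    using assms by (simp add: cvec.scale_right_diff_distrib)
  ultimately show ?thesis
    using two_sided_invertible_scaleC assms by (metis inverse_nonzero_iff_nonzero)
qed

lemma nonzero_spectrum_iff:
  "\<mu> \<in> nonzero_spectrum x \<longleftrightarrow> \<mu> \<noteq> 0 \<and> \<not> two_sided_invertible (\<mu> *\<^sub>C 1 - x)"
  unfolding nonzero_spectrum_def alg_spectrum_def by blast

lemma nonzero_spectrum_iff':
  "\<mu> \<in> nonzero_spectrum x \<longleftrightarrow> \<mu> \<noteq> 0 \<and> \<not> two_sided_invertible (1 - inverse \<mu> *\<^sub>C x)"
  using nonzero_spectrum_iff resolvent_rescale by blast

text \<open>The eigenvector is an element of the algebra itself, on which \<open>a\<close> acts by
  left multiplication; an inverse of \<open>\<mu> *\<^sub>C 1 - a\<close> would cancel to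
  \<open>w = 0\<close>.\<close>

lemma eigenvalue_in_nonzero_spectrum:
  fixes a :: "'a::complex_banach_algebra_1"
  assumes "a * w = \<mu> *\<^sub>C w" "w \<noteq> 0" "\<mu> \<noteq> 0"
  shows "\<mu> \<in> nonzero_spectrum a"
proof -
  have "(\<mu> *\<^sub>C 1 - a) * w = 0" using assms(1) by (simp add: left_diff_distrib mult_scaleC_left)
  moreover have "w = 0" if "b * (\<mu> *\<^sub>C 1 - a) = 1" "(\<mu> *\<^sub>C 1 - a) * w = 0" for b
    using mult.assoc[of b "\<mu> *\<^sub>C 1 - a" w] that by simp
  ultimately show ?thesis
    unfolding nonzero_spectrum_iff two_sided_invertible_def using assms(2,3) by blast
qed

lemma nonzero_spectrum_mult_commute:
  fixes x y :: "'a::complex_banach_algebra_1"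
  shows "nonzero_spectrum (x * y) = nonzero_spectrum (y * x)"
proof -
  have "two_sided_invertible (1 - c *\<^sub>C (x * y)) \<Longrightarrow> two_sided_invertible (1 - c *\<^sub>C (y * x))"
    for c and x y :: 'a
    using two_sided_invertible_one_minus_commute[of "c *\<^sub>C x" y]
    by (simp add: mult_scaleC_left mult_scaleC_right)
  then show ?thesis unfolding set_eq_iff nonzero_spectrum_iff' by blast
qed

section \<open>Geometric sums, Neumann series and continuity of inversion\<close>

lemma one_minus_mult_sum_power:
  fixes x :: "'a::ring_1"
  shows "(1 - x) * (\<Sum>k<n. x ^ k) = 1 - x ^ n" "(\<Sum>k<n. x ^ k) * (1 - x) = 1 - x ^ n"
proof (induction n)
  case (Suc n)
  {
    case 1
    show ?case using Suc(1) by (simp add: distrib_left left_diff_distrib)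
  next
    case 2
    have "(\<Sum>k<Suc n. x ^ k) * (1 - x) = (\<Sum>k<n. x ^ k) * (1 - x) + x ^ n * (1 - x)"
      by (simp add: distrib_right)
    then show ?case unfolding Suc(2) by (simp add: right_diff_distrib power_commutes)
  }
qed simp_all

text \<open>The exponent starts at 1: the norm of the identity may exceed 1, so the bound can fail
  for the power 0.\<close>

lemma norm_power_Suc_le:
  fixes x :: "'a::complex_banach_algebra_1"
  shows "norm (x ^ Suc n) \<le> norm x ^ Suc n"
proof (induction n)
  case (Suc n)
  have "norm (x ^ Suc (Suc n)) \<le> norm x * norm (x ^ Suc n)"
    by (metis norm_mult_ineq power_Suc)
  also have "\<dots> \<le> norm x * norm x ^ Suc n"
    using Suc by (intro mult_left_mono) auto
  finally show ?case by simp
qed simp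

lemma neumann_invertible:
  fixes x :: "'a::complex_banach_algebra_1"
  assumes "norm x < 1"
  shows "two_sided_invertible (1 - x)"
proof -
  have "summable (\<lambda>n. x ^ n)"
  proof (rule summable_comparison_test')
    show "summable (\<lambda>n. norm x ^ n)" using assms by (simp add: summable_geometric)
    show "norm (x ^ n) \<le> norm x ^ n" if "1 \<le> n" for n
      using norm_power_Suc_le[of x "n - 1"] that by simp
  qed
  then have S: "(\<lambda>n. \<Sum>k<n. x ^ k) \<longlonglongrightarrow> (\<Sum>n. x ^ n)" (is "_ \<longlonglongrightarrow> ?S") and
    z: "(\<lambda>n. x ^ n) \<longlonglongrightarrow> 0"
    using summable_LIMSEQ summable_LIMSEQ_zero by blast+
  have z': "(\<lambda>n. 1 - x ^ n) \<longlonglongrightarrow> 1" using tendsto_diff[OF tendsto_const z, of 1] by simp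
  have "(\<lambda>n. (1 - x) * (\<Sum>k<n. x ^ k)) \<longlonglongrightarrow> (1 - x) * ?S" "(\<lambda>n. (\<Sum>k<n. x ^ k) * (1 - x)) \<longlonglongrightarrow> ?S * (1 - x)"
    using S by (auto intro!: tendsto_intros)
  then have "(1 - x) * ?S = 1" "?S * (1 - x) = 1"
    using z' LIMSEQ_unique unfolding one_minus_mult_sum_power by blast+
  then show ?thesis by (rule two_sided_invertibleI)
qed

text \<open>\<open>z = x * (1 - y * (x - z))\<close>, and the second factor has a Neumann
  inverse.\<close>

lemma invertible_perturb:
  fixes x :: "'a::complex_banach_algebra_1"
  assumes "x * y = 1" "y * x = 1" "norm y * norm (x - z) < 1"
  shows "two_sided_invertible z"
proof -
  have "norm (y * (x - z)) < 1"
    using assms(3) norm_mult_ineq le_less_trans by blast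
  then have "two_sided_invertible (1 - y * (x - z))" by (rule neumann_invertible)
  moreover have "two_sided_invertible x" using assms by (blast intro: two_sided_invertibleI)
  moreover have "x * (1 - y * (x - z)) = z"
    using assms by (metis (no_types, opaque_lifting) mult_1_right diff_diff_eq2 add_diff_cancel_left' mult.assoc mult_1_left right_diff_distrib)
  ultimately show ?thesis using two_sided_invertible_mult by metis
qed

lemma open_two_sided_invertible: "open {x :: 'a::complex_banach_algebra_1. two_sided_invertible x}"
proof (rule openI)
  fix x :: 'a assume "x \<in> {x. two_sided_invertible x}"
  then obtain y where y: "x * y = 1" "y * x = 1" unfolding two_sided_invertible_def by blast
  have "two_sided_invertible z" if "dist x z < 1 / (norm y + 1)" for z
  proof (rule invertible_perturb[OF y])
    have "norm (x - z) * (norm y + 1) < 1"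
      using that by (simp add: dist_norm pos_less_divide_eq add_nonneg_pos)
    then show "norm y * norm (x - z) < 1"
      by (smt (verit) norm_ge_zero distrib_left mult.commute mult_cancel_left1)
  qed
  then show "\<exists>T>0. ball x T \<subseteq> {x. two_sided_invertible x}"
    by (intro exI[of _ "1 / (norm y + 1)"]) (auto simp: add_nonneg_pos)
qed

definition alg_inverse :: "'a::ring_1 \<Rightarrow> 'a"
  where "alg_inverse x = (SOME y. x * y = 1 \<and> y * x = 1)"

lemma alg_inverse:
  assumes "two_sided_invertible x"
  shows "x * alg_inverse x = 1" "alg_inverse x * x = 1"
proof -
  have "x * alg_inverse x = 1 \<and> alg_inverse x * x = 1"
    unfolding alg_inverse_def using assms unfolding two_sided_invertible_def by (rule someI_ex)
  then show "x * alg_inverse x = 1" "alg_inverse x * x = 1" by blast+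
qed

lemma isCont_alg_inverse:
  fixes x :: "'a::complex_banach_algebra_1"
  assumes "two_sided_invertible x"
  shows "isCont alg_inverse x"
proof -
  define y where "y = alg_inverse x"
  have y: "x * y = 1" "y * x = 1" using alg_inverse[OF assms] unfolding y_def by auto
  have ev: "\<forall>\<^sub>F z in at x. norm (alg_inverse z - y) \<le> 2 * norm y * norm y * norm (x - z)"
  proof -
    have "((\<lambda>z. norm y * norm (x - z)) \<longlongrightarrow> norm y * norm (x - x)) (at x)"
      by (intro tendsto_intros)
    then have "\<forall>\<^sub>F z in at x. norm y * norm (x - z) < 1/2"
      by (rule order_tendstoD) simp
    then show ?thesis
    proof eventually_elim
      case (elim z)
      then have "two_sided_invertible z" using invertible_perturb[OF y] by simp
      note w = alg_inverse[OF this]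
      define w where "w = alg_inverse z"
      \<comment> \<open>This identity bounds \<open>norm w\<close> by
        \<open>norm y + norm w / 2\<close>, so the unknown \<open>norm w\<close> is absorbed; used a
        second time, it gives the linear estimate.\<close>
      have "w - y = w * (x - z) * y"
        using w y unfolding w_def[symmetric] by (simp add: algebra_simps)
      then have le: "norm (w - y) \<le> norm w * norm (x - z) * norm y"
        by (metis norm_mult_ineq mult_right_mono norm_ge_zero order_trans)
      also have "\<dots> \<le> norm w * (1/2)"
        using elim by (metis less_imp_le mult.assoc mult.commute mult_left_mono norm_ge_zero)
      finally have "norm w \<le> 2 * norm y"
        using norm_triangle_sub[of w y] by simp
      then have "norm w * (norm (x - z) * norm y) \<le> 2 * norm y * (norm (x - z) * norm y)"
        by (intro mult_right_mono) auto
      then show ?case using le unfolding w_def by (simp add: mult_ac)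
    qed
  qed
  have "((\<lambda>z. 2 * norm y * norm y * norm (x - z)) \<longlongrightarrow> 2 * norm y * norm y * norm (x - x)) (at x)"
    by (intro tendsto_intros)
  then have "((\<lambda>z. alg_inverse z - y) \<longlongrightarrow> 0) (at x)"
    using Lim_null_comparison[OF ev] by simp
  then show ?thesis unfolding isCont_def y_def using LIM_zero_iff by blast
qed

text \<open>Complex scaling becomes real scaling and multiplication by the fixed element
  \<open>\<i> *\<^sub>C 1\<close>, so the limit rules of real normed algebras carry over to
  \<open>scaleC\<close>.\<close>

lemma scaleC_Re_Im: "c *\<^sub>C (x::'a::complex_banach_algebra_1) = Re c *\<^sub>R x + Im c *\<^sub>R ((\<i> *\<^sub>C 1) * x)"
proof -
  have "c *\<^sub>C x = (of_real (Re c) + of_real (Im c) * \<i>) *\<^sub>C x"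
    by (metis complex_eq mult.commute)
  then show ?thesis
    by (simp add: scaleR_eq_scaleC scaleC_add_left scaleC_scaleC mult_scaleC_left)
qed

lemma tendsto_scaleC [tendsto_intros]:
  fixes g :: "'b \<Rightarrow> 'a::complex_banach_algebra_1"
  assumes "(f \<longlongrightarrow> c) F" "(g \<longlongrightarrow> x) F"
  shows "((\<lambda>t. f t *\<^sub>C g t) \<longlongrightarrow> c *\<^sub>C x) F"
proof -
  have "((\<lambda>t. Re (f t) *\<^sub>R g t + Im (f t) *\<^sub>R ((\<i> *\<^sub>C 1) * g t))
      \<longlongrightarrow> Re c *\<^sub>R x + Im c *\<^sub>R ((\<i> *\<^sub>C 1) * x)) F"
    by (intro tendsto_intros assms)
  then show ?thesis by (simp only: scaleC_Re_Im[symmetric])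
qed

lemma continuous_on_scaleC [continuous_intros]:
  fixes g :: "'b::topological_space \<Rightarrow> 'a::complex_banach_algebra_1"
  shows "continuous_on S f \<Longrightarrow> continuous_on S g \<Longrightarrow> continuous_on S (\<lambda>t. f t *\<^sub>C g t)"
  unfolding continuous_on_def by (auto intro: tendsto_scaleC)

lemma sum_scaleC_right: "c *\<^sub>C (\<Sum>i\<in>I. f i) = (\<Sum>i\<in>I. c *\<^sub>C (f i :: 'a::complex_banach_algebra_1))"
  by (rule cvec.scale_sum_right)

lemma power_scaleC: "(c *\<^sub>C (x::'a::complex_banach_algebra_1)) ^ n = c ^ n *\<^sub>C x ^ n"
  by (induction n) (simp_all add: mult_scaleC_left mult_scaleC_right scaleC_scaleC)

section \<open>Roots of unity and averaged resolvents\<close>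

definition unity_root :: "nat \<Rightarrow> nat \<Rightarrow> complex"
  where "unity_root n k = cis (2 * pi * real k / real n)"

lemma norm_unity_root [simp]: "cmod (unity_root n k) = 1"
  by (simp add: unity_root_def)

lemma unity_root_power: "unity_root n k ^ n = 1" if "0 < n"
proof -
  have "unity_root n k ^ n = cis (2 * pi * real k)"
    unfolding unity_root_def using that by (simp add: Complex.DeMoivre)
  also have "\<dots> = 1" by (metis cis_multiple_2pi mult.commute Ints_of_nat)
  finally show ?thesis .
qed

text \<open>\<open>unity_root n k ^ j\<close> equals \<open>unity_root n j ^ k\<close>, so this is a
  geometric sum whose ratio differs from 1 when 0 < j < n.\<close>

lemma sum_unity_root_power:
  assumes "j < n"
  shows "(\<Sum>k<n. unity_root n k ^ j) = (if j = 0 then of_nat n else 0)"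
proof (cases "j = 0")
  case False
  have "unity_root n j \<noteq> 1"
  proof
    assume "unity_root n j = 1"
    then have "exp (2 * of_real pi * \<i> * of_nat j / of_nat n) = (1::complex)"
      unfolding unity_root_def cis_conv_exp by (simp add: mult_ac)
    then have "n dvd j" using complex_root_unity_eq_1[of n j] assms by simp
    then show False using assms False by (auto dest: dvd_imp_le)
  qed
  have "(\<Sum>k<n. unity_root n k ^ j) = (\<Sum>k<n. unity_root n j ^ k)"
    unfolding unity_root_def by (intro sum.cong) (auto simp: Complex.DeMoivre mult_ac)
  also have "\<dots> = 0" using geometric_sum[OF \<open>unity_root n j \<noteq> 1\<close>, of n] unity_root_power assms by simp
  finally show ?thesis using False by simp
qed simp

lemma dist_cis_le: "cmod (cis a - cis b) \<le> \<bar>a - b\<bar>"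
proof -
  have "cis a - cis b = cis b * (cis (a - b) - 1)"
    by (simp add: cis_mult algebra_simps)
  then have "cmod (cis a - cis b) = cmod (exp (\<i> * of_real (a - b)) - 1)"
    by (simp add: norm_mult cis_conv_exp)
  also have "\<dots> = 2 * \<bar>sin ((a - b) / 2)\<bar>" using dist_exp_i_1 by blast
  also have "\<dots> \<le> \<bar>a - b\<bar>" using abs_sin_x_le_abs_x[of "(a - b) / 2"] by simp
  finally show ?thesis .
qed

definition resolvent_mean :: "'a::complex_banach_algebra_1 \<Rightarrow> real \<Rightarrow> nat \<Rightarrow> 'a" where
  "resolvent_mean x t n =
    (1 / real n) *\<^sub>R (\<Sum>k<n. alg_inverse (1 - (complex_of_real t * unity_root n k) *\<^sub>C x))"

text \<open>All points \<open>y k\<close> have the same n-th power, so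
  \<open>1 - (t *\<^sub>R x) ^ n\<close> times each resolvent is the sum of the powers of
  \<open>y k\<close> below n. Adding over k, orthogonality of the roots of unity leaves only n
  copies of the power 0.\<close>

lemma resolvent_mean_inverse:
  fixes x :: "'a::complex_banach_algebra_1"
  assumes n: "0 < n" and inv: "\<And>k. k < n \<Longrightarrow> two_sided_invertible (1 - (complex_of_real t * unity_root n k) *\<^sub>C x)"
  shows "(1 - (t *\<^sub>R x) ^ n) * resolvent_mean x t n = 1"
    and "resolvent_mean x t n * (1 - (t *\<^sub>R x) ^ n) = 1"
proof -
  define y where "y k = (complex_of_real t * unity_root n k) *\<^sub>C x" for k
  define g where "g k = alg_inverse (1 - y k)" for k
  have g: "(1 - y k) * g k = 1" "g k * (1 - y k) = 1" if "k < n" for k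
    using alg_inverse[OF inv[OF that]] unfolding y_def g_def by auto
  have yn: "y k ^ n = (t *\<^sub>R x) ^ n" for k
    unfolding y_def by (simp add: power_scaleC power_mult_distrib unity_root_power[OF n] scaleR_eq_scaleC)
  have l: "(1 - (t *\<^sub>R x) ^ n) * g k = (\<Sum>j<n. y k ^ j)" if "k < n" for k
    using one_minus_mult_sum_power(2)[of "y k" n] g(1)[OF that] yn[of k] by (metis mult.assoc mult_1_right)
  have r: "g k * (1 - (t *\<^sub>R x) ^ n) = (\<Sum>j<n. y k ^ j)" if "k < n" for k
    using one_minus_mult_sum_power(1)[of "y k" n] g(2)[OF that] yn[of k] by (metis mult.assoc mult_1_left)
  have "(\<Sum>k<n. \<Sum>j<n. y k ^ j) = (\<Sum>j<n. \<Sum>k<n. y k ^ j)" by (rule sum.swap)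
  also have "\<dots> = (\<Sum>j<n. (\<Sum>k<n. unity_root n k ^ j) *\<^sub>C ((complex_of_real t ^ j) *\<^sub>C x ^ j))"
    unfolding y_def by (simp add: power_scaleC power_mult_distrib cvec.scale_sum_left sum_distrib_left mult_ac)
  also have "\<dots> = (\<Sum>j<n. if j = 0 then of_nat n *\<^sub>C 1 else 0)"
    by (intro sum.cong refl) (auto simp: sum_unity_root_power)
  also have "\<dots> = real n *\<^sub>R 1" using n by (simp add: scaleR_eq_scaleC)
  finally have total: "(\<Sum>k<n. \<Sum>j<n. y k ^ j) = real n *\<^sub>R 1" .
  have F: "resolvent_mean x t n = (1 / real n) *\<^sub>R (\<Sum>k<n. g k)"
    unfolding resolvent_mean_def g_def y_def ..
  have "(1 - (t *\<^sub>R x) ^ n) * (\<Sum>k<n. g k) = real n *\<^sub>R 1"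
    unfolding sum_distrib_left total[symmetric] using l by (intro sum.cong) auto
  then show "(1 - (t *\<^sub>R x) ^ n) * resolvent_mean x t n = 1" using n unfolding F by simp
  have "(\<Sum>k<n. g k) * (1 - (t *\<^sub>R x) ^ n) = real n *\<^sub>R 1"
    unfolding sum_distrib_right total[symmetric] using r by (intro sum.cong) auto
  then show "resolvent_mean x t n * (1 - (t *\<^sub>R x) ^ n) = 1" using n unfolding F by simp
qed

text \<open>The variable z stands for the reciprocal of a spectral parameter, so
  \<open>s0 = 0\<close> is allowed. A whole annulus is required, since idempotency and constancy of
  the limit come from comparing two radii.\<close>

locale spectral_gap =
  fixes x :: "'a::complex_banach_algebra_1" and s0 t0 :: real
  assumes s0: "0 \<le> s0" "s0 < t0"
    and gap: "\<And>z. s0 \<le> cmod z \<Longrightarrow> cmod z \<le> t0 \<Longrightarrow> two_sided_invertible (1 - z *\<^sub>C x)"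
begin

abbreviation "F \<equiv> resolvent_mean x"

lemma gap_unity_root: "s0 \<le> t \<Longrightarrow> t \<le> t0 \<Longrightarrow> two_sided_invertible (1 - (complex_of_real t * unity_root n k) *\<^sub>C x)"
  using s0 by (intro gap) (auto simp: norm_mult)

lemma resolvent_uniformly_continuous:
  assumes "0 < \<epsilon>"
  obtains \<delta> where "0 < \<delta>"
    "\<And>z w. s0 \<le> cmod z \<Longrightarrow> cmod z \<le> t0 \<Longrightarrow> s0 \<le> cmod w \<Longrightarrow> cmod w \<le> t0 \<Longrightarrow> cmod (z - w) < \<delta> \<Longrightarrow>
      norm (alg_inverse (1 - z *\<^sub>C x) - alg_inverse (1 - w *\<^sub>C x)) \<le> \<epsilon>"
proof -
  define K where "K = {z::complex. s0 \<le> cmod z \<and> cmod z \<le> t0}"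
  have "K = cball 0 t0 - ball 0 s0" unfolding K_def by auto
  then have "compact K" by (simp add: compact_diff)
  have "continuous_on K (\<lambda>z. alg_inverse (1 - z *\<^sub>C x))"
  proof (rule continuous_on_compose2[of "{y. two_sided_invertible y}" alg_inverse K "\<lambda>z. 1 - z *\<^sub>C x"])
    show "continuous_on {y :: 'a. two_sided_invertible y} alg_inverse"
      using isCont_alg_inverse by (auto intro: continuous_at_imp_continuous_on)
    show "continuous_on K (\<lambda>z. 1 - z *\<^sub>C x)" by (intro continuous_intros)
  qed (use gap in \<open>auto simp: K_def\<close>)
  then have "uniformly_continuous_on K (\<lambda>z. alg_inverse (1 - z *\<^sub>C x))"
    using \<open>compact K\<close> by (rule compact_uniformly_continuous)
  then obtain \<delta> where "0 < \<delta>" "\<And>z w. z \<in> K \<Longrightarrow> w \<in> K \<Longrightarrow> dist w z < \<delta> \<Longrightarrow>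
      dist (alg_inverse (1 - w *\<^sub>C x)) (alg_inverse (1 - z *\<^sub>C x)) < \<epsilon>"
    unfolding uniformly_continuous_on_def using assms by metis
  then show ?thesis
    by (intro that[of \<delta>]) (auto simp: K_def dist_norm less_imp_le)
qed

lemma norm_mean_le:
  assumes "0 < n" "\<And>k. k < n \<Longrightarrow> norm (f k :: 'a) \<le> \<epsilon>"
  shows "norm ((1 / real n) *\<^sub>R (\<Sum>k<n. f k)) \<le> \<epsilon>"
proof -
  have "norm (\<Sum>k<n. f k) \<le> real n * \<epsilon>"
    using sum_norm_le[of "{..<n}" f "\<lambda>_. \<epsilon>"] assms by simp
  then show ?thesis using assms(1) by (simp add: divide_simps mult.commute)
qed

text \<open>One \<open>\<delta>\<close> serves all n; this is what makes the pointwise limit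
  continuous in the radius.\<close>

lemma resolvent_mean_equicontinuous:
  assumes "0 < \<epsilon>"
  obtains \<delta> where "0 < \<delta>"
    "\<And>n s t. 0 < n \<Longrightarrow> s \<in> {s0..t0} \<Longrightarrow> t \<in> {s0..t0} \<Longrightarrow> \<bar>s - t\<bar> < \<delta> \<Longrightarrow> norm (F s n - F t n) \<le> \<epsilon>"
proof -
  obtain \<delta> where \<delta>: "0 < \<delta>"
    "\<And>z w. s0 \<le> cmod z \<Longrightarrow> cmod z \<le> t0 \<Longrightarrow> s0 \<le> cmod w \<Longrightarrow> cmod w \<le> t0 \<Longrightarrow> cmod (z - w) < \<delta> \<Longrightarrow>
      norm (alg_inverse (1 - z *\<^sub>C x) - alg_inverse (1 - w *\<^sub>C x)) \<le> \<epsilon>"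
    using resolvent_uniformly_continuous[OF assms] by blast
  have "norm (F s n - F t n) \<le> \<epsilon>" if "0 < n" "s \<in> {s0..t0}" "t \<in> {s0..t0}" "\<bar>s - t\<bar> < \<delta>" for n s t
  proof -
    have eq: "F s n - F t n = (1 / real n) *\<^sub>R (\<Sum>k<n. alg_inverse (1 - (complex_of_real s * unity_root n k) *\<^sub>C x)
        - alg_inverse (1 - (complex_of_real t * unity_root n k) *\<^sub>C x))"
      unfolding resolvent_mean_def by (simp only: scaleR_diff_right sum_subtractf)
    show ?thesis unfolding eq
    proof (rule norm_mean_le[OF that(1)], rule \<delta>(2))
      fix k
      have "complex_of_real s * unity_root n k - complex_of_real t * unity_root n k = complex_of_real (s - t) * unity_root n k"
        by (simp add: algebra_simps)
      then show "cmod (complex_of_real s * unity_root n k - complex_of_real t * unity_root n k) < \<delta>"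
        using that(4) by (simp add: norm_mult del: of_real_diff)
    qed (use that s0 in \<open>auto simp: norm_mult\<close>)
  qed
  then show ?thesis using that \<delta>(1) by blast
qed

text \<open>The grid of n * m points refines that of n points: each coarse point is compared with
  the m fine points that start at it. Grids of sizes n and m can then both be compared with the grid
  of size n * m, which gives the Cauchy property.\<close>

lemma resolvent_mean_refine:
  assumes "0 < \<epsilon>"
  obtains N where "0 < N"
    "\<And>n m t. N \<le> n \<Longrightarrow> 0 < m \<Longrightarrow> t \<in> {s0..t0} \<Longrightarrow> norm (F t (n * m) - F t n) \<le> \<epsilon>"
proof -
  obtain \<delta> where \<delta>: "0 < \<delta>"
    "\<And>z w. s0 \<le> cmod z \<Longrightarrow> cmod z \<le> t0 \<Longrightarrow> s0 \<le> cmod w \<Longrightarrow> cmod w \<le> t0 \<Longrightarrow> cmod (z - w) < \<delta> \<Longrightarrow>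
      norm (alg_inverse (1 - z *\<^sub>C x) - alg_inverse (1 - w *\<^sub>C x)) \<le> \<epsilon>"
    using resolvent_uniformly_continuous[OF assms] by blast
  \<comment> \<open>For n at least \<open>N\<close>, an arc of angle 2 pi / n on the largest circle
    is shorter than \<open>\<delta>\<close>.\<close>
  obtain N where N: "0 < N" "t0 * 2 * pi / \<delta> < real N"
    by (metis gr0I reals_Archimedean2 of_nat_0_less_iff less_trans not_less_iff_gr_or_eq of_nat_0 zero_less_Suc of_nat_Suc less_add_one order_less_trans add.commute)
  have "norm (F t (n * m) - F t n) \<le> \<epsilon>" if "N \<le> n" "0 < m" "t \<in> {s0..t0}" for n m t
  proof -
    have n: "0 < n" using that N by auto
    define g where "g z = alg_inverse (1 - (complex_of_real t * z) *\<^sub>C x)" for z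
    have "F t (n * m) = (1 / real n) *\<^sub>R ((1 / real m) *\<^sub>R (\<Sum>i<n * m. g (unity_root (n * m) i)))"
      unfolding resolvent_mean_def g_def by (simp add: mult.commute)
    also have "(\<Sum>i<n * m. g (unity_root (n * m) i)) = (\<Sum>k<n. \<Sum>i = k * m..<k * m + m. g (unity_root (n * m) i))"
      by (rule sum.nat_group[symmetric])
    also have "\<dots> = (\<Sum>k<n. \<Sum>j<m. g (unity_root (n * m) (k * m + j)))"
    proof (rule sum.cong[OF refl])
      fix k
      show "(\<Sum>i = k * m..<k * m + m. g (unity_root (n * m) i)) = (\<Sum>j<m. g (unity_root (n * m) (k * m + j)))"
        using sum.shift_bounds_nat_ivl[of "\<lambda>i. g (unity_root (n * m) i)" 0 "k * m" m]
        by (simp add: atLeast0LessThan add.commute)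
    qed
    finally have Fnm: "F t (n * m) = (1 / real n) *\<^sub>R (\<Sum>k<n. (1 / real m) *\<^sub>R (\<Sum>j<m. g (unity_root (n * m) (k * m + j))))"
      by (simp add: scaleR_sum_right)
    have Fn: "F t n = (1 / real n) *\<^sub>R (\<Sum>k<n. (1 / real m) *\<^sub>R (\<Sum>j<m. g (unity_root n k)))"
      unfolding resolvent_mean_def g_def using that by (simp add: sum_constant_scaleR del: sum_constant)
    have eq: "F t (n * m) - F t n = (1 / real n) *\<^sub>R (\<Sum>k<n. (1 / real m) *\<^sub>R
        (\<Sum>j<m. g (unity_root (n * m) (k * m + j)) - g (unity_root n k)))"
      unfolding Fn Fnm by (simp only: scaleR_diff_right sum_subtractf)
    show ?thesis unfolding eq
    proof (intro norm_mean_le[OF n] norm_mean_le[OF that(2)])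
      fix k j assume "k < n" "j < m"
      have ang: "2 * pi * real (k * m + j) / real (n * m) - 2 * pi * real k / real n = 2 * pi * real j / (real n * real m)"
        using n that by (simp add: field_simps)
      have "cmod (unity_root (n * m) (k * m + j) - unity_root n k) \<le> 2 * pi * real j / (real n * real m)"
        unfolding unity_root_def using dist_cis_le ang by (smt (verit) divide_nonneg_nonneg mult_nonneg_nonneg of_nat_0_le_iff pi_ge_zero)
      also have "\<dots> \<le> 2 * pi / real n"
        using \<open>j < m\<close> n by (simp add: field_simps)
      finally have "cmod (unity_root (n * m) (k * m + j) - unity_root n k) \<le> 2 * pi / real n" .
      then have "t * cmod (unity_root (n * m) (k * m + j) - unity_root n k) \<le> t0 * (2 * pi / real n)"
        using that s0 by (intro mult_mono) auto
      also have "\<dots> < \<delta>"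
      proof -
        have "t0 * 2 * pi < \<delta> * real N" using N \<delta>(1) by (simp add: pos_divide_less_eq mult.commute)
        also have "\<dots> \<le> \<delta> * real n" using that \<delta>(1) by simp
        finally show ?thesis using n by (simp add: pos_divide_less_eq)
      qed
      finally have d: "t * cmod (unity_root (n * m) (k * m + j) - unity_root n k) < \<delta>" .
      show "norm (g (unity_root (n * m) (k * m + j)) - g (unity_root n k)) \<le> \<epsilon>"
        unfolding g_def
      proof (rule \<delta>(2))
        show "cmod (complex_of_real t * unity_root (n * m) (k * m + j) - complex_of_real t * unity_root n k) < \<delta>"
          unfolding right_diff_distrib[symmetric] norm_mult using d that s0 by simp
      qed (use that s0 in \<open>auto simp: norm_mult\<close>)
    qed
  qed
  then show ?thesis using that N(1) by blast
qed

text \<open>When the means converge, this is 1/(2 pi i) times the integral of (1 - z x)^{-1} / z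
  over |z| = t, the Riesz idempotent of the part of the spectrum of modulus below 1/t.\<close>

definition riesz_limit :: "real \<Rightarrow> 'a" where "riesz_limit t = lim (F t)"

lemma resolvent_mean_tendsto:
  assumes t: "t \<in> {s0..t0}"
  shows "F t \<longlonglongrightarrow> riesz_limit t"
proof -
  have "Cauchy (F t)"
  proof (rule metric_CauchyI)
    fix e :: real assume "0 < e"
    then obtain N where N: "0 < N" "\<And>n m. N \<le> n \<Longrightarrow> 0 < m \<Longrightarrow> norm (F t (n * m) - F t n) \<le> e / 3"
      using resolvent_mean_refine[of "e / 3"] t by (metis divide_pos_pos zero_less_numeral)
    have "dist (F t m) (F t n) < e" if "N \<le> m" "N \<le> n" for m n
    proof -
      have 1: "norm (F t (m * n) - F t m) \<le> e / 3" "norm (F t (n * m) - F t n) \<le> e / 3"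
        using N that by auto
      have "dist (F t m) (F t n) \<le> dist (F t m) (F t (m * n)) + dist (F t n) (F t (m * n))"
        by (rule dist_triangle2)
      also have "\<dots> \<le> e / 3 + e / 3"
        using 1 by (intro add_mono) (simp_all add: dist_norm norm_minus_commute mult.commute)
      finally show ?thesis using \<open>0 < e\<close> by simp
    qed
    then show "\<exists>M. \<forall>m\<ge>M. \<forall>n\<ge>M. dist (F t m) (F t n) < e" by blast
  qed
  then show ?thesis unfolding riesz_limit_def using Cauchy_convergent convergent_LIMSEQ_iff by blast
qed

lemma continuous_riesz_limit: "continuous_on {s0..t0} riesz_limit"
  unfolding continuous_on_iff
proof (intro ballI allI impI)
  fix t and e :: real assume t: "t \<in> {s0..t0}" and "0 < e"
  then obtain \<delta> where \<delta>: "0 < \<delta>"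
    "\<And>n s t. 0 < n \<Longrightarrow> s \<in> {s0..t0} \<Longrightarrow> t \<in> {s0..t0} \<Longrightarrow> \<bar>s - t\<bar> < \<delta> \<Longrightarrow> norm (F s n - F t n) \<le> e / 2"
    using resolvent_mean_equicontinuous[of "e / 2"] by (metis half_gt_zero)
  have "dist (riesz_limit s) (riesz_limit t) < e" if s: "s \<in> {s0..t0}" and "dist s t < \<delta>" for s
  proof -
    have "(\<lambda>n. norm (F s n - F t n)) \<longlonglongrightarrow> norm (riesz_limit s - riesz_limit t)"
      using resolvent_mean_tendsto s t by (intro tendsto_intros) auto
    then have "norm (riesz_limit s - riesz_limit t) \<le> e / 2"
      by (rule tendsto_upperbound)
        (use \<delta>(2)[OF _ s t] that in \<open>auto simp: dist_norm eventually_at_top_linorder intro!: exI[of _ 1]\<close>)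
    then show ?thesis using \<open>0 < e\<close> by (simp add: dist_norm)
  qed
  then show "\<exists>d>0. \<forall>x'\<in>{s0..t0}. dist x' t < d \<longrightarrow> dist (riesz_limit x') (riesz_limit t) < e" using \<delta>(1) by blast
qed

lemma resolvent_mean_inverse_power:
  assumes "t \<in> {s0..t0}" "0 < n"
  shows "(1 - (t *\<^sub>R x) ^ n) * F t n = 1" "F t n * (1 - (t *\<^sub>R x) ^ n) = 1"
  using resolvent_mean_inverse[OF assms(2) gap_unity_root] assms by auto

text \<open>With X = x^n, a = s^n, b = t^n the means are A = (1 - a X)^{-1} and B = (1 - b X)^{-1},
  and partial fractions give (b - a) A B = b B - a A. Hence A B - B is a / (b - a) times B - A, and
  a / (b - a) tends to 0 since s < t.\<close>

lemma riesz_limit_mult_less: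
  assumes s: "s \<in> {s0..t0}" and t: "t \<in> {s0..t0}" and "s < t"
  shows "riesz_limit s * riesz_limit t = riesz_limit t" "riesz_limit t * riesz_limit s = riesz_limit t"
proof -
  define q where "q = s / t"
  have q: "0 \<le> q" "q < 1" unfolding q_def using s t s0 \<open>s < t\<close> by auto
  have t0: "t > 0" using s s0 \<open>s < t\<close> by auto
  have id: "F s n * F t n - F t n = (q ^ n / (1 - q ^ n)) *\<^sub>R (F t n - F s n)"
    "F t n * F s n - F t n = (q ^ n / (1 - q ^ n)) *\<^sub>R (F t n - F s n)" if n: "0 < n" for n
  proof -
    define X where "X = x ^ n"
    define a b where "a = s ^ n" and "b = t ^ n"
    define A B where "A = F s n" and "B = F t n"
    have pw: "(c *\<^sub>R x) ^ n = c ^ n *\<^sub>R X" for c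
      unfolding X_def by (simp add: scaleR_eq_scaleC power_scaleC)
    have A: "A - a *\<^sub>R (X * A) = 1" "A - a *\<^sub>R (A * X) = 1"
      using resolvent_mean_inverse_power[OF s n] unfolding pw A_def a_def by (simp_all add: algebra_simps)
    have B: "B - b *\<^sub>R (X * B) = 1" "B - b *\<^sub>R (B * X) = 1"
      using resolvent_mean_inverse_power[OF t n] unfolding pw B_def b_def by (simp_all add: algebra_simps)
    have BA: "A * B - a *\<^sub>R (A * X * B) = B" using A(2) by (metis left_diff_distrib mult_1_left mult_scaleR_left)
    have AB: "A * B - b *\<^sub>R (A * X * B) = A" using B(1) by (metis right_diff_distrib mult_1_right mult_scaleR_right mult.assoc)
    have BA': "B * A - a *\<^sub>R (B * X * A) = B" using A(1) by (metis right_diff_distrib mult_1_right mult_scaleR_right mult.assoc)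
    have AB': "B * A - b *\<^sub>R (B * X * A) = A" using B(2) by (metis left_diff_distrib mult_1_left mult_scaleR_left)
    have ab: "a < b" unfolding a_def b_def using \<open>s < t\<close> n s s0 by (simp add: power_strict_mono)
    have "b *\<^sub>R B - a *\<^sub>R A = (b - a) *\<^sub>R (A * B)"
      using arg_cong[OF BA, of "\<lambda>z. b *\<^sub>R z"] arg_cong[OF AB, of "\<lambda>z. a *\<^sub>R z"] by (simp add: algebra_simps)
    then have 1: "(b - a) *\<^sub>R (A * B - B) = a *\<^sub>R (B - A)" by (simp add: algebra_simps)
    have "b *\<^sub>R B - a *\<^sub>R A = (b - a) *\<^sub>R (B * A)"
      using arg_cong[OF BA', of "\<lambda>z. b *\<^sub>R z"] arg_cong[OF AB', of "\<lambda>z. a *\<^sub>R z"] by (simp add: algebra_simps)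
    then have 2: "(b - a) *\<^sub>R (B * A - B) = a *\<^sub>R (B - A)" by (simp add: algebra_simps)
    have c: "q ^ n / (1 - q ^ n) = a / (b - a)"
      unfolding q_def a_def b_def using t0 by (simp add: power_divide divide_simps)
    have solve: "C - B = (a / (b - a)) *\<^sub>R (B - A)" if "(b - a) *\<^sub>R (C - B) = a *\<^sub>R (B - A)" for C
    proof -
      have "(1 / (b - a)) *\<^sub>R ((b - a) *\<^sub>R (C - B)) = (1 / (b - a)) *\<^sub>R (a *\<^sub>R (B - A))" using that by simp
      then show ?thesis using ab by simp
    qed
    show "F s n * F t n - F t n = (q ^ n / (1 - q ^ n)) *\<^sub>R (F t n - F s n)"
      "F t n * F s n - F t n = (q ^ n / (1 - q ^ n)) *\<^sub>R (F t n - F s n)"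
      using solve[OF 1] solve[OF 2] unfolding c A_def B_def by auto
  qed
  have "(\<lambda>n. q ^ n / (1 - q ^ n)) \<longlonglongrightarrow> 0 / (1 - 0)"
    using q by (intro tendsto_intros LIMSEQ_realpow_zero) auto
  then have r: "(\<lambda>n. (q ^ n / (1 - q ^ n)) *\<^sub>R (F t n - F s n)) \<longlonglongrightarrow> 0"
    using tendsto_scaleR[OF _ tendsto_diff[OF resolvent_mean_tendsto[OF t] resolvent_mean_tendsto[OF s]]] by fastforce
  have "(\<lambda>n. F s n * F t n - F t n) \<longlonglongrightarrow> 0" "(\<lambda>n. F t n * F s n - F t n) \<longlonglongrightarrow> 0"
    by (rule Lim_transform_eventually[OF r], use id in \<open>auto simp: eventually_at_top_linorder intro!: exI[of _ 1]\<close>)+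
  moreover have "(\<lambda>n. F s n * F t n - F t n) \<longlonglongrightarrow> riesz_limit s * riesz_limit t - riesz_limit t" "(\<lambda>n. F t n * F s n - F t n) \<longlonglongrightarrow> riesz_limit t * riesz_limit s - riesz_limit t"
    using resolvent_mean_tendsto s t by (auto intro!: tendsto_intros)
  ultimately show "riesz_limit s * riesz_limit t = riesz_limit t" "riesz_limit t * riesz_limit s = riesz_limit t"
    using LIMSEQ_unique by fastforce+
qed

text \<open>By continuity, the second radius tends to the first in
  \<open>riesz_limit_mult_less\<close>. At \<open>t0\<close> it can only approach from below;
  elsewhere it is taken from above.\<close>

lemma riesz_limit_idem:
  assumes t: "t \<in> {s0..t0}"
  shows "riesz_limit t * riesz_limit t = riesz_limit t"
proof -
  have lim: "((\<lambda>s. riesz_limit s) \<longlongrightarrow> riesz_limit t) (at t within {s0..t0})"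
    using continuous_riesz_limit t unfolding continuous_on_def by blast
  show ?thesis
  proof (cases "t = t0")
    case True
    have nt: "at t0 within {s0..t0} \<noteq> bot" using s0 by (simp add: at_within_Icc_at_left)
    have "((\<lambda>s. riesz_limit s * riesz_limit t) \<longlongrightarrow> riesz_limit t * riesz_limit t) (at t0 within {s0..t0})"
      using lim True by (intro tendsto_intros) auto
    moreover have "((\<lambda>s. riesz_limit s * riesz_limit t) \<longlongrightarrow> riesz_limit t) (at t0 within {s0..t0})"
      by (rule tendsto_eventually) (use riesz_limit_mult_less t True in \<open>auto simp: eventually_at_filter\<close>)
    ultimately show ?thesis using nt tendsto_unique by blast
  next
    case False
    have nt: "at t within {t..t0} \<noteq> bot" using False t by (simp add: at_within_Icc_at_right)
    have lim': "((\<lambda>s. riesz_limit s) \<longlongrightarrow> riesz_limit t) (at t within {t..t0})"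
      using lim by (rule tendsto_within_subset) (use t in auto)
    then have "((\<lambda>s. riesz_limit t * riesz_limit s) \<longlongrightarrow> riesz_limit t * riesz_limit t) (at t within {t..t0})"
      by (intro tendsto_intros)
    moreover have "((\<lambda>s. riesz_limit t * riesz_limit s - riesz_limit s) \<longlongrightarrow> 0) (at t within {t..t0})"
      by (rule tendsto_eventually) (use riesz_limit_mult_less t in \<open>auto simp: eventually_at_filter\<close>)
    ultimately have "((\<lambda>s. riesz_limit t * riesz_limit s - (riesz_limit t * riesz_limit s - riesz_limit s)) \<longlongrightarrow> riesz_limit t * riesz_limit t - 0) (at t within {t..t0})"
      by (rule tendsto_diff)
    then show ?thesis using lim' nt tendsto_unique by fastforce
  qed
qed

lemma small_idempotent:
  fixes d :: 'a
  assumes "d * d = d" "norm d < 1"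
  shows "d = 0"
proof -
  obtain c where "(1 - d) * c = 1" using neumann_invertible[OF assms(2)] unfolding two_sided_invertible_def by blast
  moreover have "d * (1 - d) = 0" using assms(1) by (simp add: right_diff_distrib)
  ultimately show ?thesis by (metis mult.assoc mult_1_right mult_zero_left)
qed

text \<open>For s < t the product rules make \<open>riesz_limit s - riesz_limit t\<close>
  idempotent. Nearby values therefore differ by an idempotent of norm below 1, that is, by 0, and a
  locally constant function on an interval is constant.\<close>

lemma riesz_limit_const:
  assumes "s \<in> {s0..t0}" "t \<in> {s0..t0}"
  shows "riesz_limit s = riesz_limit t"
proof (rule connected_local_const[OF _ assms])
  show "connected {s0..t0}" by simp
  show "\<forall>a\<in>{s0..t0}. \<forall>\<^sub>F b in at a within {s0..t0}. riesz_limit a = riesz_limit b"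
  proof
    fix a assume a: "a \<in> {s0..t0}"
    have "((\<lambda>s. riesz_limit s) \<longlongrightarrow> riesz_limit a) (at a within {s0..t0})"
      using continuous_riesz_limit a unfolding continuous_on_def by blast
    then have "\<forall>\<^sub>F b in at a within {s0..t0}. dist (riesz_limit b) (riesz_limit a) < 1" by (rule tendstoD) simp
    moreover have "\<forall>\<^sub>F b in at a within {s0..t0}. b \<in> {s0..t0}" by (simp add: eventually_at_filter)
    ultimately show "\<forall>\<^sub>F b in at a within {s0..t0}. riesz_limit a = riesz_limit b"
    proof eventually_elim
      case (elim b)
      have "(riesz_limit a - riesz_limit b) * (riesz_limit a - riesz_limit b) = riesz_limit a - riesz_limit b \<or> (riesz_limit b - riesz_limit a) * (riesz_limit b - riesz_limit a) = riesz_limit b - riesz_limit a"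
      proof (rule linorder_cases[of a b])
        assume "a < b"
        then show ?thesis using riesz_limit_mult_less[OF a elim(2)] riesz_limit_idem a elim(2) by (simp add: algebra_simps)
      next
        assume "b < a"
        then show ?thesis using riesz_limit_mult_less[OF elim(2) a] riesz_limit_idem a elim(2) by (simp add: algebra_simps)
      qed simp
      then show ?case using small_idempotent elim(1)
        by (metis dist_norm dist_commute eq_iff_diff_eq_0)
    qed
  qed
qed

end

text \<open>The inverse of the n-th mean is \<open>1 - (t *\<^sub>R x) ^ n\<close> for n > 0, and
  inversion is continuous at 1.\<close>

lemma power_tendsto_0_if_resolvent_mean_tendsto_1:
  assumes "spectral_gap x s0 t0" "t \<in> {s0..t0}" "resolvent_mean x t \<longlonglongrightarrow> 1"
  shows "(\<lambda>n. (t *\<^sub>R x) ^ n) \<longlonglongrightarrow> 0"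
proof -
  interpret spectral_gap x s0 t0 by fact
  have "isCont alg_inverse (1::'a)" by (rule isCont_alg_inverse) (auto intro: two_sided_invertibleI[of 1 1])
  then have "(\<lambda>n. alg_inverse (F t n)) \<longlonglongrightarrow> alg_inverse 1"
    using assms(3) isCont_tendsto_compose by blast
  moreover have "alg_inverse (1::'a) = 1"
    using alg_inverse[of "1::'a"] two_sided_invertibleI[of "1::'a" 1] by simp
  moreover have "alg_inverse (F t n) = 1 - (t *\<^sub>R x) ^ n" if "0 < n" for n
  proof -
    have "two_sided_invertible (F t n)" using resolvent_mean_inverse_power[OF assms(2) that] two_sided_invertibleI by blast
    from alg_inverse[OF this] resolvent_mean_inverse_power[OF assms(2) that] show ?thesis
      by (metis mult.assoc mult_1_left mult_1_right)
  qed
  ultimately have "(\<lambda>n. 1 - (t *\<^sub>R x) ^ n) \<longlonglongrightarrow> 1"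
    by (auto elim!: Lim_transform_eventually simp: eventually_at_top_linorder intro!: exI[of _ 1])
  then have "(\<lambda>n. 1 - (1 - (t *\<^sub>R x) ^ n)) \<longlonglongrightarrow> 1 - 1" by (intro tendsto_intros)
  then show ?thesis by simp
qed

text \<open>This stands in for the spectral radius formula: without nonzero spectrum the annulus may
  start at radius 0, where the means are 1, and the limit does not change up to radius t.\<close>

lemma power_tendsto_0_of_no_spectrum:
  fixes x :: "'a::complex_banach_algebra_1"
  assumes "nonzero_spectrum x = {}" "0 < t"
  shows "(\<lambda>n. (t *\<^sub>R x) ^ n) \<longlonglongrightarrow> 0"
proof -
  have inv: "two_sided_invertible (1 - z *\<^sub>C x)" for z
  proof (cases "z = 0")
    case True
    then show ?thesis using two_sided_invertibleI[of "1::'a" 1] by simp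
  next
    case False
    then show ?thesis using assms nonzero_spectrum_iff'[of "inverse z" x] by auto
  qed
  interpret spectral_gap x 0 t using inv \<open>0 < t\<close> by unfold_locales auto
  have "F 0 n = 1" if "0 < n" for n
    using resolvent_mean_inverse_power[of 0 n] \<open>0 < t\<close> that by (simp add: power_0_left)
  then have "F 0 \<longlonglongrightarrow> 1"
    by (intro tendsto_eventually) (auto simp: eventually_at_top_linorder intro!: exI[of _ 1])
  then have "riesz_limit 0 = 1" using resolvent_mean_tendsto[of 0] \<open>0 < t\<close> LIMSEQ_unique by auto
  then have "riesz_limit t = 1" using riesz_limit_const[of 0 t] \<open>0 < t\<close> by auto
  then have "F t \<longlonglongrightarrow> 1" using resolvent_mean_tendsto[of t] \<open>0 < t\<close> by auto
  then show ?thesis using power_tendsto_0_if_resolvent_mean_tendsto_1[of x 0 t t] spectral_gap_axioms \<open>0 < t\<close> by auto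
qed

section \<open>Minimal idempotents and the socle\<close>

text \<open>Lets a product equation act inside right-nested products once \<open>mult.assoc\<close>
  is used as a rewrite rule.\<close>

lemma mult_eq_assoc: "a * b = c \<Longrightarrow> a * (b * z) = c * (z :: 'a::semigroup_mult)"
  by (metis mult.assoc)

definition minimal_idempotent :: "'a::complex_banach_algebra_1 \<Rightarrow> bool" where
  "minimal_idempotent e \<longleftrightarrow> e \<noteq> 0 \<and> e * e = e \<and> (\<forall>x. \<exists>c. e * x * e = c *\<^sub>C e)"

lemma minimal_idempotentD:
  assumes "minimal_idempotent e"
  shows "e \<noteq> 0" "e * e = e" "e * (e * x) = e * x"
proof -
  show "e \<noteq> 0" and ee: "e * e = e" using assms unfolding minimal_idempotent_def by blast+
  show "e * (e * x) = e * x" using ee by (metis mult.assoc)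
qed

lemma minimal_idempotent_corner:
  assumes "minimal_idempotent e" "e * x = x" "x * e = x"
  obtains c where "x = c *\<^sub>C e"
  using assms unfolding minimal_idempotent_def by metis

text \<open>\<open>v * y * x * (v * y)\<close> is \<open>v * (y * x * v) * y\<close>, whose middle
  factor lies in the one-dimensional corner of \<open>e\<close>.\<close>

lemma minimal_idempotent_transfer:
  assumes e: "minimal_idempotent e" and "y * v = e" "v * e = v" "e * y = y"
  shows "minimal_idempotent (v * y)"
proof -
  note simps = mult.assoc assms(2-4) assms(2-4)[THEN mult_eq_assoc] minimal_idempotentD(2,3)[OF e]
  have "v * y * (v * y) = v * y" by (simp add: simps)
  moreover have "v * y \<noteq> 0"
  proof
    assume "v * y = 0"
    moreover have "e = y * (v * y) * v" by (simp add: simps)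
    ultimately show False using minimal_idempotentD(1)[OF e] by simp
  qed
  moreover have "\<exists>c. v * y * x * (v * y) = c *\<^sub>C (v * y)" for x
  proof -
    have "e * (y * x * v) = y * x * v" "y * x * v * e = y * x * v" by (simp_all add: simps)
    then obtain c where c: "y * x * v = c *\<^sub>C e" using minimal_idempotent_corner[OF e] by blast
    have "v * y * x * (v * y) = v * (y * x * v) * y" by (simp add: mult.assoc)
    also have "\<dots> = c *\<^sub>C (v * y)" unfolding c by (simp add: mult_scaleC_left mult_scaleC_right simps)
    finally show ?thesis ..
  qed
  ultimately show ?thesis unfolding minimal_idempotent_def by blast
qed

text \<open>From \<open>w ^ n * y ^ n = e\<close> for n > 0, the norm of \<open>e\<close> is at most
  that of \<open>(t *\<^sub>R y) ^ n\<close> with \<open>t = norm w + 1\<close>, and these powers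
  tend to 0. The summand 1 keeps t positive.\<close>

lemma quasinilpotent_no_left_inverse:
  fixes y :: "'a::complex_banach_algebra_1"
  assumes "nonzero_spectrum y = {}" "e * y = y" "w * y = e"
  shows "e = 0"
proof -
  define t where "t = norm w + 1"
  have t: "t > 0" unfolding t_def by (simp add: add_nonneg_pos)
  have wy: "w ^ Suc n * y ^ Suc n = e" for n
  proof (induction n)
    case (Suc n)
    have "w ^ Suc (Suc n) * y ^ Suc (Suc n) = w * (w ^ Suc n * y ^ Suc n) * y"
      unfolding power_Suc[of w "Suc n"] power_Suc2[of y "Suc n"] by (simp only: mult.assoc)
    also have "\<dots> = e" unfolding Suc using assms by (simp add: mult.assoc)
    finally show ?case .
  qed (use assms in simp)
  have le: "norm e \<le> norm ((t *\<^sub>R y) ^ Suc n)" for n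
  proof -
    have "norm e \<le> norm (w ^ Suc n) * norm (y ^ Suc n)"
      using norm_mult_ineq wy by metis
    also have "\<dots> \<le> norm w ^ Suc n * norm (y ^ Suc n)"
      by (intro mult_right_mono norm_power_Suc_le) auto
    also have "\<dots> \<le> t ^ Suc n * norm (y ^ Suc n)"
      unfolding t_def by (intro mult_right_mono power_mono) auto
    also have "\<dots> = norm ((t *\<^sub>R y) ^ Suc n)"
      using t by (simp only: scaleR_eq_scaleC power_scaleC norm_scaleC norm_power norm_of_real abs_of_pos)
    finally show ?thesis .
  qed
  have "(\<lambda>n. (t *\<^sub>R y) ^ Suc n) \<longlonglongrightarrow> 0"
    using power_tendsto_0_of_no_spectrum[OF assms(1) t] LIMSEQ_Suc by blast
  then have "(\<lambda>n. norm ((t *\<^sub>R y) ^ Suc n)) \<longlonglongrightarrow> 0" by (rule tendsto_norm_zero)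
  then have "norm e \<le> 0" using le by (intro LIMSEQ_le_const) auto
  then show ?thesis by simp
qed

text \<open>A Gelfand-Mazur argument in the corner of \<open>e\<close>: a nonzero y there has a
  nonzero spectral value \<mu> by \<open>quasinilpotent_no_left_inverse\<close>; if
  \<open>\<mu> *\<^sub>C e - y\<close> were nonzero, it would be invertible in the corner and \<mu>
  would not be spectral.\<close>

lemma minimal_idempotent_if_division:
  fixes e :: "'a::complex_banach_algebra_1"
  assumes e: "e * e = e" "e \<noteq> 0"
    and div: "\<And>y. e * y = y \<Longrightarrow> y * e = y \<Longrightarrow> y \<noteq> 0 \<Longrightarrow> \<exists>w. w * y = e"
  shows "minimal_idempotent e"
  unfolding minimal_idempotent_def
proof (intro conjI e allI)
  have div': "\<exists>w. w * y = e \<and> y * w = e \<and> e * w = w \<and> w * e = w" if y: "e * y = y" "y * e = y" "y \<noteq> 0" for y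
  proof -
    have l: "\<exists>w. w * z = e \<and> e * w = w \<and> w * e = w" if z: "e * z = z" "z * e = z" "z \<noteq> 0" for z
    proof -
      obtain w where "w * z = e" using div z by blast
      then have "e * w * e * z = e" "e * (e * w * e) = e * w * e" "e * w * e * e = e * w * e"
        using z e by (simp_all add: mult.assoc mult_eq_assoc[OF e(1)])
      then show ?thesis by blast
    qed
    \<comment> \<open>The left inverse \<open>w\<close> has a left inverse \<open>v\<close> of its
      own, and then \<open>v = y\<close>, so \<open>w\<close> is two-sided.\<close>
    obtain w where w: "w * y = e" "e * w = w" "w * e = w" using l y by blast
    then have "w \<noteq> 0" using e by auto
    then obtain v where v: "v * w = e" "v * e = v" using l w by blast
    have "v = v * (w * y)" using w v by simp
    also have "\<dots> = y" using v y by (simp add: mult.assoc[symmetric])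
    finally have "v = y" .
    then show ?thesis using v w by blast
  qed
  fix x
  define y where "y = e * x * e"
  have y: "e * y = y" "y * e = y" unfolding y_def using e by (simp_all add: mult.assoc mult_eq_assoc[OF e(1)])
  show "\<exists>c. e * x * e = c *\<^sub>C e"
  proof (cases "y = 0")
    case True
    then show ?thesis unfolding y_def by (intro exI[of _ 0]) simp
  next
    case False
    then obtain w where "w * y = e" using div y by blast
    then have "nonzero_spectrum y \<noteq> {}" using quasinilpotent_no_left_inverse y e by blast
    then obtain \<mu> where "\<mu> \<in> nonzero_spectrum y" by blast
    then have \<mu>: "\<mu> \<noteq> 0" "\<not> two_sided_invertible (\<mu> *\<^sub>C 1 - y)" by (simp_all add: nonzero_spectrum_iff)
    define z where "z = \<mu> *\<^sub>C e - y"
    have z: "e * z = z" "z * e = z"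
      unfolding z_def using y e by (simp_all add: algebra_simps mult_scaleC_left mult_scaleC_right)
    have "z = 0"
    proof (rule ccontr)
      assume "z \<noteq> 0"
      then obtain w where w: "w * z = e" "z * w = e" "e * w = w" "w * e = w" using div' z by blast
      \<comment> \<open>The inverse is glued from the corner inverse \<open>w\<close> and the scalar
        inverse on the complement \<open>1 - e\<close>.\<close>
      have dec: "\<mu> *\<^sub>C 1 - y = z + \<mu> *\<^sub>C (1 - e)"
        unfolding z_def by (simp add: cvec.scale_right_diff_distrib)
      have "(\<mu> *\<^sub>C 1 - y) * (w + inverse \<mu> *\<^sub>C (1 - e)) = 1" "(w + inverse \<mu> *\<^sub>C (1 - e)) * (\<mu> *\<^sub>C 1 - y) = 1"
        unfolding dec using w z e \<mu>(1)
        by (simp_all add: algebra_simps mult_scaleC_left mult_scaleC_right)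
      then show False using \<mu>(2) two_sided_invertibleI by blast
    qed
    then show ?thesis unfolding z_def y_def by (intro exI[of _ \<mu>]) simp
  qed
qed

section \<open>Orthogonal families of minimal idempotents\<close>

definition orthogonal_minimal :: "'a::complex_banach_algebra_1 set \<Rightarrow> bool" where
  "orthogonal_minimal E \<longleftrightarrow> finite E \<and> (\<forall>e\<in>E. minimal_idempotent e) \<and> (\<forall>e\<in>E. \<forall>f\<in>E. e \<noteq> f \<longrightarrow> e * f = 0)"

lemma orthogonal_minimal_empty [simp]: "orthogonal_minimal {}"
  by (simp add: orthogonal_minimal_def)

lemma orthogonal_minimalD:
  assumes "orthogonal_minimal E"
  shows "finite E" "e \<in> E \<Longrightarrow> minimal_idempotent e" "e \<in> E \<Longrightarrow> f \<in> E \<Longrightarrow> e \<noteq> f \<Longrightarrow> e * f = 0"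
  using assms unfolding orthogonal_minimal_def by auto

lemma orthogonal_minimal_sum:
  assumes "orthogonal_minimal E" "e \<in> E"
  shows "e * \<Sum>E = e" "\<Sum>E * e = e"
proof -
  have "e * \<Sum>E = (\<Sum>f\<in>E. if f = e then e else 0)"
    unfolding sum_distrib_left
    using assms by (intro sum.cong) (auto dest: orthogonal_minimalD minimal_idempotentD)
  then show "e * \<Sum>E = e" using assms by (simp add: orthogonal_minimalD)
  have "\<Sum>E * e = (\<Sum>f\<in>E. if f = e then e else 0)"
    unfolding sum_distrib_right
    using assms by (intro sum.cong) (auto dest: orthogonal_minimalD minimal_idempotentD)
  then show "\<Sum>E * e = e" using assms by (simp add: orthogonal_minimalD)
qed

lemma orthogonal_minimal_sum_subset:
  assumes "orthogonal_minimal E" "F \<subseteq> E"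
  shows "\<Sum>F * \<Sum>E = \<Sum>F" "\<Sum>E * \<Sum>F = \<Sum>F"
  using orthogonal_minimal_sum[OF assms(1)] assms(2)
  by (auto simp: sum_distrib_left[of "\<Sum>E"] sum_distrib_right[of _ _ "\<Sum>E"] intro!: sum.cong)

lemma orthogonal_minimal_sum_idem:
  assumes "orthogonal_minimal E"
  shows "\<Sum>E * \<Sum>E = \<Sum>E"
  using orthogonal_minimal_sum_subset[OF assms] by blast

lemma orthogonal_minimal_insert:
  assumes E: "orthogonal_minimal E" and f: "minimal_idempotent f" "f * \<Sum>E = 0" "\<Sum>E * f = 0"
  shows "orthogonal_minimal (insert f E)" "f \<notin> E" "\<Sum>(insert f E) = f + \<Sum>E"
proof -
  have *: "f * e = 0" "e * f = 0" if "e \<in> E" for e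
  proof -
    have "f * e = f * \<Sum>E * e" "e * f = e * (\<Sum>E * f)"
      using orthogonal_minimal_sum[OF E that] by (simp_all add: mult.assoc) (simp add: mult.assoc[symmetric])
    then show "f * e = 0" "e * f = 0" using f by simp_all
  qed
  then show "f \<notin> E" using minimal_idempotentD[OF f(1)] by metis
  then show "\<Sum>(insert f E) = f + \<Sum>E" using E by (simp add: orthogonal_minimalD)
  show "orthogonal_minimal (insert f E)" using E f(1) * unfolding orthogonal_minimal_def by auto
qed

lemma orthogonal_minimal_Un:
  assumes E: "orthogonal_minimal E" and F: "orthogonal_minimal F"
    and "\<Sum>E * \<Sum>F = 0" "\<Sum>F * \<Sum>E = 0"
  shows "orthogonal_minimal (E \<union> F)" "E \<inter> F = {}" "\<Sum>(E \<union> F) = \<Sum>E + \<Sum>F"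
proof -
  have *: "e * f = 0" "f * e = 0" if "e \<in> E" "f \<in> F" for e f
  proof -
    have "(e * \<Sum>E) * (\<Sum>F * f) = e * (\<Sum>E * \<Sum>F) * f" "(f * \<Sum>F) * (\<Sum>E * e) = f * (\<Sum>F * \<Sum>E) * e"
      by (simp_all only: mult.assoc)
    then show "e * f = 0" "f * e = 0"
      using orthogonal_minimal_sum[OF E that(1)] orthogonal_minimal_sum[OF F that(2)] assms(3,4) by simp_all
  qed
  then show dis: "E \<inter> F = {}"
    using minimal_idempotentD orthogonal_minimalD(2)[OF E] by (metis disjoint_iff)
  then show "\<Sum>(E \<union> F) = \<Sum>E + \<Sum>F"
    using E F by (simp add: orthogonal_minimalD sum.union_disjoint)
  show "orthogonal_minimal (E \<union> F)" using E F * unfolding orthogonal_minimal_def by auto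
qed

section \<open>Semisimplicity and minimal left ideals\<close>

lemma maximal_left_ideal_sum:
  assumes L: "maximal_left_ideal L" and x: "x \<notin> L"
  obtains l a where "l \<in> L" "1 = l + a * x"
proof -
  define M where "M = {l + a * x | l a. l \<in> L}"
  have sub: "cvec.subspace L" and mul: "\<And>a x. x \<in> L \<Longrightarrow> a * x \<in> L"
    using L unfolding maximal_left_ideal_def left_ideal_def by blast+
  have "left_ideal M"
    unfolding left_ideal_def cvec.subspace_def
  proof (intro conjI ballI allI)
    have "0 = 0 + 0 * x \<and> 0 \<in> L" using cvec.subspace_0[OF sub] by simp
    then show "0 \<in> M" unfolding M_def by blast
  next
    fix y z assume "y \<in> M" "z \<in> M"
    then obtain l a l' a' where "y = l + a * x" "z = l' + a' * x" "l \<in> L" "l' \<in> L" unfolding M_def by blast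
    then have "y + z = (l + l') + (a + a') * x" "l + l' \<in> L"
      using cvec.subspace_add[OF sub] by (auto simp: algebra_simps)
    then show "y + z \<in> M" unfolding M_def by blast
  next
    fix c y assume "y \<in> M"
    then obtain l a where "y = l + a * x" "l \<in> L" unfolding M_def by blast
    then have "c *\<^sub>C y = c *\<^sub>C l + (c *\<^sub>C a) * x" "c *\<^sub>C l \<in> L"
      using cvec.subspace_scale[OF sub] by (auto simp: mult_scaleC_left scaleC_add_right)
    then show "c *\<^sub>C y \<in> M" unfolding M_def by blast
  next
    fix b y assume "y \<in> M"
    then obtain l a where "y = l + a * x" "l \<in> L" unfolding M_def by blast
    then have "b * y = b * l + (b * a) * x" "b * l \<in> L" using mul by (auto simp: algebra_simps)
    then show "b * y \<in> M" unfolding M_def by blast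
  qed
  moreover have "L \<subseteq> M"
  proof
    fix l assume "l \<in> L"
    then have "l = l + 0 * x \<and> l \<in> L" by simp
    then show "l \<in> M" unfolding M_def by blast
  qed
  moreover have "x \<in> M"
  proof -
    have "x = 0 + 1 * x \<and> 0 \<in> L" using cvec.subspace_0[OF sub] by simp
    then show ?thesis unfolding M_def by blast
  qed
  ultimately have "M = UNIV" using L x unfolding maximal_left_ideal_def by blast
  then show ?thesis using that unfolding M_def by blast
qed

locale semisimple_algebra =
  fixes type :: "'a::complex_banach_algebra_1 itself"
  assumes radical: "(jacobson_radical :: 'a set) = {0}"
begin

text \<open>If a maximal left ideal L missed y, then 1 = l + a y with l in L; the hypothesis, moved
  from \<open>y * a\<close> to \<open>a * y\<close>, makes l invertible, so L would be
  everything.\<close>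

lemma radical_zero:
  fixes y :: 'a
  assumes "\<And>a. 1 \<notin> nonzero_spectrum (y * a)"
  shows "y = 0"
proof -
  have "y \<in> L" if L: "maximal_left_ideal L" for L
  proof (rule ccontr)
    assume "y \<notin> L"
    then obtain l a where l: "l \<in> L" "1 = l + a * y" using maximal_left_ideal_sum[OF L] by blast
    have "1 \<notin> nonzero_spectrum (a * y)" using assms[of a] nonzero_spectrum_mult_commute by metis
    then have "two_sided_invertible (1 - a * y)" by (simp add: nonzero_spectrum_iff)
    moreover have "1 - a * y = l" using l(2) by (metis add_diff_cancel_right')
    ultimately obtain c where "c * l = 1" unfolding two_sided_invertible_def by metis
    have id: "left_ideal L" using L unfolding maximal_left_ideal_def by blast
    then have "1 \<in> L" using l(1) \<open>c * l = 1\<close> unfolding left_ideal_def by metis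
    then have "b \<in> L" for b using id unfolding left_ideal_def by (metis mult_1_right)
    then show False using L unfolding maximal_left_ideal_def by blast
  qed
  then have "y \<in> jacobson_radical" unfolding jacobson_radical_def by blast
  then show ?thesis using radical by blast
qed

text \<open>If \<open>x * a * x = 0\<close> for all a, then each \<open>1 - x * a\<close> has the
  inverse \<open>1 + x * a\<close>, which puts x into the radical.\<close>

lemma semiprime:
  fixes x :: 'a
  assumes "x \<noteq> 0"
  obtains a where "x * a * x \<noteq> 0"
proof (rule ccontr)
  assume "\<not> thesis"
  then have z: "x * a * x = 0" for a using that by blast
  have "1 \<notin> nonzero_spectrum (x * a)" for a
  proof -
    have "(1 - x * a) * (1 + x * a) = 1 + x * a - x * a - (x * a * x) * a"
      "(1 + x * a) * (1 - x * a) = 1 + x * a - x * a - (x * a * x) * a"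
      by (simp_all add: algebra_simps)
    then have "(1 - x * a) * (1 + x * a) = 1" "(1 + x * a) * (1 - x * a) = 1" using z by simp_all
    then show ?thesis using two_sided_invertibleI by (simp add: nonzero_spectrum_iff) blast
  qed
  then show False using radical_zero assms by blast
qed

text \<open>Semiprimeness gives b with \<open>e * b * x\<close> nonzero, and this element of the
  corner of \<open>e\<close> is a nonzero multiple of \<open>e\<close>. In this way every nonzero
  vector of the module A e can be sent back to \<open>e\<close>.\<close>

lemma minimal_left_inverse:
  fixes x :: 'a
  assumes e: "minimal_idempotent e" and x: "x * e = x" "x \<noteq> 0"
  obtains y where "y * x = e" "e * y = y"
proof -
  obtain b where b: "x * b * x \<noteq> 0" using semiprime x by blast
  have "e * (e * b * x) = e * b * x" "e * b * x * e = e * b * x"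
    using x minimal_idempotentD(2,3)[OF e] by (simp_all add: mult.assoc)
  then obtain c where c: "e * b * x = c *\<^sub>C e" using minimal_idempotent_corner[OF e] by blast
  have "c \<noteq> 0"
  proof
    assume "c = 0"
    then have "x * (e * b * x) = 0" using c by simp
    then show False using b by (simp add: mult.assoc mult_eq_assoc[OF x(1)])
  qed
  have "(inverse c *\<^sub>C (e * b)) * x = e" using c \<open>c \<noteq> 0\<close> by (simp add: mult_scaleC_left)
  moreover have "e * (inverse c *\<^sub>C (e * b)) = inverse c *\<^sub>C (e * b)"
    using minimal_idempotentD(2,3)[OF e] by (simp add: mult_scaleC_right)
  ultimately show ?thesis using that by blast
qed

lemma minimal_right_inverse:
  fixes x :: 'a
  assumes e: "minimal_idempotent e" and x: "e * x = x" "x \<noteq> 0"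
  obtains y where "x * y = e" "y * e = y"
proof -
  obtain b where b: "x * b * x \<noteq> 0" using semiprime x by blast
  have "e * (x * b * e) = x * b * e" "x * b * e * e = x * b * e"
    using x(1) minimal_idempotentD(2,3)[OF e] by (simp_all add: mult.assoc mult_eq_assoc[OF x(1)])
  then obtain c where c: "x * b * e = c *\<^sub>C e" using minimal_idempotent_corner[OF e] by blast
  have "c \<noteq> 0"
  proof
    assume "c = 0"
    then have "x * b * e * x = 0" using c by simp
    then show False using b x(1) by (simp add: mult.assoc)
  qed
  have "x * (inverse c *\<^sub>C (b * e)) = e" using c \<open>c \<noteq> 0\<close> by (simp add: mult_scaleC_right mult.assoc)
  moreover have "(inverse c *\<^sub>C (b * e)) * e = inverse c *\<^sub>C (b * e)"
    using minimal_idempotentD(2,3)[OF e] by (simp add: mult_scaleC_left mult.assoc)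
  ultimately show ?thesis using that by blast
qed

lemma left_ideal_image_mult:
  assumes "left_ideal (L :: 'a set)"
  shows "left_ideal ((\<lambda>l. l * y) ` L)"
proof -
  have sub: "cvec.subspace L" and mul: "\<And>a x. x \<in> L \<Longrightarrow> a * x \<in> L"
    using assms unfolding left_ideal_def by blast+
  show ?thesis
    unfolding left_ideal_def cvec.subspace_def
  proof (intro conjI ballI allI)
    show "0 \<in> (\<lambda>l. l * y) ` L" using cvec.subspace_0[OF sub] by (intro image_eqI[of _ _ 0]) auto
  next
    fix u v assume "u \<in> (\<lambda>l. l * y) ` L" "v \<in> (\<lambda>l. l * y) ` L"
    then obtain l m where "u = l * y" "v = m * y" "l \<in> L" "m \<in> L" by blast
    then show "u + v \<in> (\<lambda>l. l * y) ` L"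
      using cvec.subspace_add[OF sub] by (intro image_eqI[of _ _ "l + m"]) (auto simp: distrib_right)
  next
    fix c u assume "u \<in> (\<lambda>l. l * y) ` L"
    then obtain l where "u = l * y" "l \<in> L" by blast
    then show "c *\<^sub>C u \<in> (\<lambda>l. l * y) ` L"
      using cvec.subspace_scale[OF sub] by (intro image_eqI[of _ _ "c *\<^sub>C l"]) (auto simp: mult_scaleC_left)
  next
    fix b u assume "u \<in> (\<lambda>l. l * y) ` L"
    then obtain l where "u = l * y" "l \<in> L" by blast
    then show "b * u \<in> (\<lambda>l. l * y) ` L"
      using mul by (intro image_eqI[of _ _ "b * l"]) (auto simp: mult.assoc)
  qed
qed

lemma left_ideal_range_mult: "left_ideal (range (\<lambda>a. a * (y::'a)))"
  by (rule left_ideal_image_mult) (simp add: left_ideal_def)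

lemma minimal_left_ideal_of_idempotent:
  assumes e: "minimal_idempotent (e :: 'a)"
  shows "minimal_left_ideal (range (\<lambda>a. a * e))"
  unfolding minimal_left_ideal_def
proof (intro conjI allI impI left_ideal_range_mult)
  have "e \<in> range (\<lambda>a. a * e)" by (rule range_eqI[of _ _ 1]) simp
  then show "range (\<lambda>a. a * e) \<noteq> {0}" using minimal_idempotentD(1)[OF e] by blast
  fix M assume M: "left_ideal M \<and> M \<subseteq> range (\<lambda>a. a * e)"
  then have mul: "\<And>a x. x \<in> M \<Longrightarrow> a * x \<in> M" and "0 \<in> M"
    unfolding left_ideal_def using cvec.subspace_0 by blast+
  show "M = {0} \<or> M = range (\<lambda>a. a * e)"
  proof (cases "M = {0}")
    case False
    then obtain x where x: "x \<in> M" "x \<noteq> 0" using \<open>0 \<in> M\<close> by blast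
    then obtain a where "x = a * e" using M by blast
    then have "x * e = x" using minimal_idempotentD(2)[OF e] by (simp add: mult.assoc)
    then obtain y where "y * x = e" using minimal_left_inverse[OF e] x by blast
    then have "e \<in> M" using mul x by metis
    then show ?thesis using M mul by blast
  qed simp
qed

text \<open>Brauer's lemma. Choose y in L with L y nonzero; minimality gives L y = L, so
  \<open>e * y = y\<close> for some e in L, and the annihilator of y in L is a smaller left ideal,
  hence 0. As \<open>e * e - e\<close> annihilates y, e is idempotent.\<close>

lemma minimal_left_ideal_idempotent:
  assumes L: "minimal_left_ideal (L :: 'a set)"
  obtains e where "minimal_idempotent e" "L = range (\<lambda>a. a * e)"
proof -
  have id: "left_ideal L" and sub: "cvec.subspace L" and mul: "\<And>a x. x \<in> L \<Longrightarrow> a * x \<in> L"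
    and min: "\<And>M. left_ideal M \<Longrightarrow> M \<subseteq> L \<Longrightarrow> M \<noteq> {0} \<Longrightarrow> M = L"
    using L unfolding minimal_left_ideal_def left_ideal_def by auto
  have "0 \<in> L" using sub by (rule cvec.subspace_0)
  then obtain x where x: "x \<in> L" "x \<noteq> 0" using L unfolding minimal_left_ideal_def by blast
  then obtain a where a: "x * a * x \<noteq> 0" using semiprime by blast
  define y where "y = a * x"
  have y: "y \<in> L" "x * y \<noteq> 0" "y \<noteq> 0" unfolding y_def using mul x a by (auto simp: mult.assoc)
  have "(\<lambda>l. l * y) ` L = L"
  proof (rule min[OF left_ideal_image_mult[OF id]])
    show "(\<lambda>l. l * y) ` L \<subseteq> L" using mul y by blast
    show "(\<lambda>l. l * y) ` L \<noteq> {0}" using x y by blast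
  qed
  then obtain e where e: "e \<in> L" "e * y = y" using y(1) by (metis imageE)
  define N where "N = {l \<in> L. l * y = 0}"
  have "left_ideal N"
    unfolding left_ideal_def cvec.subspace_def N_def using \<open>0 \<in> L\<close> mul
      cvec.subspace_add[OF sub] cvec.subspace_scale[OF sub]
    by (auto simp: distrib_right mult_scaleC_left mult.assoc)
  moreover have "e \<notin> N" unfolding N_def using e(2) y(3) by simp
  then have "N \<noteq> L" using e(1) by blast
  moreover have "N \<subseteq> L" unfolding N_def by blast
  ultimately have N: "N = {0}" using min by blast
  have "e * e - e \<in> L" using e(1) mul cvec.subspace_diff[OF sub] by blast
  then have "e * e - e \<in> N" unfolding N_def using e(2) by (simp add: left_diff_distrib mult.assoc)
  then have ee: "e * e = e" using N by simp
  have ne: "e \<noteq> 0" using e(2) y(3) by auto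
  have gen: "range (\<lambda>a. a * z) = L" if "z \<in> L" "z \<noteq> 0" for z
  proof (rule min[OF left_ideal_range_mult])
    show "range (\<lambda>a. a * z) \<subseteq> L" using mul that by blast
    have "z \<in> range (\<lambda>a. a * z)" by (rule range_eqI[of _ _ 1]) simp
    then show "range (\<lambda>a. a * z) \<noteq> {0}" using that by blast
  qed
  have "minimal_idempotent e"
  proof (rule minimal_idempotent_if_division[OF ee ne])
    fix z assume z: "e * z = z" "z * e = z" "z \<noteq> 0"
    then have "z \<in> L" using mul[OF e(1), of z] by simp
    then have "e \<in> range (\<lambda>a. a * z)" using gen z(3) e(1) by blast
    then show "\<exists>w. w * z = e" by auto
  qed
  then show ?thesis using that gen[OF e(1) ne] by blast
qed

section \<open>Local units in the socle\<close>

lemma minimal_in_socle: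
  assumes "minimal_idempotent (e :: 'a)"
  shows "a * e \<in> socle"
  unfolding socle_def using minimal_left_ideal_of_idempotent[OF assms]
  by (intro cvec.span_base) blast

lemma subspace_socle: "cvec.subspace (socle :: 'a set)"
  unfolding socle_def by (rule cvec.subspace_span)

lemma socle_induct [consumes 1, case_names zero add scale minimal]:
  assumes "(x :: 'a) \<in> socle" "Q 0" "\<And>x y. Q x \<Longrightarrow> Q y \<Longrightarrow> Q (x + y)" "\<And>c x. Q x \<Longrightarrow> Q (c *\<^sub>C x)"
    "\<And>e x. minimal_idempotent e \<Longrightarrow> x * e = x \<Longrightarrow> Q x"
  shows "Q x"
  using assms(1) unfolding socle_def
proof (rule cvec.span_induct)
  show "cvec.subspace {x. Q x}" unfolding cvec.subspace_def using assms by simp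
  fix y :: 'a assume "y \<in> \<Union> {L. minimal_left_ideal L}"
  then obtain L where "minimal_left_ideal L" "y \<in> L" by blast
  then obtain e where e: "minimal_idempotent e" "y \<in> range (\<lambda>a. a * e)" using minimal_left_ideal_idempotent by metis
  then have "y * e = y" using minimal_idempotentD(2)[OF e(1)] by (auto simp: mult.assoc)
  then show "Q y" using assms e by blast
qed

text \<open>Only the part \<open>w\<close> of v outside the current sum \<open>h\<close> has to be
  covered, by a new idempotent \<open>w * y\<close>. The last clause records that it is a right
  multiple of \<open>w\<close>; \<open>socle_regular\<close> uses this to keep the family inside a
  given right ideal.\<close>

lemma absorb_left:
  fixes v :: 'a
  assumes E: "orthogonal_minimal E" and e: "minimal_idempotent e" and v: "v * e = v"
  obtains E' where "orthogonal_minimal E'" "E \<subseteq> E'" "\<Sum>E' * v = v"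
    "\<And>f. f \<in> E' \<Longrightarrow> f \<in> E \<or> (\<exists>b. f = (v - \<Sum>E * v) * b)"
proof (cases "\<Sum>E * v = v")
  case True
  then show ?thesis using that[of E] E by blast
next
  case False
  define h where "h = \<Sum>E"
  have hh: "h * h = h" unfolding h_def using orthogonal_minimal_sum_idem[OF E] .
  define w where "w = v - h * v"
  have w: "w * e = w" "w \<noteq> 0" "h * w = 0"
    unfolding w_def using v False by (simp_all add: h_def[symmetric] algebra_simps mult_eq_assoc[OF hh])
  then obtain y0 where y0: "y0 * w = e" "e * y0 = y0" using minimal_left_inverse[OF e] by blast
  \<comment> \<open>The factor \<open>1 - h\<close> achieves \<open>y * h = 0\<close> and keeps
    \<open>y * w = e\<close>, because \<open>h * w = 0\<close>.\<close>
  define y where "y = y0 * (1 - h)"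
  have y: "y * w = e" "e * y = y" "y * h = 0"
    unfolding y_def using w(3) y0 hh by (simp_all add: algebra_simps mult_eq_assoc[OF y0(2)])
  have f: "minimal_idempotent (w * y)" using minimal_idempotent_transfer[OF e] y w by blast
  have o: "w * y * \<Sum>E = 0" "\<Sum>E * (w * y) = 0"
    using y(3) mult_eq_assoc[OF w(3)] unfolding h_def by (simp_all add: mult.assoc)
  note ins = orthogonal_minimal_insert[OF E f o]
  have "(w * y + h) * v = v"
  proof -
    have "v = w + h * v" unfolding w_def by simp
    then have "w * y * v = w * (y * w) + w * (y * h) * v"
      by (metis (no_types, lifting) distrib_left mult.assoc)
    also have "\<dots> = w" using y w(1) by simp
    finally have "w * y * v = w" .
    then have "(w * y + h) * v = w + h * v" by (simp add: distrib_right)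
    also have "\<dots> = v" unfolding w_def by simp
    finally show ?thesis .
  qed
  then show ?thesis
    by (intro that[of "insert (w * y) E"]) (use ins in \<open>auto simp: h_def w_def\<close>)
qed

lemma absorb_right:
  fixes v :: 'a
  assumes E: "orthogonal_minimal E" and e: "minimal_idempotent e" and v: "e * v = v"
  obtains E' where "orthogonal_minimal E'" "E \<subseteq> E'" "v * \<Sum>E' = v"
proof (cases "v * \<Sum>E = v")
  case True
  then show ?thesis using that[of E] E by blast
next
  case False
  define h where "h = \<Sum>E"
  have hh: "h * h = h" unfolding h_def using orthogonal_minimal_sum_idem[OF E] .
  define w where "w = v - v * h"
  have w: "e * w = w" "w \<noteq> 0" "w * h = 0"
    unfolding w_def using v False by (simp_all add: h_def[symmetric] algebra_simps hh mult_eq_assoc[OF v])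
  then obtain y0 where y0: "w * y0 = e" "y0 * e = y0" using minimal_right_inverse[OF e] by blast
  define y where "y = (1 - h) * y0"
  have y: "w * y = e" "y * e = y" "h * y = 0"
    unfolding y_def using mult_eq_assoc[OF w(3)] y0 by (simp_all add: algebra_simps mult_eq_assoc[OF hh])
  have f: "minimal_idempotent (y * w)" using minimal_idempotent_transfer[OF e] y w by blast
  have o: "y * w * \<Sum>E = 0" "\<Sum>E * (y * w) = 0"
    using w(3) mult_eq_assoc[OF y(3)] unfolding h_def by (simp_all add: mult.assoc)
  note ins = orthogonal_minimal_insert[OF E f o]
  have "v * (y * w + h) = v"
  proof -
    have "v = w + v * h" unfolding w_def by simp
    then have "v * (y * w) = (w * y) * w + v * (h * y) * w"
      by (metis (no_types, lifting) distrib_right mult.assoc)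
    also have "\<dots> = w" using y w(1) by simp
    finally have "v * (y * w) = w" .
    then have "v * (y * w + h) = w + v * h" by (simp add: distrib_left)
    also have "\<dots> = v" unfolding w_def by simp
    finally show ?thesis .
  qed
  then show ?thesis
    by (intro that[of "insert (y * w) E"]) (use ins in \<open>auto simp: h_def w_def\<close>)
qed

text \<open>Extending a given family drives the induction: the sum of a larger family still acts as
  a unit wherever the smaller one did. It also provides a common unit for several elements.\<close>

lemma socle_local_unit:
  fixes x :: 'a
  assumes "x \<in> socle" "orthogonal_minimal E"
  shows "\<exists>E'. orthogonal_minimal E' \<and> E \<subseteq> E' \<and> \<Sum>E' * x = x \<and> x * \<Sum>E' = x"
  using assms
proof (induction x arbitrary: E rule: socle_induct)
  case (add x y)
  obtain E1 where E1: "orthogonal_minimal E1" "E \<subseteq> E1" "\<Sum>E1 * x = x" "x * \<Sum>E1 = x" using add by blast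
  obtain E2 where E2: "orthogonal_minimal E2" "E1 \<subseteq> E2" "\<Sum>E2 * y = y" "y * \<Sum>E2 = y" using add E1 by blast
  have "\<Sum>E2 * (\<Sum>E1 * x) = \<Sum>E1 * x" "x * \<Sum>E1 * \<Sum>E2 = x * \<Sum>E1"
    using orthogonal_minimal_sum_subset[OF E2(1,2)] mult_eq_assoc[OF orthogonal_minimal_sum_subset(2)[OF E2(1,2)]]
    by (simp_all add: mult.assoc)
  then have "\<Sum>E2 * x = x" "x * \<Sum>E2 = x" unfolding E1(3,4) by simp_all
  then show ?case using E1 E2 by (intro exI[of _ E2]) (auto simp: algebra_simps)
next
  case (scale c x)
  then show ?case by (metis mult_scaleC_left mult_scaleC_right)
next
  case (minimal e x)
  obtain E1 where E1: "orthogonal_minimal E1" "E \<subseteq> E1" "\<Sum>E1 * x = x"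
    using absorb_left[OF minimal(3,1,2)] by blast
  obtain E2 where E2: "orthogonal_minimal E2" "E1 \<subseteq> E2" "e * \<Sum>E2 = e"
    using absorb_right[OF E1(1) minimal(1) minimal_idempotentD(2)[OF minimal(1)]] by blast
  have "x * e * \<Sum>E2 = x * e" using E2(3) by (simp add: mult.assoc)
  then have "x * \<Sum>E2 = x" unfolding minimal(2) .
  moreover have "\<Sum>E2 * x = x" using mult_eq_assoc[OF orthogonal_minimal_sum_subset(2)[OF E2(1,2)], of x] unfolding E1(3) .
  ultimately show ?case using E1 E2 by blast
qed auto

lemma sum_mem_left_multiples:
  fixes a :: "'b::ring"
  assumes "\<forall>g\<in>G. \<exists>b. g = a * b"
  shows "\<exists>b. \<Sum>G = a * b"
proof -
  obtain b where "\<forall>g\<in>G. g = a * b g" using assms by metis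
  then have "\<Sum>G = a * (\<Sum>g\<in>G. b g)" unfolding sum_distrib_left by (intro sum.cong) auto
  then show ?thesis ..
qed

text \<open>The sum of \<open>G\<close> generates the same right ideal as \<open>a\<close>, which
  ties the size of \<open>G\<close> to the rank of \<open>a\<close>. The vectors
  \<open>a * e\<close>, for e in a family whose sum is a right unit of \<open>a\<close>, are
  absorbed one at a time, and every new idempotent is again a right multiple of
  \<open>a\<close>.\<close>

lemma socle_regular:
  fixes a :: 'a
  assumes "a \<in> socle"
  obtains G b where "orthogonal_minimal G" "\<Sum>G * a = a" "\<Sum>G = a * b"
proof -
  obtain E where E: "orthogonal_minimal E" "a * \<Sum>E = a"
    using socle_local_unit[OF assms orthogonal_minimal_empty] by blast
  have "\<exists>G. orthogonal_minimal G \<and> (\<forall>g\<in>G. \<exists>b. g = a * b) \<and> (\<forall>e\<in>E0. \<Sum>G * (a * e) = a * e)"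
    if "finite E0" "E0 \<subseteq> E" for E0
    using that
  proof (induction E0)
    case empty
    then show ?case by (intro exI[of _ "{}"]) simp
  next
    case (insert e E0)
    then obtain G where G: "orthogonal_minimal G" "\<forall>g\<in>G. \<exists>b. g = a * b" "\<forall>e\<in>E0. \<Sum>G * (a * e) = a * e" by auto
    have e: "minimal_idempotent e" using insert E orthogonal_minimalD by blast
    have "a * e * e = a * e" using minimal_idempotentD[OF e] by (simp add: mult.assoc)
    from absorb_left[OF G(1) e this] obtain G' where G': "orthogonal_minimal G'" "G \<subseteq> G'" "\<Sum>G' * (a * e) = a * e"
      "\<And>f. f \<in> G' \<Longrightarrow> f \<in> G \<or> (\<exists>b. f = (a * e - \<Sum>G * (a * e)) * b)" by blast
    have "\<exists>b. \<Sum>G = a * b"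
      using sum_mem_left_multiples G(2) .
    then obtain b where b: "\<Sum>G = a * b" by blast
    have "\<exists>b. f = a * b" if f: "f \<in> G'" for f
    proof (cases "f \<in> G")
      case False
      then obtain c where "f = (a * e - \<Sum>G * (a * e)) * c" using G'(4) f by blast
      then have "f = a * ((e - b * a * e) * c)" unfolding b by (simp add: algebra_simps)
      then show ?thesis by blast
    qed (use G in blast)
    moreover have "\<Sum>G' * (a * f) = a * f" if "f \<in> E0" for f
      using mult_eq_assoc[OF orthogonal_minimal_sum_subset(2)[OF G'(1,2)], of "a * f"] G(3) that by simp
    ultimately show ?case using G' by blast
  qed
  from this[of E] obtain G where G: "orthogonal_minimal G" "\<forall>g\<in>G. \<exists>b. g = a * b" "\<forall>e\<in>E. \<Sum>G * (a * e) = a * e"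
    using E orthogonal_minimalD by blast
  have "\<exists>b. \<Sum>G = a * b"
    using sum_mem_left_multiples G(2) .
  moreover have "\<Sum>G * (a * \<Sum>E) = a * \<Sum>E"
    unfolding sum_distrib_left[of _ _ E] using G(3) by (intro sum.cong) auto
  ultimately show ?thesis using that G(1) E(2) by auto
qed

end

text \<open>Here q is the Riesz idempotent of the whole nonzero spectrum of y. It lies in the corner
  of \<open>e\<close> because the means differ from 1 by multiples of powers of y. When q is all of
  \<open>e\<close>, an approximation of q that is a right multiple of y has a right inverse relative
  to \<open>e\<close>, so y has one too.\<close>

lemma riesz_idempotent:
  fixes y :: "'a::complex_banach_algebra_1"
  assumes y: "e * y = y" "y * e = y" and fin: "finite (nonzero_spectrum y)" "nonzero_spectrum y \<noteq> {}"
  obtains q where "q * q = q" "e * q = q" "q * e = q" "q \<noteq> 0" "q = e \<Longrightarrow> \<exists>w. y * w = e"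
proof -
  define r where "r = Min (cmod ` nonzero_spectrum y)"
  have "r \<in> cmod ` nonzero_spectrum y" unfolding r_def using fin by (intro Min_in) auto
  then have r: "r > 0" by (auto simp: nonzero_spectrum_iff)
  have r_le: "r \<le> cmod \<mu>" if "\<mu> \<in> nonzero_spectrum y" for \<mu>
    unfolding r_def using fin that by simp
  have inv: "two_sided_invertible (1 - z *\<^sub>C y)" if "2 / r \<le> cmod z" for z
  proof -
    have pos: "0 < cmod z" using that r by (smt (verit) divide_pos_pos)
    then have z: "z \<noteq> 0" by auto
    have "2 \<le> cmod z * r" using that r by (simp add: pos_divide_le_eq)
    then have "cmod (inverse z) < r" using pos by (simp add: norm_divide inverse_eq_divide pos_divide_less_eq mult.commute)
    then have "inverse z \<notin> nonzero_spectrum y" using r_le by fastforce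
    then show ?thesis using z nonzero_spectrum_iff'[of "inverse z" y] by simp
  qed
  \<comment> \<open>Reciprocals of the nonzero spectral values have modulus at most 1 / r; the
    annulus from 2 / r to 3 / r lies strictly beyond them.\<close>
  interpret spectral_gap y "2 / r" "3 / r"
    by unfold_locales (use r inv in \<open>auto simp: divide_strict_right_mono\<close>)
  define t where "t = 3 / r"
  have t: "t \<in> {2/r..3/r}" "t > 0" unfolding t_def using r by (auto simp: divide_right_mono)
  define q where "q = 1 - riesz_limit t"
  have q: "q * q = q" unfolding q_def using riesz_limit_idem[OF t(1)] by (simp add: algebra_simps)
  have lim: "(\<lambda>n. 1 - F t (Suc n)) \<longlonglongrightarrow> q"
    unfolding q_def by (intro tendsto_intros LIMSEQ_Suc resolvent_mean_tendsto t(1))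
  have Qn: "1 - F t (Suc n) = - ((t *\<^sub>R y) ^ Suc n * F t (Suc n))" "1 - F t (Suc n) = - (F t (Suc n) * (t *\<^sub>R y) ^ Suc n)" for n
    using resolvent_mean_inverse_power[OF t(1), of "Suc n"] by (simp_all add: algebra_simps)
  have eQ: "e * (1 - F t (Suc n)) = 1 - F t (Suc n)" for n
    unfolding Qn(1) using y(1) by (simp add: mult.assoc[symmetric])
  have Qe: "(1 - F t (Suc n)) * e = 1 - F t (Suc n)" for n
    unfolding Qn(2) power_Suc2 using y(2) by (simp add: mult.assoc)
  have "(\<lambda>n. e * (1 - F t (Suc n))) \<longlonglongrightarrow> e * q" "(\<lambda>n. (1 - F t (Suc n)) * e) \<longlonglongrightarrow> q * e"
    using lim by (auto intro!: tendsto_intros)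
  then have eq: "e * q = q" "q * e = q" unfolding eQ Qe using lim LIMSEQ_unique by blast+
  have "q \<noteq> 0"
  proof
    assume "q = 0"
    then have "F t \<longlonglongrightarrow> 1" using resolvent_mean_tendsto[OF t(1)] unfolding q_def by simp
    then have "(\<lambda>n. (t *\<^sub>R y) ^ n) \<longlonglongrightarrow> 0"
      using power_tendsto_0_if_resolvent_mean_tendsto_1[OF spectral_gap_axioms t(1)] by blast
    then have "\<forall>\<^sub>F n in sequentially. norm ((t *\<^sub>R y) ^ n) < 1"
      using tendstoD[of "\<lambda>n. (t *\<^sub>R y) ^ n" 0 sequentially 1] by simp
    then obtain n where n: "norm ((t *\<^sub>R y) ^ n) < 1"
      using eventually_happens by fastforce
    obtain \<mu> where \<mu>: "\<mu> \<in> nonzero_spectrum y" using fin by blast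
    then have \<mu>0: "\<mu> \<noteq> 0" "r \<le> cmod \<mu>" using nonzero_spectrum_iff r_le by auto
    \<comment> \<open>Passing from \<open>t *\<^sub>R y\<close> to \<open>Y\<close> divides by
      \<open>c = t * \<mu>\<close>, of modulus at least 3. So \<open>Y\<close> has a power of norm
      below 1 and \<open>1 - Y\<close> is invertible, although \<mu> is spectral.\<close>
    define Y where "Y = inverse \<mu> *\<^sub>C y"
    define c where "c = of_real t * \<mu>"
    have "Y = inverse c *\<^sub>C (t *\<^sub>R y)"
      unfolding Y_def c_def using t(2) \<mu>0 by (simp add: scaleR_eq_scaleC)
    then have "norm (Y ^ n) = norm ((t *\<^sub>R y) ^ n) / cmod c ^ n"
      by (simp only: power_scaleC norm_scaleC norm_power norm_inverse divide_inverse power_inverse mult.commute)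
    moreover have "1 \<le> cmod c ^ n"
    proof (rule one_le_power)
      have "1 \<le> 3 * cmod \<mu> / r" using \<mu>0 r by (simp add: pos_le_divide_eq)
      then show "1 \<le> cmod c" unfolding c_def t_def using r by (simp add: norm_mult norm_divide)
    qed
    ultimately have "norm (Y ^ n) < 1" using n by (smt (verit) divide_le_eq_1 divide_less_eq_1 norm_ge_zero)
    then have "two_sided_invertible (1 - Y ^ n)" by (rule neumann_invertible)
    then have "two_sided_invertible (1 - Y)"
      using one_minus_mult_sum_power[of Y n] two_sided_invertible_factor by metis
    then show False using \<mu> nonzero_spectrum_iff' unfolding Y_def by blast
  qed
  moreover have "\<exists>w. y * w = e" if "q = e"
  proof -
    have "\<forall>\<^sub>F n in sequentially. dist (1 - F t (Suc n)) e < 1"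
      using tendstoD[OF lim] that by simp
    then obtain n where n: "dist (1 - F t (Suc n)) e < 1"
      using eventually_happens by fastforce
    define k where "k = 1 - F t (Suc n)"
    have "norm (e - k) < 1" using n unfolding k_def by (metis dist_commute dist_norm)
    then obtain c where c: "(1 - (e - k)) * c = 1"
      using neumann_invertible unfolding two_sided_invertible_def by blast
    have "e * (1 - (e - k)) = k"
      using eQ[of n] q that unfolding k_def[symmetric] by (simp add: right_diff_distrib)
    then have kc: "k * c = e" using c mult.assoc[of e "1 - (e - k)" c] by simp
    have "k = y * (- (t *\<^sub>R ((t *\<^sub>R y) ^ n * F t (Suc n))))"
      unfolding k_def Qn(1) by (simp add: mult.assoc)
    then have "y * (- (t *\<^sub>R ((t *\<^sub>R y) ^ n * F t (Suc n))) * c) = e" using kc by (simp add: mult.assoc)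
    then show ?thesis by blast
  qed
  ultimately show ?thesis using that q eq by blast
qed

context semisimple_algebra
begin

text \<open>An element of the corner with nonzero spectrum has a right inverse there, since its
  Riesz idempotent can only be \<open>e\<close>; a right inverse is two-sided because
  \<open>w' * y\<close> is again a nonzero idempotent of the corner. An element y without nonzero
  spectrum is in the radical: if 1 were spectral for some \<open>y * a\<close>, then y would get a
  right inverse as well.\<close>

lemma minimal_idempotent_if_primitive:
  fixes e :: 'a
  assumes e: "e * e = e" "e \<noteq> 0"
    and fin: "\<And>y. e * y = y \<Longrightarrow> y * e = y \<Longrightarrow> finite (nonzero_spectrum y)"
    and prim: "\<And>h. h * h = h \<Longrightarrow> e * h = h \<Longrightarrow> h * e = h \<Longrightarrow> h = 0 \<or> h = e"
  shows "minimal_idempotent e"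
proof (rule minimal_idempotent_if_division[OF e])
  have two_sided: "\<exists>w. w * y = e" if y: "e * y = y" "y * e = y" "y * w = e" for y w
  proof -
    define w' where "w' = e * w * e"
    have w': "y * w' = e" "e * w' = w'" "w' * e = w'" unfolding w'_def
      using y e by (simp_all add: mult.assoc mult_eq_assoc[OF y(2)] mult_eq_assoc[OF y(3)] mult_eq_assoc[OF e(1)])
    have "w' * y * (w' * y) = w' * y" "e * (w' * y) = w' * y" "w' * y * e = w' * y"
      using w' y by (simp_all add: mult.assoc mult_eq_assoc[OF w'(1)] mult_eq_assoc[OF w'(2)] mult_eq_assoc[OF y(1)])
    moreover have "w' * y \<noteq> 0"
    proof
      assume "w' * y = 0"
      then have "y * w' * y = 0" by (simp add: mult.assoc)
      then have "y = 0" using w'(1) y(1) by simp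
      then show False using y(3) e by simp
    qed
    ultimately show ?thesis using prim by blast
  qed
  have inv: "\<exists>w. y * w = e" if y: "e * y = y" "y * e = y" "nonzero_spectrum y \<noteq> {}" for y
    using riesz_idempotent[OF y(1,2) fin y(3)] y prim by metis
  have qn: "y = 0" if y: "e * y = y" "y * e = y" "nonzero_spectrum y = {}" for y
  proof (rule radical_zero)
    fix a
    show "1 \<notin> nonzero_spectrum (y * a)"
    proof
      assume 1: "1 \<in> nonzero_spectrum (y * a)"
      define b where "b = y * (e * a * e)"
      have "nonzero_spectrum (y * a) = nonzero_spectrum (e * (y * a))" by (simp add: mult_eq_assoc[OF y(1)])
      also have "\<dots> = nonzero_spectrum (y * a * e)" by (rule nonzero_spectrum_mult_commute)
      also have "y * a * e = b" unfolding b_def by (simp add: mult.assoc mult_eq_assoc[OF y(2)])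
      finally have "nonzero_spectrum b \<noteq> {}" using 1 by blast
      moreover have "e * b = b" "b * e = b" unfolding b_def using y e by (simp_all add: mult.assoc mult_eq_assoc[OF y(1)])
      ultimately obtain w where "b * w = e" using inv by blast
      then have "y * (e * a * e * w) = e" unfolding b_def by (simp add: mult.assoc)
      then obtain w' where "w' * y = e" using two_sided y by blast
      then show False using quasinilpotent_no_left_inverse[OF y(3) y(1)] e by blast
    qed
  qed
  fix y assume y: "e * y = y" "y * e = y" "y \<noteq> 0"
  then have "nonzero_spectrum y \<noteq> {}" using qn by blast
  then show "\<exists>w. w * y = e" using inv two_sided y by blast
qed

lemma idempotent_in_nonzero_spectrum:
  fixes p :: 'a
  assumes "p * p = p" "p \<noteq> 0"
  shows "1 \<in> nonzero_spectrum p"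
  using assms by (intro eigenvalue_in_nonzero_spectrum[of p p]) simp_all

text \<open>Adding a multiple of the complementary idempotent creates one more spectral point, so the
  bound drops by one on each proper piece of a splitting.\<close>

lemma spectrum_bound_split:
  fixes p h :: 'a
  assumes bound: "\<And>x. finite (nonzero_spectrum (x * p)) \<and> card (nonzero_spectrum (x * p)) \<le> Suc M"
    and h: "h * h = h" "p * h = h" "h * p = h" "h \<noteq> p" and p: "p * p = p"
  shows "finite (nonzero_spectrum (x * h)) \<and> card (nonzero_spectrum (x * h)) \<le> M"
proof -
  have xh: "nonzero_spectrum (x * h) = nonzero_spectrum (x * h * p)" using h by (simp add: mult.assoc)
  have fin: "finite (nonzero_spectrum (x * h))" unfolding xh using bound by blast
  define y where "y = h * x * h"
  have sp: "nonzero_spectrum (x * h) = nonzero_spectrum y"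
    unfolding y_def using nonzero_spectrum_mult_commute[of "x * h" h] h by (simp add: mult.assoc)
  obtain c where c: "c \<noteq> 0" "c \<notin> nonzero_spectrum (x * h)"
    using ex_new_if_finite[of "insert 0 (nonzero_spectrum (x * h))"] fin infinite_UNIV_char_0 by auto
  define z where "z = y + c *\<^sub>C (p - h)"
  have yh: "y * h = y" "h * y = y" unfolding y_def using h(1) by (simp_all add: mult.assoc mult_eq_assoc[OF h(1)])
  have yp: "y * p = y" unfolding y_def using h(3) by (simp add: mult.assoc)
  have zh: "z * h = y" "h * z = y" unfolding z_def using yh h
    by (simp_all add: algebra_simps mult_scaleC_left mult_scaleC_right)
  have "z * p = z" unfolding z_def using yp h p
    by (simp add: algebra_simps mult_scaleC_left)
  then have "finite (nonzero_spectrum z)" "card (nonzero_spectrum z) \<le> Suc M" using bound[of z] by auto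
  moreover have "insert c (nonzero_spectrum (x * h)) \<subseteq> nonzero_spectrum z"
  proof (intro insert_subsetI subsetI)
    have "z * (p - h) = c *\<^sub>C (p - h)" unfolding z_def using yh yp h p
      by (simp add: algebra_simps mult_scaleC_left)
    then show "c \<in> nonzero_spectrum z" using h(4) c(1) by (intro eigenvalue_in_nonzero_spectrum) auto
  next
    fix \<mu> assume "\<mu> \<in> nonzero_spectrum (x * h)"
    then have \<mu>: "\<mu> \<noteq> 0" "\<not> two_sided_invertible (\<mu> *\<^sub>C 1 - y)" unfolding sp nonzero_spectrum_iff by auto
    have "\<not> two_sided_invertible (\<mu> *\<^sub>C 1 - z)"
    proof
      assume "two_sided_invertible (\<mu> *\<^sub>C 1 - z)"
      then obtain w where w: "(\<mu> *\<^sub>C 1 - z) * w = 1" "w * (\<mu> *\<^sub>C 1 - z) = 1"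
        unfolding two_sided_invertible_def by blast
      \<comment> \<open>\<open>h\<close> intertwines y and z, so an inverse \<open>w\<close> of
        \<open>\<mu> *\<^sub>C 1 - z\<close> compresses to \<open>h * w * h\<close>, which inverts
        \<open>\<mu> *\<^sub>C 1 - y\<close> inside the corner of \<open>h\<close>; on
        \<open>1 - h\<close> the latter is the scalar \<mu>.\<close>
      have 1: "(\<mu> *\<^sub>C 1 - y) * h = h * (\<mu> *\<^sub>C 1 - z)" "h * (\<mu> *\<^sub>C 1 - y) = (\<mu> *\<^sub>C 1 - z) * h"
        using yh zh by (simp_all add: algebra_simps mult_scaleC_left mult_scaleC_right)
      have 2: "(\<mu> *\<^sub>C 1 - y) * (h * w * h) = h" "(h * w * h) * (\<mu> *\<^sub>C 1 - y) = h"
      proof -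
        have "(\<mu> *\<^sub>C 1 - y) * (h * w * h) = ((\<mu> *\<^sub>C 1 - y) * h) * w * h" "(h * w * h) * (\<mu> *\<^sub>C 1 - y) = h * w * (h * (\<mu> *\<^sub>C 1 - y))"
          by (simp_all only: mult.assoc)
        moreover have "h * (\<mu> *\<^sub>C 1 - z) * w * h = h" "h * w * ((\<mu> *\<^sub>C 1 - z) * h) = h"
          using h(1) w mult_eq_assoc[OF w(1)] mult_eq_assoc[OF w(2)] by (simp_all add: mult.assoc)
        ultimately show "(\<mu> *\<^sub>C 1 - y) * (h * w * h) = h" "(h * w * h) * (\<mu> *\<^sub>C 1 - y) = h" unfolding 1 by simp_all
      qed
      have 3: "(\<mu> *\<^sub>C 1 - y) * (inverse \<mu> *\<^sub>C (1 - h)) = 1 - h" "(inverse \<mu> *\<^sub>C (1 - h)) * (\<mu> *\<^sub>C 1 - y) = 1 - h"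
        using \<mu>(1) yh by (simp_all add: algebra_simps mult_scaleC_left mult_scaleC_right)
      have "(\<mu> *\<^sub>C 1 - y) * (h * w * h + inverse \<mu> *\<^sub>C (1 - h)) = 1"
        "(h * w * h + inverse \<mu> *\<^sub>C (1 - h)) * (\<mu> *\<^sub>C 1 - y) = 1"
        unfolding distrib_left distrib_right using 2 3 by simp_all
      then show False using \<mu>(2) two_sided_invertibleI by blast
    qed
    then show "\<mu> \<in> nonzero_spectrum z" using \<mu>(1) nonzero_spectrum_iff by blast
  qed
  ultimately have "card (insert c (nonzero_spectrum (x * h))) \<le> Suc M"
    by (meson card_mono order_trans)
  then show ?thesis using fin c(2) by simp
qed

text \<open>The spectral bound is the induction measure: a nonzero p that is not minimal splits
  properly as h + k, and both parts satisfy a smaller bound. For bound 0, p vanishes, as 1 is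
  spectral for a nonzero idempotent.\<close>

lemma idempotent_decomposition:
  fixes p :: 'a
  assumes "\<And>x. finite (nonzero_spectrum (x * p)) \<and> card (nonzero_spectrum (x * p)) \<le> N" "p * p = p"
  shows "\<exists>E. orthogonal_minimal E \<and> \<Sum>E = p"
  using assms
proof (induction N arbitrary: p)
  case 0
  then have "nonzero_spectrum (1 * p) = {}" by (metis card_0_eq le_zero_eq)
  then have "p = 0" using idempotent_in_nonzero_spectrum[OF 0(2)] by auto
  then show ?case by (intro exI[of _ "{}"]) simp
next
  case (Suc M p)
  show ?case
  proof (cases "p = 0 \<or> minimal_idempotent p")
    case True
    then show ?thesis
    proof
      assume "p = 0"
      then show ?thesis by (intro exI[of _ "{}"]) simp
    next
      assume "minimal_idempotent p"
      then show ?thesis by (intro exI[of _ "{p}"]) (simp add: orthogonal_minimal_def)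
    qed
  next
    case False
    have "finite (nonzero_spectrum y)" if "y * p = y" for y using Suc.prems(1)[of y] that by simp
    then obtain h where h: "h * h = h" "p * h = h" "h * p = h" "h \<noteq> 0" "h \<noteq> p"
      using minimal_idempotent_if_primitive[of p] Suc.prems(2) False by blast
    define k where "k = p - h"
    have k: "k * k = k" "p * k = k" "k * p = k" "k \<noteq> p" "h * k = 0" "k * h = 0"
      unfolding k_def using h Suc.prems(2) by (simp_all add: algebra_simps)
    obtain E where E: "orthogonal_minimal E" "\<Sum>E = h"
      using Suc.IH[OF spectrum_bound_split[OF Suc.prems(1) h(1,2,3,5) Suc.prems(2)] h(1)] by blast
    obtain F where F: "orthogonal_minimal F" "\<Sum>F = k"
      using Suc.IH[OF spectrum_bound_split[OF Suc.prems(1) k(1,2,3,4) Suc.prems(2)] k(1)] by blast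
    have "orthogonal_minimal (E \<union> F)" "\<Sum>(E \<union> F) = p"
      using orthogonal_minimal_Un[OF E(1) F(1)] E F k by (simp_all add: k_def)
    then show ?thesis by blast
  qed
qed

lemma finite_rank_decomposition:
  fixes p :: 'a
  assumes "projection p" "spectral_rank p < \<infinity>"
  obtains E where "orthogonal_minimal E" "\<Sum>E = p"
proof -
  obtain N where N: "spectral_rank p = enat N" using assms(2) by auto
  have "ecard (nonzero_spectrum (x * p)) \<le> enat N" for x
    using SUP_upper[of x UNIV "\<lambda>x. ecard (nonzero_spectrum (x * p))"] N unfolding spectral_rank_def by simp
  then have "finite (nonzero_spectrum (x * p)) \<and> card (nonzero_spectrum (x * p)) \<le> N" for x
    unfolding ecard_def by (metis enat_ord_simps(1) enat_ord_code(5) infinity_ileE)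
  then show ?thesis using that idempotent_decomposition assms(1) unfolding projection_def by blast
qed

end

section \<open>Matrix representations of corners\<close>

text \<open>The products u i * v j play the role of matrix units. The idempotent r i only depends on the
  block containing i, and indices from different blocks are unlinked, so off-block entries vanish.\<close>

locale matrix_frame =
  fixes n :: nat and r u v :: "nat \<Rightarrow> 'a::complex_banach_algebra_1"
  assumes minimal: "i < n \<Longrightarrow> minimal_idempotent (r i)"
    and u_r: "i < n \<Longrightarrow> u i * r i = u i"
    and r_v: "i < n \<Longrightarrow> r i * v i = v i"
    and v_u: "i < n \<Longrightarrow> j < n \<Longrightarrow> v i * u j = (if i = j then r i else 0)"
    and linked: "i < n \<Longrightarrow> j < n \<Longrightarrow> r i \<noteq> r j \<Longrightarrow> r i * x * r j = 0"
begin

definition frame_unit :: 'a where "frame_unit = (\<Sum>i<n. u i * v i)"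

definition entry :: "'a \<Rightarrow> nat \<Rightarrow> nat \<Rightarrow> complex"
  where "entry a i j = (THE c. v i * a * u j = c *\<^sub>C r i)"

definition rep :: "'a \<Rightarrow> complex mat"
  where "rep a = Matrix.mat n n (\<lambda>(i, j). entry a i j)"

lemma rep_carrier [simp]: "rep a \<in> carrier_mat n n"
  unfolding rep_def by simp

lemma r_nonzero: "i < n \<Longrightarrow> r i \<noteq> 0"
  using minimal minimal_idempotentD(1) by blast

lemma sandwich: "i < n \<Longrightarrow> j < n \<Longrightarrow> v i * a * u j = r i * (v i * a * u j) * r j"
  using mult_eq_assoc[OF r_v] u_r by (simp add: mult.assoc)

lemma entry_eqI:
  assumes "i < n" "v i * a * u j = c *\<^sub>C r i"
  shows "entry a i j = c"
  unfolding entry_def assms(2) using r_nonzero[OF assms(1)] by (auto simp: cvec.scale_cancel_right)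

lemma entry:
  assumes i: "i < n" and j: "j < n"
  shows "v i * a * u j = entry a i j *\<^sub>C r i"
proof -
  have "\<exists>c. v i * a * u j = c *\<^sub>C r i"
  proof (cases "r i = r j")
    case True
    then have "v i * a * u j = r i * (v i * a * u j) * r i" using sandwich[OF i j] by simp
    then show ?thesis using minimal[OF i] unfolding minimal_idempotent_def by metis
  next
    case False
    then have "v i * a * u j = 0" using sandwich[OF i j] linked[OF i j] by metis
    then show ?thesis by (intro exI[of _ 0]) simp
  qed
  then show ?thesis using entry_eqI[OF i] by blast
qed

lemma entry_unlinked:
  assumes i: "i < n" and j: "j < n" and "r i \<noteq> r j"
  shows "entry a i j = 0"
proof (rule entry_eqI[OF i])
  show "v i * a * u j = 0 *\<^sub>C r i"
    using sandwich[OF i j, of a] linked[OF assms] by (metis cvec.scale_zero_left)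
qed

text \<open>Across blocks the entry is 0, within a block \<open>r i = r j\<close>; so the corner
  idempotent may be taken from either index.\<close>

lemma entry_smult_r: "i < n \<Longrightarrow> j < n \<Longrightarrow> entry a i j *\<^sub>C (r i * x) = entry a i j *\<^sub>C (r j * x)"
  by (cases "r i = r j") (simp_all add: entry_unlinked)

lemma unit_u: "i < n \<Longrightarrow> frame_unit * u i = u i"
proof -
  assume i: "i < n"
  have "frame_unit * u i = (\<Sum>l<n. if l = i then u i else 0)"
    unfolding frame_unit_def sum_distrib_right
    using i by (intro sum.cong) (auto simp: mult.assoc v_u u_r)
  then show ?thesis using i by simp
qed

lemma v_unit: "i < n \<Longrightarrow> v i * frame_unit = v i"
proof -
  assume i: "i < n"
  have "v i * frame_unit = (\<Sum>l<n. if l = i then v i else 0)"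
    unfolding frame_unit_def sum_distrib_left
    using i by (intro sum.cong) (auto simp: mult.assoc[symmetric] v_u r_v)
  then show ?thesis using i by simp
qed

lemma unit_idem: "frame_unit * frame_unit = frame_unit"
  by (subst (2 3) frame_unit_def) (auto simp: sum_distrib_left mult.assoc[symmetric] unit_u intro!: sum.cong)

lemma unit_mult_u:
  assumes i: "i < n"
  shows "frame_unit * a * u i = (\<Sum>l<n. entry a l i *\<^sub>C u l)"
proof -
  have "frame_unit * a * u i = (\<Sum>l<n. u l * (v l * a * u i))"
    unfolding frame_unit_def sum_distrib_right by (simp add: mult.assoc)
  also have "\<dots> = (\<Sum>l<n. entry a l i *\<^sub>C u l)"
    using i by (intro sum.cong) (auto simp: entry mult_scaleC_right u_r)
  finally show ?thesis .
qed

lemma v_mult_unit: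
  assumes i: "i < n"
  shows "v i * a * frame_unit = (\<Sum>l<n. entry a i l *\<^sub>C v l)"
proof -
  have "v i * a * frame_unit = (\<Sum>l<n. (v i * a * u l) * v l)"
    unfolding frame_unit_def sum_distrib_left by (simp add: mult.assoc)
  also have "\<dots> = (\<Sum>l<n. entry a i l *\<^sub>C v l)"
    using i by (intro sum.cong) (auto simp: entry mult_scaleC_left entry_smult_r r_v)
  finally show ?thesis .
qed

lemma entry_sum:
  assumes "i < n" "j < n"
  shows "entry (\<Sum>k\<in>K. f k) i j = (\<Sum>k\<in>K. entry (f k) i j)"
  using assms by (intro entry_eqI) (simp_all add: sum_distrib_left sum_distrib_right entry cvec.scale_sum_left)

lemma entry_add: "i < n \<Longrightarrow> j < n \<Longrightarrow> entry (a + b) i j = entry a i j + entry b i j"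
  by (intro entry_eqI) (simp_all add: distrib_left distrib_right entry scaleC_add_left)

lemma entry_scaleC: "i < n \<Longrightarrow> j < n \<Longrightarrow> entry (c *\<^sub>C a) i j = c * entry a i j"
  by (intro entry_eqI) (simp_all add: mult_scaleC_left mult_scaleC_right entry scaleC_scaleC)

lemma entry_compress:
  assumes "i < n" "j < n"
  shows "entry (frame_unit * a * frame_unit) i j = entry a i j"
proof (rule entry_eqI[OF assms(1)])
  have "v i * (frame_unit * a * frame_unit) * u j = (v i * frame_unit) * a * (frame_unit * u j)"
    by (simp add: mult.assoc)
  then show "v i * (frame_unit * a * frame_unit) * u j = entry a i j *\<^sub>C r i"
    using assms by (simp add: v_unit unit_u entry)
qed

lemma entry_matrix_unit:
  assumes "i < n" "j < n" "k < n" "l < n" "r k = r l"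
  shows "entry (u k * v l) i j = (if i = k \<and> j = l then 1 else 0)"
proof (rule entry_eqI[OF assms(1)])
  have "v i * (u k * v l) * u j = (v i * u k) * (v l * u j)" by (simp add: mult.assoc)
  then show "v i * (u k * v l) * u j = (if i = k \<and> j = l then 1 else 0) *\<^sub>C r i"
    using assms minimal_idempotentD(2)[OF minimal] by (auto simp: v_u)
qed

lemma rep_compress: "rep (frame_unit * a * frame_unit) = rep a"
  unfolding rep_def by (rule cong_mat) (auto simp: entry_compress)

text \<open>An eigenvector c of the matrix lifts to the sum of the c_i u_i, and an inverse matrix W
  to the sum of the W_ij u_i v_j. The value 0 is excluded because \<open>a\<close> vanishes on the
  complement \<open>1 - frame_unit\<close>.\<close>

lemma nonzero_spectrum_rep:
  assumes a: "frame_unit * a = a" "a * frame_unit = a" and \<mu>: "\<mu> \<noteq> 0"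
  shows "\<mu> \<in> nonzero_spectrum a \<longleftrightarrow> poly (char_poly (rep a)) \<mu> = 0"
proof
  assume "poly (char_poly (rep a)) \<mu> = 0"
  then have "eigenvalue (rep a) \<mu>" using eigenvalue_root_char_poly[OF rep_carrier] by blast
  then obtain c where c: "c \<in> carrier_vec n" "c \<noteq> 0\<^sub>v n" "rep a *\<^sub>v c = \<mu> \<cdot>\<^sub>v c"
    unfolding eigenvalue_def eigenvector_def using rep_carrier[of a] by auto
  define w where "w = (\<Sum>i<n. vec_index c i *\<^sub>C u i)"
  have ac: "(\<Sum>i<n. entry a l i * vec_index c i) = \<mu> * vec_index c l" if l: "l < n" for l
  proof -
    have "(\<Sum>i<n. entry a l i * vec_index c i) = vec_index (rep a *\<^sub>v c) l"
      using l c(1) unfolding rep_def by (simp add: scalar_prod_def atLeast0LessThan)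
    then show ?thesis using c l by simp
  qed
  have "a * w = (\<Sum>i<n. vec_index c i *\<^sub>C (frame_unit * a * u i))"
    unfolding w_def sum_distrib_left using a by (simp add: mult_scaleC_right)
  also have "\<dots> = (\<Sum>i<n. \<Sum>l<n. (entry a l i * vec_index c i) *\<^sub>C u l)"
    by (intro sum.cong) (auto simp: unit_mult_u sum_scaleC_right scaleC_scaleC mult.commute)
  also have "\<dots> = (\<Sum>l<n. (\<Sum>i<n. entry a l i * vec_index c i) *\<^sub>C u l)"
    by (subst sum.swap) (simp add: cvec.scale_sum_left)
  also have "\<dots> = \<mu> *\<^sub>C w"
    unfolding w_def sum_scaleC_right by (intro sum.cong) (auto simp: ac scaleC_scaleC)
  finally have "a * w = \<mu> *\<^sub>C w" .
  moreover have "w \<noteq> 0"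
  proof
    assume "w = 0"
    have "vec_index c j = 0" if j: "j < n" for j
    proof -
      have "0 = v j * w" using \<open>w = 0\<close> by simp
      also have "\<dots> = (\<Sum>i<n. if i = j then vec_index c j *\<^sub>C r j else 0)"
        unfolding w_def sum_distrib_left using j by (intro sum.cong) (auto simp: mult_scaleC_right v_u)
      finally show ?thesis using j r_nonzero[OF j] by simp
    qed
    then show False using c(1,2) by (auto simp: vec_eq_iff)
  qed
  ultimately show "\<mu> \<in> nonzero_spectrum a" using \<mu> by (rule eigenvalue_in_nonzero_spectrum)
next
  assume sp: "\<mu> \<in> nonzero_spectrum a"
  show "poly (char_poly (rep a)) \<mu> = 0"
  proof (rule ccontr)
    define C where "C = char_matrix (rep a) \<mu>"
    have C: "C \<in> carrier_mat n n" unfolding C_def by simp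
    assume "poly (char_poly (rep a)) \<mu> \<noteq> 0"
    then have "Determinant.det C \<noteq> 0"
      unfolding C_def using eigenvalue_det[OF rep_carrier] eigenvalue_root_char_poly[OF rep_carrier] by blast
    then have "C \<in> Group.Units (ring_mat TYPE(complex) n ())" by (rule det_non_zero_imp_unit[OF C])
    then obtain W where W: "W \<in> carrier_mat n n" "W * C = 1\<^sub>m n" "C * W = 1\<^sub>m n"
      unfolding Units_def by (auto simp: ring_mat_simps)
    have Cij: "C $$ (i, j) = entry a i j - (if i = j then \<mu> else 0)" if "i < n" "j < n" for i j
      unfolding C_def char_matrix_def rep_def using that by simp
    have CW: "(\<Sum>l<n. C $$ (i, l) * W $$ (l, j)) = (if i = j then 1 else 0)" if "i < n" "j < n" for i j
    proof -
      have "(C * W) $$ (i, j) = (\<Sum>l<n. C $$ (i, l) * W $$ (l, j))"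
        using that C W(1) by (simp add: scalar_prod_def atLeast0LessThan)
      then show ?thesis using W(3) that by simp
    qed
    have WC: "(\<Sum>l<n. W $$ (i, l) * C $$ (l, j)) = (if i = j then 1 else 0)" if "i < n" "j < n" for i j
    proof -
      have "(W * C) $$ (i, j) = (\<Sum>l<n. W $$ (i, l) * C $$ (l, j))"
        using that C W(1) by (simp add: scalar_prod_def atLeast0LessThan)
      then show ?thesis using W(2) that by simp
    qed
    \<comment> \<open>Entries of \<open>W\<close> between different blocks are harmless, since there
      \<open>u i * v j = 0\<close>.\<close>
    define w where "w = (\<Sum>i<n. \<Sum>j<n. W $$ (i, j) *\<^sub>C (u i * v j))"
    have Cu: "(a - \<mu> *\<^sub>C 1) * u i = (\<Sum>l<n. C $$ (l, i) *\<^sub>C u l)" if i: "i < n" for i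
    proof -
      have "(\<Sum>l<n. C $$ (l, i) *\<^sub>C u l) = (\<Sum>l<n. entry a l i *\<^sub>C u l - (if l = i then \<mu> *\<^sub>C u i else 0))"
        using i by (intro sum.cong) (auto simp: Cij cvec.scale_left_diff_distrib)
      also have "\<dots> = a * u i - \<mu> *\<^sub>C u i"
        unfolding sum_subtractf unit_mult_u[OF i, of a, symmetric] using i a by simp
      finally show ?thesis by (simp add: left_diff_distrib mult_scaleC_left)
    qed
    have vC: "v j * (a - \<mu> *\<^sub>C 1) = (\<Sum>l<n. C $$ (j, l) *\<^sub>C v l)" if j: "j < n" for j
    proof -
      have "(\<Sum>l<n. C $$ (j, l) *\<^sub>C v l) = (\<Sum>l<n. entry a j l *\<^sub>C v l - (if l = j then \<mu> *\<^sub>C v j else 0))"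
        using j by (intro sum.cong) (auto simp: Cij cvec.scale_left_diff_distrib)
      also have "\<dots> = v j * a - \<mu> *\<^sub>C v j"
        unfolding sum_subtractf v_mult_unit[OF j, of a, symmetric] using j a by (simp add: mult.assoc)
      finally show ?thesis by (simp add: right_diff_distrib mult_scaleC_right)
    qed
    have "(a - \<mu> *\<^sub>C 1) * w = (\<Sum>i<n. \<Sum>j<n. W $$ (i, j) *\<^sub>C (((a - \<mu> *\<^sub>C 1) * u i) * v j))"
      unfolding w_def by (simp add: sum_distrib_left mult_scaleC_right mult.assoc)
    also have "\<dots> = (\<Sum>i<n. \<Sum>j<n. \<Sum>l<n. (C $$ (l, i) * W $$ (i, j)) *\<^sub>C (u l * v j))"
      by (intro sum.cong refl) (simp add: Cu sum_distrib_right sum_scaleC_right mult_scaleC_left scaleC_scaleC mult.commute)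
    also have "\<dots> = (\<Sum>j<n. \<Sum>i<n. \<Sum>l<n. (C $$ (l, i) * W $$ (i, j)) *\<^sub>C (u l * v j))" by (rule sum.swap)
    also have "\<dots> = (\<Sum>j<n. \<Sum>l<n. \<Sum>i<n. (C $$ (l, i) * W $$ (i, j)) *\<^sub>C (u l * v j))"
      by (rule sum.cong[OF refl], rule sum.swap)
    also have "\<dots> = (\<Sum>j<n. \<Sum>l<n. (if l = j then 1 else 0) *\<^sub>C (u l * v j))"
      by (intro sum.cong refl) (simp add: cvec.scale_sum_left[symmetric] CW)
    also have "\<dots> = (\<Sum>j<n. \<Sum>l<n. if l = j then u j * v j else 0)"
      by (intro sum.cong refl) auto
    also have "\<dots> = frame_unit" unfolding frame_unit_def by (intro sum.cong) auto
    finally have 1: "(a - \<mu> *\<^sub>C 1) * w = frame_unit" .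
    have "w * (a - \<mu> *\<^sub>C 1) = (\<Sum>i<n. \<Sum>j<n. W $$ (i, j) *\<^sub>C (u i * (v j * (a - \<mu> *\<^sub>C 1))))"
      unfolding w_def by (simp add: sum_distrib_right mult_scaleC_left mult.assoc)
    also have "\<dots> = (\<Sum>i<n. \<Sum>j<n. \<Sum>l<n. (W $$ (i, j) * C $$ (j, l)) *\<^sub>C (u i * v l))"
      by (intro sum.cong refl) (simp add: vC sum_distrib_left sum_scaleC_right mult_scaleC_right scaleC_scaleC)
    also have "\<dots> = (\<Sum>i<n. \<Sum>l<n. \<Sum>j<n. (W $$ (i, j) * C $$ (j, l)) *\<^sub>C (u i * v l))"
      by (rule sum.cong[OF refl], rule sum.swap)
    also have "\<dots> = (\<Sum>i<n. \<Sum>l<n. (if i = l then 1 else 0) *\<^sub>C (u i * v l))"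
      by (intro sum.cong refl) (simp add: cvec.scale_sum_left[symmetric] WC)
    also have "\<dots> = (\<Sum>i<n. \<Sum>l<n. if i = l then u i * v i else 0)"
      by (intro sum.cong refl) auto
    also have "\<dots> = frame_unit" unfolding frame_unit_def by (intro sum.cong) auto
    finally have 2: "w * (a - \<mu> *\<^sub>C 1) = frame_unit" .
    have 3: "(\<mu> *\<^sub>C 1 - a) * (inverse \<mu> *\<^sub>C (1 - frame_unit)) = 1 - frame_unit"
      "(inverse \<mu> *\<^sub>C (1 - frame_unit)) * (\<mu> *\<^sub>C 1 - a) = 1 - frame_unit"
      using \<mu> a by (simp_all add: algebra_simps mult_scaleC_left mult_scaleC_right)
    have "(\<mu> *\<^sub>C 1 - a) * - w = frame_unit" "- w * (\<mu> *\<^sub>C 1 - a) = frame_unit"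
      using 1 2 by (simp_all add: algebra_simps)
    then have "(\<mu> *\<^sub>C 1 - a) * (- w + inverse \<mu> *\<^sub>C (1 - frame_unit)) = 1"
      "(- w + inverse \<mu> *\<^sub>C (1 - frame_unit)) * (\<mu> *\<^sub>C 1 - a) = 1"
      unfolding distrib_left distrib_right 3 by simp_all
    then show False using sp two_sided_invertibleI unfolding nonzero_spectrum_iff by blast
  qed
qed

lemma char_poly_rep: "char_poly (rep a) \<noteq> 0" "degree (char_poly (rep a)) = n"
  using degree_monic_char_poly[OF rep_carrier[of a]] by auto

lemma nonzero_spectrum_bound:
  assumes a: "frame_unit * a = a" "a * frame_unit = a"
  shows "finite (nonzero_spectrum a)" "card (nonzero_spectrum a) \<le> n"
proof -
  have sub: "nonzero_spectrum a \<subseteq> {z. poly (char_poly (rep a)) z = 0}"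
    using nonzero_spectrum_rep[OF a] nonzero_spectrum_iff by blast
  have fin: "finite {z. poly (char_poly (rep a)) z = 0}" using poly_roots_finite char_poly_rep by blast
  then show "finite (nonzero_spectrum a)" using sub finite_subset by blast
  have "card (nonzero_spectrum a) \<le> card {z. poly (char_poly (rep a)) z = 0}"
    using sub fin by (rule card_mono[rotated])
  also have "\<dots> \<le> n" using poly_roots_degree[of "char_poly (rep a)"] char_poly_rep by metis
  finally show "card (nonzero_spectrum a) \<le> n" .
qed

lemma spectral_rank_unit: "spectral_rank frame_unit = enat n"
proof (rule antisym)
  show "spectral_rank frame_unit \<le> enat n"
    unfolding spectral_rank_def
  proof (rule SUP_least)
    fix x
    have "nonzero_spectrum (x * frame_unit) = nonzero_spectrum (x * frame_unit * frame_unit)"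
      by (simp add: mult.assoc unit_idem)
    also have "\<dots> = nonzero_spectrum (frame_unit * (x * frame_unit))" by (rule nonzero_spectrum_mult_commute)
    finally have eq: "nonzero_spectrum (x * frame_unit) = nonzero_spectrum (frame_unit * (x * frame_unit))" .
    show "ecard (nonzero_spectrum (x * frame_unit)) \<le> enat n"
      unfolding eq ecard_def
      using nonzero_spectrum_bound[of "frame_unit * (x * frame_unit)"]
      by (simp add: mult.assoc unit_idem mult_eq_assoc[OF unit_idem])
  qed
  \<comment> \<open>A diagonal element with n distinct eigenvalues 1, ..., n; counting from 1 keeps
    them nonzero.\<close>
  define x where "x = (\<Sum>i<n. of_nat (Suc i) *\<^sub>C (u i * v i))"
  have "x * u j = of_nat (Suc j) *\<^sub>C u j" if j: "j < n" for j
  proof -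
    have "x * u j = (\<Sum>i<n. if i = j then of_nat (Suc j) *\<^sub>C u j else 0)"
      unfolding x_def sum_distrib_right using j
      by (intro sum.cong refl) (auto simp: mult_scaleC_left mult.assoc v_u u_r)
    then show ?thesis using j by simp
  qed
  moreover have "u j \<noteq> 0" if "j < n" for j using v_u[OF that that] r_nonzero[OF that] by auto
  moreover have xp: "x * frame_unit = x"
    unfolding x_def sum_distrib_right by (intro sum.cong refl) (simp add: mult_scaleC_left mult.assoc v_unit)
  ultimately have sub: "(\<lambda>i. of_nat (Suc i)) ` {..<n} \<subseteq> nonzero_spectrum (x * frame_unit)"
    using eigenvalue_in_nonzero_spectrum[of x] of_nat_neq_0 by (metis (no_types, lifting) image_subsetI lessThan_iff)
  have "enat n \<le> ecard (nonzero_spectrum (x * frame_unit))"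
  proof (cases "finite (nonzero_spectrum (x * frame_unit))")
    case True
    have "card ((\<lambda>i. of_nat (Suc i) :: complex) ` {..<n}) = n"
      by (subst card_image) (auto simp: inj_on_def)
    then have "n \<le> card (nonzero_spectrum (x * frame_unit))" using card_mono[OF True sub] by simp
    then show ?thesis using True by (simp add: ecard_def)
  qed (simp add: ecard_def)
  then show "enat n \<le> spectral_rank frame_unit"
    unfolding spectral_rank_def by (rule SUP_upper2[OF UNIV_I])
qed

text \<open>The products \<open>u i * v j\<close> with \<open>r i = r j\<close> are a basis:
  \<open>entry\<close> reads off their coefficients, and the remaining pairs have entry 0.\<close>

lemma complex_dim_corner:
  "complex_dim (corner frame_unit) = enat (card {(i, j). i < n \<and> j < n \<and> r i = r j})"
proof -
  define I where "I = {(i, j). i < n \<and> j < n \<and> r i = r j}"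
  have "I \<subseteq> {..<n} \<times> {..<n}" unfolding I_def by auto
  then have finI: "finite I" by (rule finite_subset) simp
  define b where "b = (\<lambda>(i, j). u i * v j)"
  have ent: "entry (b q) i j = (if q = (i, j) then 1 else 0)" if "q \<in> I" "i < n" "j < n" for q i j
    using that entry_matrix_unit[of i j "fst q" "snd q"] unfolding b_def I_def by (auto split: prod.splits)
  have inj: "inj_on b I"
  proof (rule inj_onI)
    fix p q assume pq: "p \<in> I" "q \<in> I" "b p = b q"
    obtain i j where p: "p = (i, j)" by (cases p)
    then have "i < n" "j < n" using pq(1) unfolding I_def by auto
    then show "p = q" using ent[OF pq(1)] ent[OF pq(2)] pq(3) p by (metis zero_neq_one)
  qed
  have B: "b ` I \<subseteq> corner frame_unit"
  proof (rule image_subsetI)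
    fix q assume "q \<in> I"
    then have "b q = frame_unit * b q * frame_unit"
      unfolding I_def b_def by (auto simp: mult.assoc v_unit mult_eq_assoc[OF unit_u])
    then show "b q \<in> corner frame_unit" unfolding corner_def by blast
  qed
  have span: "corner frame_unit \<subseteq> cvec.span (b ` I)"
  proof
    fix y assume "y \<in> corner frame_unit"
    then obtain x where "y = frame_unit * x * frame_unit" unfolding corner_def by blast
    also have "\<dots> = (\<Sum>i<n. u i * (v i * x * frame_unit))"
      by (subst (1) frame_unit_def) (simp add: sum_distrib_right mult.assoc)
    also have "\<dots> = (\<Sum>i<n. \<Sum>j<n. entry x i j *\<^sub>C (u i * v j))"
      by (intro sum.cong refl) (simp add: v_mult_unit sum_distrib_left mult_scaleC_right)
    finally have y: "y = (\<Sum>i<n. \<Sum>j<n. entry x i j *\<^sub>C (u i * v j))" .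
    show "y \<in> cvec.span (b ` I)" unfolding y
    proof (intro cvec.span_sum)
      fix i j assume ij: "i \<in> {..<n}" "j \<in> {..<n}"
      show "entry x i j *\<^sub>C (u i * v j) \<in> cvec.span (b ` I)"
      proof (cases "r i = r j")
        case True
        then have "u i * v j \<in> b ` I" using ij unfolding I_def b_def by (intro image_eqI[of _ _ "(i, j)"]) auto
        then show ?thesis by (intro cvec.span_scale cvec.span_base)
      next
        case False
        then show ?thesis using ij by (simp add: entry_unlinked cvec.span_zero)
      qed
    qed
  qed
  have ind: "cvec.independent (b ` I)"
  proof (rule cvec.independent_if_scalars_zero)
    show "finite (b ` I)" using finI by simp
    fix f x assume z: "(\<Sum>x\<in>b ` I. f x *\<^sub>C x) = 0" and "x \<in> b ` I"
    then obtain i j where ij: "x = b (i, j)" "(i, j) \<in> I" by auto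
    then have lt: "i < n" "j < n" unfolding I_def by auto
    have z': "(\<Sum>q\<in>I. f (b q) *\<^sub>C b q) = 0" using z by (simp add: sum.reindex[OF inj])
    have "0 = entry 0 i j" using lt by (intro entry_eqI[symmetric]) auto
    also have "\<dots> = (\<Sum>q\<in>I. f (b q) * entry (b q) i j)"
      unfolding z'[symmetric] using lt by (simp add: entry_sum entry_scaleC)
    also have "\<dots> = (\<Sum>q\<in>I. if q = (i, j) then f x else 0)"
      using lt ij by (intro sum.cong refl) (auto simp: ent)
    also have "\<dots> = f x" using finI ij by simp
    finally show "f x = 0" by simp
  qed
  have "cvec.dim (corner frame_unit) = card I"
    using cvec.dim_unique[OF B span ind] card_image[OF inj] by blast
  moreover have "\<exists>B. finite B \<and> corner frame_unit \<subseteq> cvec.span B" using finI span by blast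
  ultimately show ?thesis unfolding complex_dim_def I_def by simp
qed

lemma diagonal_entry:
  assumes "i < n"
  shows "(u i * v i) * a * (u i * v i) = entry a i i *\<^sub>C (u i * v i)"
proof -
  have "(u i * v i) * a * (u i * v i) = u i * (v i * a * u i) * v i" by (simp add: mult.assoc)
  then show ?thesis using assms by (simp add: entry mult_scaleC_left mult_scaleC_right u_r)
qed

end

section \<open>Two extreme frames: all blocks of size one, or a single block\<close>

lemma matrix_frame_diagonal:
  assumes "\<And>i. i < n \<Longrightarrow> minimal_idempotent (e i)"
    and "\<And>i j x. i < n \<Longrightarrow> j < n \<Longrightarrow> i \<noteq> j \<Longrightarrow> e i * x * e j = 0"
  shows "matrix_frame n e e e"
proof
  fix i j x assume "i < n" "j < n"
  then show "e i * e j = (if i = j then e i else 0)"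
    using assms(2)[of i j 1] minimal_idempotentD(2)[OF assms(1)] by auto
  show "e i * x * e j = 0" if "e i \<noteq> e j" using assms(2) that \<open>i < n\<close> \<open>j < n\<close> by metis
qed (use assms(1) minimal_idempotentD(2) in auto)

context semisimple_algebra
begin

text \<open>A left inverse of \<open>u = e * x * f\<close>, cut down by e, serves as v. Then
  \<open>u * v\<close> is a multiple of \<open>e\<close>, and \<open>u = u * v * u\<close> forces
  the scalar to be 1.\<close>

lemma minimal_idempotent_equivalence:
  fixes e f :: 'a
  assumes e: "minimal_idempotent e" and f: "minimal_idempotent f" and "e * x * f \<noteq> 0"
  obtains u v where "e * u = u" "u * f = u" "f * v = v" "v * e = v" "v * u = f" "u * v = e"
proof -
  define u where "u = e * x * f"
  have u: "e * u = u" "u * f = u" "u \<noteq> 0"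
    unfolding u_def using assms(3) minimal_idempotentD(2,3)[OF e] minimal_idempotentD(2)[OF f] by (simp_all add: mult.assoc)
  obtain y where y: "y * u = f" "f * y = y" using minimal_left_inverse[OF f u(2,3)] by blast
  define v where "v = y * e"
  have v: "f * v = v" "v * e = v" "v * u = f"
    unfolding v_def using y u minimal_idempotentD(2)[OF e] by (simp_all add: mult.assoc mult_eq_assoc[OF y(2)])
  have "e * (u * v) = u * v" "u * v * e = u * v" using u v by (simp_all add: mult.assoc mult_eq_assoc[OF u(1)])
  then obtain c where c: "u * v = c *\<^sub>C e" using minimal_idempotent_corner[OF e] by blast
  have "u = u * v * u" using u v by (simp add: mult.assoc)
  also have "\<dots> = c *\<^sub>C u" unfolding c by (simp add: mult_scaleC_left u)
  finally have "(1 - c) *\<^sub>C u = 0" by (simp add: cvec.scale_left_diff_distrib)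
  then have "c = 1" using u(3) by simp
  then show ?thesis using that u v c by simp
qed

lemma matrix_frame_equivalent:
  fixes e :: "nat \<Rightarrow> 'a"
  assumes e: "\<And>i. i < n \<Longrightarrow> minimal_idempotent (e i)" "\<And>i j. i < n \<Longrightarrow> j < n \<Longrightarrow> i \<noteq> j \<Longrightarrow> e i * e j = 0"
    and f: "minimal_idempotent f" and eq: "\<And>i. i < n \<Longrightarrow> \<exists>x. e i * x * f \<noteq> 0"
  obtains u v where "matrix_frame n (\<lambda>_. f) u v" "\<And>i. i < n \<Longrightarrow> u i * v i = e i"
proof -
  have "\<exists>u v. e i * u = u \<and> u * f = u \<and> f * v = v \<and> v * e i = v \<and> v * u = f \<and> u * v = e i" if "i < n" for i
    using minimal_idempotent_equivalence[OF e(1)[OF that] f] eq[OF that] by metis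
  then obtain u v where uv: "\<And>i. i < n \<Longrightarrow> e i * u i = u i \<and> u i * f = u i \<and> f * v i = v i \<and> v i * e i = v i \<and> v i * u i = f \<and> u i * v i = e i"
    by metis
  have "matrix_frame n (\<lambda>_. f) u v"
  proof
    fix i j assume ij: "i < n" "j < n"
    show "v i * u j = (if i = j then f else 0)"
    proof (cases "i = j")
      case False
      have "v i * u j = v i * (e i * e j) * u j" using uv[OF ij(1)] uv[OF ij(2)]
        by (simp add: mult.assoc[symmetric]) (simp add: mult.assoc)
      then show ?thesis using e(2)[OF ij False] False by simp
    qed (use uv ij in simp)
  qed (use uv f in auto)
  then show ?thesis using that uv by blast
qed

end

section \<open>The spectral trace\<close>

lemma order_linear_factor: "Polynomial.order z [:- a, 1:] = (if z = a then 1 else 0)" for a :: complex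
proof (cases "z = a")
  case True
  then show ?thesis using order_power_n_n[of a 1] by simp
next
  case False
  then show ?thesis by (simp add: order_0I)
qed

lemma prod_linear_factors_nonzero: "(\<Prod>a\<leftarrow>as. [:- a, 1:]) \<noteq> (0 :: complex poly)"
  by (auto simp: prod_list_zero_iff)

lemma order_prod_linear_factors:
  "Polynomial.order z (\<Prod>a\<leftarrow>as. [:- a, 1:]) = count_list as z" for as :: "complex list"
proof (induction as)
  case (Cons a as)
  have "[:- a, 1:] * (\<Prod>a\<leftarrow>as. [:- a, 1:]) \<noteq> 0"
    using prod_linear_factors_nonzero[of "a # as"] by (simp only: list.map prod_list.Cons not_False_eq_True)
  then show ?case using Cons order_mult[of "[:- a, 1:]" "\<Prod>a\<leftarrow>as. [:- a, 1:]" z] by (simp add: order_linear_factor)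
qed simp

lemma sum_roots_order:
  fixes as :: "complex list"
  assumes "p = (\<Prod>a\<leftarrow>as. [:- a, 1:])"
  shows "(\<Sum>z | poly p z = 0. z * of_nat (Polynomial.order z p)) = sum_list as"
proof -
  have nz: "p \<noteq> 0" unfolding assms by (rule prod_linear_factors_nonzero)
  have roots: "{z. poly p z = 0} = set as"
    using order_root[of p] nz unfolding assms order_prod_linear_factors
    by (auto simp: count_list_0_iff)
  have "sum_list (map (\<lambda>z. z) as) = (\<Sum>z\<in>set as. of_nat (count_list as z) * z)"
  proof (induction as)
    case (Cons a as)
    have "(\<Sum>z\<in>set (a # as). of_nat (count_list (a # as) z) * z) =
      (\<Sum>z\<in>set (a # as). of_nat (count_list as z) * z + (if z = a then a else 0))"
      by (intro sum.cong refl) (auto simp: algebra_simps)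
    also have "\<dots> = (\<Sum>z\<in>set (a # as). of_nat (count_list as z) * z) + a"
      by (simp add: sum.distrib)
    also have "(\<Sum>z\<in>set (a # as). of_nat (count_list as z) * z) = (\<Sum>z\<in>set as. of_nat (count_list as z) * z)"
      by (rule sum.mono_neutral_right) (auto simp: count_list_0_iff)
    finally show ?case using Cons by simp
  qed simp
  then show ?thesis unfolding roots unfolding assms order_prod_linear_factors by (simp add: mult.commute)
qed

lemma schur_form:
  fixes A :: "complex mat"
  assumes A: "A \<in> carrier_mat n n"
  obtains B P Q as where "B \<in> carrier_mat n n" "P \<in> carrier_mat n n" "Q \<in> carrier_mat n n"
    "P * Q = 1\<^sub>m n" "Q * P = 1\<^sub>m n" "A = P * B * Q" "upper_triangular B"
    "diag_mat B = as" "char_poly A = (\<Prod>a\<leftarrow>as. [:- a, 1:])"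
proof -
  obtain as where as: "char_poly A = (\<Prod>a\<leftarrow>as. [:- a, 1:])" using char_poly_factorized[OF A] by blast
  obtain B P Q where s: "schur_decomposition A as = (B, P, Q)" by (cases "schur_decomposition A as") auto
  from schur_decomposition[OF A as s] have w: "similar_mat_wit A B P Q" "upper_triangular B" "diag_mat B = as" by auto
  show ?thesis using that similar_mat_witD2[OF A w(1)] w as by blast
qed

lemma mat_mult_entry:
  fixes P :: "complex mat"
  assumes "P \<in> carrier_mat n n" "Q \<in> carrier_mat n n" "i < n" "j < n"
  shows "(P * Q) $$ (i, j) = (\<Sum>k<n. P $$ (i, k) * Q $$ (k, j))"
  using assms by (simp add: scalar_prod_def atLeast0LessThan)

lemma mat_mult3_entry:
  fixes P :: "complex mat"
  assumes "P \<in> carrier_mat n n" "B \<in> carrier_mat n n" "Q \<in> carrier_mat n n" "i < n" "j < n"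
  shows "(P * B * Q) $$ (i, j) = (\<Sum>k<n. \<Sum>l<n. P $$ (i, l) * B $$ (l, k) * Q $$ (k, j))"
proof -
  have PB: "P * B \<in> carrier_mat n n" using assms by simp
  show ?thesis
    unfolding mat_mult_entry[OF PB assms(3,4,5)]
    by (intro sum.cong refl) (use assms in \<open>subst mat_mult_entry[OF assms(1,2,4)], auto simp: sum_distrib_right\<close>)
qed

text \<open>The interchange of sums is cyclicity of the trace. It passes to the triangular Schur
  form, whose diagonal lists the roots of the characteristic polynomial.\<close>

lemma sum_eigenvalues_eq_trace:
  fixes A :: "complex mat"
  assumes A: "A \<in> carrier_mat n n"
  shows "(\<Sum>z | poly (char_poly A) z = 0. z * of_nat (Polynomial.order z (char_poly A))) = (\<Sum>i<n. A $$ (i, i))"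
proof -
  obtain B P Q as where s: "B \<in> carrier_mat n n" "P \<in> carrier_mat n n" "Q \<in> carrier_mat n n"
    "P * Q = 1\<^sub>m n" "Q * P = 1\<^sub>m n" "A = P * B * Q" "diag_mat B = as" "char_poly A = (\<Prod>a\<leftarrow>as. [:- a, 1:])"
    using schur_form[OF A] by metis
  have "(\<Sum>i<n. A $$ (i, i)) = (\<Sum>i<n. \<Sum>k<n. \<Sum>l<n. P $$ (i, l) * B $$ (l, k) * Q $$ (k, i))"
    unfolding s(6) by (intro sum.cong refl mat_mult3_entry[OF s(2,1,3)]) auto
  also have "\<dots> = (\<Sum>k<n. \<Sum>i<n. \<Sum>l<n. P $$ (i, l) * B $$ (l, k) * Q $$ (k, i))" by (rule sum.swap)
  also have "\<dots> = (\<Sum>k<n. \<Sum>l<n. \<Sum>i<n. P $$ (i, l) * B $$ (l, k) * Q $$ (k, i))"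
    by (rule sum.cong[OF refl], rule sum.swap)
  also have "\<dots> = (\<Sum>k<n. \<Sum>l<n. B $$ (l, k) * (Q * P) $$ (k, l))"
    by (intro sum.cong refl) (subst mat_mult_entry[OF s(3,2)], auto simp: sum_distrib_left mult_ac)
  also have "\<dots> = (\<Sum>k<n. \<Sum>l<n. if l = k then B $$ (k, k) else 0)"
    unfolding s(5) by (intro sum.cong refl) auto
  also have "\<dots> = (\<Sum>k<n. B $$ (k, k))" by (intro sum.cong) auto
  also have "\<dots> = sum_list as"
    unfolding s(7)[symmetric] diag_mat_def using s(1) by (simp add: sum_list_sum_nth atLeast0LessThan)
  finally show ?thesis using sum_roots_order[OF s(8)] by simp
qed

text \<open>Adding t (1, ..., n) to the diagonal of a Schur form separates the eigenvalues from each other and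
  from 0 for all but finitely many t.\<close>

lemma simple_spectrum_perturbation:
  fixes A :: "complex mat"
  assumes A: "A \<in> carrier_mat n n" and "0 < \<epsilon>"
  obtains W where "W \<in> carrier_mat n n" "\<And>i j. i < n \<Longrightarrow> j < n \<Longrightarrow> cmod (W $$ (i, j)) < \<epsilon>"
    "card {z. z \<noteq> 0 \<and> poly (char_poly (A + W)) z = 0} = n"
proof -
  obtain B P Q as where s: "B \<in> carrier_mat n n" "P \<in> carrier_mat n n" "Q \<in> carrier_mat n n"
    "P * Q = 1\<^sub>m n" "Q * P = 1\<^sub>m n" "A = P * B * Q" "upper_triangular B"
    using schur_form[OF A] by metis
  define D where "D = Matrix.mat n n (\<lambda>(i, j). if i = j then of_nat (Suc i) else (0::complex))"
  have D: "D \<in> carrier_mat n n" unfolding D_def by simp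
  define K where "K = P * D * Q"
  have K: "K \<in> carrier_mat n n" unfolding K_def using s D by simp
  define M where "M = 1 + (\<Sum>i<n. \<Sum>j<n. cmod (K $$ (i, j)))"
  have M: "cmod (K $$ (i, j)) < M" if "i < n" "j < n" for i j
  proof -
    have "cmod (K $$ (i, j)) \<le> (\<Sum>j<n. cmod (K $$ (i, j)))" using that by (intro member_le_sum) auto
    also have "\<dots> \<le> (\<Sum>i<n. \<Sum>j<n. cmod (K $$ (i, j)))"
      using that by (intro member_le_sum[of i "{..<n}" "\<lambda>i. \<Sum>j<n. cmod (K $$ (i, j))"]) (auto intro: sum_nonneg)
    finally show ?thesis unfolding M_def by simp
  qed
  have M1: "M \<ge> 1" unfolding M_def by (simp add: sum_nonneg)
  \<comment> \<open>The parameters at which a perturbed diagonal entry vanishes or two of them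
    coincide. A pair with i = j contributes only the value 0, by division by 0, and the parameter
    chosen below is positive.\<close>
  define bad where "bad = (\<lambda>i. - B $$ (i, i) / of_nat (Suc i)) ` {..<n}
    \<union> (\<lambda>(i, j). (B $$ (j, j) - B $$ (i, i)) / (of_nat (Suc i) - of_nat (Suc j))) ` ({..<n} \<times> {..<n})"
  have "finite bad" unfolding bad_def by simp
  then have "finite {\<tau>::real. complex_of_real \<tau> \<in> bad}"
    using finite_vimageI[of bad complex_of_real] by (simp add: vimage_def inj_of_real)
  moreover have "infinite {0 <..< \<epsilon> / M}" using assms(2) M1 by (simp add: infinite_Ioo)
  ultimately obtain \<tau> where \<tau>: "0 < \<tau>" "\<tau> < \<epsilon> / M" "complex_of_real \<tau> \<notin> bad"
    by (metis (mono_tags, lifting) finite_subset greaterThanLessThan_iff mem_Collect_eq subsetI)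
  define t where "t = complex_of_real \<tau>"
  define d where "d i = B $$ (i, i) + t * of_nat (Suc i)" for i
  have d0: "d i \<noteq> 0" if "i < n" for i
  proof
    assume "d i = 0"
    then have "t = - B $$ (i, i) / of_nat (Suc i)"
      unfolding d_def by (simp add: field_simps add_eq_0_iff del: of_nat_Suc)
    then show False using \<tau>(3) that unfolding t_def bad_def by blast
  qed
  have inj: "inj_on d {..<n}"
  proof (rule inj_onI, rule ccontr)
    fix i j assume ij: "i \<in> {..<n}" "j \<in> {..<n}" "d i = d j" "i \<noteq> j"
    then have ne: "(of_nat (Suc i) - of_nat (Suc j) :: complex) \<noteq> 0" by (simp del: of_nat_Suc)
    have "t * (of_nat (Suc i) - of_nat (Suc j)) = B $$ (j, j) - B $$ (i, i)"
      using ij(3) unfolding d_def by (simp add: algebra_simps del: of_nat_Suc)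
    then have "t = (B $$ (j, j) - B $$ (i, i)) / (of_nat (Suc i) - of_nat (Suc j))"
      using ne by (simp add: eq_divide_eq)
    then have "t \<in> bad" unfolding bad_def using ij(1,2) by (intro UnI2 image_eqI[of _ _ "(i, j)"]) auto
    then show False using \<tau>(3) unfolding t_def by blast
  qed
  define W where "W = t \<cdot>\<^sub>m K"
  define C where "C = B + t \<cdot>\<^sub>m D"
  have W: "W \<in> carrier_mat n n" unfolding W_def using K by simp
  have C: "C \<in> carrier_mat n n" unfolding C_def using s D by simp
  have "A + W = P * C * Q"
  proof (rule eq_matI)
    fix i j assume "i < dim_row (P * C * Q)" "j < dim_col (P * C * Q)"
    then have ij: "i < n" "j < n" using s C by auto
    have "(A + W) $$ (i, j) = A $$ (i, j) + t * K $$ (i, j)" unfolding W_def using ij K A by simp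
    also have "\<dots> = (\<Sum>k<n. \<Sum>l<n. P $$ (i, l) * C $$ (l, k) * Q $$ (k, j))"
      unfolding s(6) K_def mat_mult3_entry[OF s(2,1,3) ij] mat_mult3_entry[OF s(2) D s(3) ij] sum_distrib_left sum.distrib[symmetric]
      using s(1) D by (intro sum.cong refl) (simp add: C_def algebra_simps)
    finally show "(A + W) $$ (i, j) = (P * C * Q) $$ (i, j)" unfolding mat_mult3_entry[OF s(2) C s(3) ij] .
  qed (use A W s C in auto)
  then have "similar_mat (A + W) C" using s W C A by (intro similar_matI[of _ _ P Q n]) auto
  then have "char_poly (A + W) = char_poly C" by (rule char_poly_similar)
  also have "\<dots> = (\<Prod>a\<leftarrow>diag_mat C. [:- a, 1:])"
    using C s(1,7) by (intro char_poly_upper_triangular) (auto simp: C_def D_def upper_triangular_def)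
  finally have cp: "char_poly (A + W) = (\<Prod>a\<leftarrow>diag_mat C. [:- a, 1:])" .
  have diag: "set (diag_mat C) = d ` {..<n}"
    unfolding diag_mat_def C_def d_def using s(1) D by (auto simp: D_def image_iff)
  have "poly (char_poly (A + W)) z = 0 \<longleftrightarrow> z \<in> d ` {..<n}" for z
    unfolding cp diag[symmetric] poly_prod_list by (auto simp: prod_list_zero_iff)
  then have "{z. z \<noteq> 0 \<and> poly (char_poly (A + W)) z = 0} = d ` {..<n}" using d0 by auto
  then have "card {z. z \<noteq> 0 \<and> poly (char_poly (A + W)) z = 0} = n" using inj by (simp add: card_image)
  moreover have "cmod (W $$ (i, j)) < \<epsilon>" if "i < n" "j < n" for i j
  proof -
    have "cmod (W $$ (i, j)) = \<tau> * cmod (K $$ (i, j))"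
      unfolding W_def t_def using that K \<tau>(1) by (simp add: norm_mult)
    also have "\<dots> \<le> \<tau> * M" using M[OF that] \<tau>(1) by simp
    also have "\<dots> < \<epsilon>" using \<tau>(2) M1 by (simp add: pos_less_divide_eq)
    finally show ?thesis .
  qed
  ultimately show ?thesis using that W by blast
qed

section \<open>Root counting and stability of spectra\<close>

lemma zorder_poly:
  fixes p :: "complex poly"
  assumes "p \<noteq> 0"
  shows "zorder (poly p) z = int (Polynomial.order z p)"
proof -
  obtain q where q: "p = [:- z, 1:] ^ Polynomial.order z p * q" "\<not> [:- z, 1:] dvd q"
    using order_decomp[OF assms] by blast
  show ?thesis
  proof (rule zorder_eqI[of UNIV z "poly q"])
    show "poly q holomorphic_on UNIV"
      unfolding holomorphic_on_def field_differentiable_def by (auto intro!: exI poly_DERIV)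
    show "poly q z \<noteq> 0" using q(2) by (simp add: poly_eq_0_iff_dvd)
    show "poly p w = poly q w * (w - z) powi int (Polynomial.order z p)" for w
      by (subst q(1)) (simp add: power_int_def)
  qed auto
qed

text \<open>Rouche's theorem weights zeros by winding number, which for a circle is 1 inside the
  ball and 0 outside the closed ball; the strict inequality keeps the zeros of p and q off the
  circle itself.\<close>

lemma count_roots_near:
  fixes p q :: "complex poly"
  assumes r: "0 < r" and p: "p \<noteq> 0" and q: "q \<noteq> 0"
    and small: "\<And>z. z \<in> sphere c r \<Longrightarrow> cmod (poly q z - poly p z) < cmod (poly p z)"
  shows "(\<Sum>z | poly q z = 0 \<and> z \<in> ball c r. Polynomial.order z q) = (\<Sum>z | poly p z = 0 \<and> z \<in> ball c r. Polynomial.order z p)"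
proof -
  have holo: "poly f holomorphic_on UNIV" for f :: "complex poly"
    unfolding holomorphic_on_def field_differentiable_def by (auto intro!: exI poly_DERIV)
  have *: "(\<Sum>z | poly f z = 0. winding_number (circlepath c r) z * of_int (zorder (poly f) z)) =
      of_nat (\<Sum>z | poly f z = 0 \<and> z \<in> ball c r. Polynomial.order z f)"
    if f: "f \<noteq> 0" and ns: "\<And>z. z \<in> sphere c r \<Longrightarrow> poly f z \<noteq> 0" for f :: "complex poly"
  proof -
    have fin: "finite {z. poly f z = 0}" using poly_roots_finite[OF f] .
    have "winding_number (circlepath c r) z = (if z \<in> ball c r then 1 else 0)" if "poly f z = 0" for z
    proof (cases "z \<in> ball c r")
      case True
      then show ?thesis using winding_number_circlepath[of z c r] by (simp add: dist_norm norm_minus_commute)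
    next
      case False
      then have "z \<notin> cball c r" using ns that by force
      then have "winding_number (circlepath c r) z = 0"
        using r by (intro winding_number_zero_outside[of _ "cball c r"]) auto
      then show ?thesis using False by simp
    qed
    then have "(\<Sum>z | poly f z = 0. winding_number (circlepath c r) z * of_int (zorder (poly f) z)) =
        (\<Sum>z | poly f z = 0. if z \<in> ball c r then of_nat (Polynomial.order z f) else 0)"
      by (intro sum.cong refl) (auto simp: zorder_poly[OF f])
    also have "\<dots> = (\<Sum>z \<in> {z. poly f z = 0} \<inter> ball c r. of_nat (Polynomial.order z f))"
      using fin by (simp add: sum.inter_restrict)
    also have "{z. poly f z = 0} \<inter> ball c r = {z. poly f z = 0 \<and> z \<in> ball c r}" by blast
    finally show ?thesis by simp
  qed
  have eq: "(\<lambda>z. poly p z + (poly q z - poly p z)) = poly q" by auto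
  have "(\<Sum>z\<in>{z\<in>UNIV. poly p z + (poly q z - poly p z) = 0}.
      winding_number (circlepath c r) z * of_int (zorder (\<lambda>z. poly p z + (poly q z - poly p z)) z)) =
    (\<Sum>z\<in>{z\<in>UNIV. poly p z = 0}. winding_number (circlepath c r) z * of_int (zorder (poly p) z))"
  proof (rule Rouche_theorem)
    show "finite {z \<in> UNIV. poly p z + (poly q z - poly p z) = 0}" using poly_roots_finite[OF q] by simp
    show "finite {z \<in> UNIV. poly p z = 0}" using poly_roots_finite[OF p] by simp
    show "(\<lambda>z. poly q z - poly p z) holomorphic_on UNIV" by (intro holomorphic_intros holo)
    show "\<forall>z\<in>path_image (circlepath c r). cmod (poly q z - poly p z) < cmod (poly p z)"
      using small r by simp
  qed (auto simp: holo)
  then have "(\<Sum>z | poly q z = 0. winding_number (circlepath c r) z * of_int (zorder (poly q) z)) =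
    (\<Sum>z | poly p z = 0. winding_number (circlepath c r) z * of_int (zorder (poly p) z))"
    unfolding eq by simp
  moreover have "poly p z \<noteq> 0" "poly q z \<noteq> 0" if "z \<in> sphere c r" for z
    using small[OF that] by auto
  ultimately have "(of_nat (\<Sum>z | poly q z = 0 \<and> z \<in> ball c r. Polynomial.order z q) :: complex) =
      of_nat (\<Sum>z | poly p z = 0 \<and> z \<in> ball c r. Polynomial.order z p)"
    using *[OF p] *[OF q] by simp
  then show ?thesis by (simp only: of_nat_eq_iff)
qed

text \<open>The pairs (x, z) with \<open>z *\<^sub>C 1 - x * a\<close> invertible form an open set
  containing the slice of \<open>K\<close> over x = 1; the tube lemma thickens this slice.\<close>

lemma spectrum_avoids_compact:
  fixes a :: "'a::complex_banach_algebra_1"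
  assumes "compact K" "K \<inter> alg_spectrum a = {}"
  obtains \<epsilon> where "0 < \<epsilon>" "\<And>x. x \<in> ball 1 \<epsilon> \<Longrightarrow> K \<inter> alg_spectrum (x * a) = {}"
proof -
  define W where "W = {q :: 'a \<times> complex. two_sided_invertible (snd q *\<^sub>C 1 - fst q * a)}"
  have "continuous_on UNIV (\<lambda>q :: 'a \<times> complex. snd q *\<^sub>C 1 - fst q * a)"
    by (intro continuous_intros)
  then have "open W" unfolding W_def using open_two_sided_invertible
    by (metis (mono_tags, lifting) Collect_cong mem_Collect_eq open_vimage vimage_def)
  moreover have "{1} \<times> K \<subseteq> W" using assms(2) unfolding W_def alg_spectrum_def by auto
  ultimately have "\<exists>X. 1 \<in> X \<and> open X \<and> X \<times> K \<subseteq> W"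
    by (rule Elementary_Topology.tube_lemma[OF assms(1)])
  then obtain X where X: "1 \<in> X" "open X" "X \<times> K \<subseteq> W" by blast
  then obtain \<epsilon> where \<epsilon>: "0 < \<epsilon>" "ball 1 \<epsilon> \<subseteq> X" using openE by blast
  have "K \<inter> alg_spectrum (x * a) = {}" if "x \<in> ball 1 \<epsilon>" for x
  proof -
    have "{x} \<times> K \<subseteq> W" using X(3) \<epsilon>(2) that by blast
    then show ?thesis unfolding W_def alg_spectrum_def by auto
  qed
  then show ?thesis using that \<epsilon>(1) by blast
qed

text \<open>\<open>x * a\<close> may lie outside the corner of the frame. Cyclic exchange of factors
  moves its nonzero spectrum to \<open>a * x * frame_unit\<close>, which lies inside.\<close>

lemma (in matrix_frame) nonzero_spectrum_mult_left:
  assumes unit_a: "frame_unit * a = a"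
  shows "nonzero_spectrum (x * a) = {z. z \<noteq> 0 \<and> poly (char_poly (rep (a * x))) z = 0}"
proof -
  define c where "c = a * x * frame_unit"
  have c: "frame_unit * c = c" "c * frame_unit = c"
    unfolding c_def by (simp_all add: mult.assoc unit_idem mult_eq_assoc[OF unit_a])
  have "nonzero_spectrum (x * a) = nonzero_spectrum (a * x)" by (rule nonzero_spectrum_mult_commute)
  also have "\<dots> = nonzero_spectrum (frame_unit * (a * x))" by (simp add: mult_eq_assoc[OF unit_a])
  also have "\<dots> = nonzero_spectrum c" unfolding c_def by (rule nonzero_spectrum_mult_commute)
  finally have sp: "nonzero_spectrum (x * a) = nonzero_spectrum c" .
  have "frame_unit * (a * x) * frame_unit = c" unfolding c_def by (simp add: mult.assoc mult_eq_assoc[OF unit_a])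
  then have "rep c = rep (a * x)" using rep_compress[of "a * x"] by simp
  then show ?thesis unfolding sp using nonzero_spectrum_rep[OF c] nonzero_spectrum_iff[of _ c] by auto
qed

text \<open>The condition on b says a A = frame_unit A, so the frame has exactly the rank of a.\<close>

locale regular_frame = matrix_frame n r u v for n and r u v :: "nat \<Rightarrow> 'a::complex_banach_algebra_1" +
  fixes a b :: 'a
  assumes unit_a: "frame_unit * a = a" and a_b: "a * b = frame_unit"
    and dense: "\<And>\<epsilon>. 0 < \<epsilon> \<Longrightarrow> \<exists>x\<in>ball 1 \<epsilon>. ecard (nonzero_spectrum (x * a)) = enat n"
begin

abbreviation "cp x \<equiv> char_poly (rep (a * x))"

lemmas nonzero_spectrum_eq = nonzero_spectrum_mult_left[OF unit_a]

lemma finite_roots: "finite {z. poly (cp x) z = 0}"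
  using poly_roots_finite char_poly_rep(1) .

lemma card_roots: "card {z. poly (cp x) z = 0} \<le> n"
  using poly_roots_degree[OF char_poly_rep(1)] char_poly_rep(2) by metis

lemma spectral_rank_eq: "spectral_rank a = enat n"
proof (rule antisym)
  show "spectral_rank a \<le> enat n"
    unfolding spectral_rank_def
  proof (rule SUP_least)
    fix x
    have "card (nonzero_spectrum (x * a)) \<le> card {z. poly (cp x) z = 0}" "finite (nonzero_spectrum (x * a))"
      unfolding nonzero_spectrum_eq using finite_roots[of x] by (auto intro: card_mono finite_subset)
    then show "ecard (nonzero_spectrum (x * a)) \<le> enat n" using card_roots[of x] by (simp add: ecard_def)
  qed
  obtain x where "ecard (nonzero_spectrum (x * a)) = enat n" using dense[of 1] by auto
  then show "enat n \<le> spectral_rank a" unfolding spectral_rank_def by (metis SUP_upper UNIV_I)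
qed

text \<open>At such x the spectrum supplies n different nonzero roots of a polynomial of degree n,
  so there are no others and all are simple.\<close>

lemma max_rank_set_roots:
  assumes "x \<in> max_rank_set a"
  shows "poly (cp x) z = 0 \<Longrightarrow> z \<noteq> 0" "poly (cp x) z = 0 \<Longrightarrow> Polynomial.order z (cp x) = 1"
proof -
  have fin: "finite {z. poly (cp x) z = 0}" by (rule finite_roots)
  have "finite (nonzero_spectrum (x * a))" "card (nonzero_spectrum (x * a)) = n"
    using assms unfolding max_rank_set_def spectral_rank_eq ecard_def by (auto split: if_splits)
  moreover have sub: "nonzero_spectrum (x * a) \<subseteq> {z. poly (cp x) z = 0}" unfolding nonzero_spectrum_eq by blast
  ultimately have eq: "nonzero_spectrum (x * a) = {z. poly (cp x) z = 0}" and card: "card {z. poly (cp x) z = 0} = n"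
    using card_roots[of x] fin by (metis card_seteq, metis card_mono card_roots le_antisym)
  show "z \<noteq> 0" if "poly (cp x) z = 0" using eq that unfolding nonzero_spectrum_eq by blast
  have ge: "1 \<le> Polynomial.order z (cp x)" if "poly (cp x) z = 0" for z
    using that char_poly_rep(1) order_root[of "cp x" z] by (metis One_nat_def Suc_leI neq0_conv)
  show "Polynomial.order z (cp x) = 1" if z: "poly (cp x) z = 0"
  proof (rule ccontr)
    assume "Polynomial.order z (cp x) \<noteq> 1"
    then have "1 < Polynomial.order z (cp x)" using ge[OF z] by simp
    then have "(\<Sum>z | poly (cp x) z = 0. 1) < (\<Sum>z | poly (cp x) z = 0. Polynomial.order z (cp x))"
      using fin z ge by (intro sum_strict_mono_ex1) auto
    then show False using card sum_order_le_degree[OF char_poly_rep(1), of "a * x"] char_poly_rep(2)[of "a * x"] by simp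
  qed
qed

lemma continuous_entry:
  assumes "i < n" "j < n"
  shows "continuous_on UNIV (\<lambda>x. entry (a * x) i j)"
  unfolding continuous_on_def
proof
  fix x0 :: 'a
  have ev: "cmod (entry (a * x) i j - entry (a * x0) i j) \<le> norm (v i * a * (x - x0) * u j) / norm (r i)" for x
  proof -
    have "(entry (a * x) i j - entry (a * x0) i j) *\<^sub>C r i = v i * a * (x - x0) * u j"
      using entry[OF assms, of "a * x"] entry[OF assms, of "a * x0"]
      by (simp add: cvec.scale_left_diff_distrib algebra_simps)
    then have "cmod (entry (a * x) i j - entry (a * x0) i j) * norm (r i) = norm (v i * a * (x - x0) * u j)"
      by (metis norm_scaleC)
    then show ?thesis using r_nonzero[OF assms(1)] by (simp add: field_simps)
  qed
  have "((\<lambda>x. norm (v i * a * (x - x0) * u j) / norm (r i)) \<longlongrightarrow> norm (v i * a * (x0 - x0) * u j) / norm (r i)) (at x0)"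
    by (intro tendsto_intros) (use r_nonzero[OF assms(1)] in simp)
  then have "((\<lambda>x. entry (a * x) i j - entry (a * x0) i j) \<longlongrightarrow> 0) (at x0)"
    by (intro Lim_null_comparison[OF always_eventually[OF allI[OF ev]]]) simp
  then show "((\<lambda>x. entry (a * x) i j) \<longlongrightarrow> entry (a * x0) i j) (at x0 within UNIV)"
    using LIM_zero_iff by blast
qed

text \<open>Joint continuity in x and z, read off from the permutation expansion of the determinant,
  makes the comparison uniform on a whole circle.\<close>

lemma continuous_cp: "continuous_on UNIV (\<lambda>(x, z). poly (cp x) z)"
proof -
  have "poly (cp x) z = (\<Sum>\<pi> | \<pi> permutes {0..<n}. signof \<pi> * (\<Prod>i = 0..<n. (if i = \<pi> i then z else 0) - entry (a * x) i (\<pi> i)))" for x z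
  proof -
    have c: "- char_matrix (rep (a * x)) z \<in> carrier_mat n n" by simp
    have "(- char_matrix (rep (a * x)) z) $$ (i, \<pi> i) = (if i = \<pi> i then z else 0) - entry (a * x) i (\<pi> i)"
      if "\<pi> permutes {0..<n}" "i < n" for \<pi> i
    proof -
      have "\<pi> i < n" using that permutes_in_image[OF that(1), of i] by simp
      then show ?thesis using that(2) by (auto simp: char_matrix_def rep_def)
    qed
    then show ?thesis
      unfolding char_poly_matrix[OF rep_carrier] Determinant.det_def carrier_matD[OF c]
      by (simp only: if_True refl) (intro sum.cong refl arg_cong2[of _ _ _ _ "(*)"] prod.cong, auto)
  qed
  moreover have "continuous_on UNIV (\<lambda>q :: 'a \<times> complex. \<Sum>\<pi> | \<pi> permutes {0..<n}. signof \<pi> *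
      (\<Prod>i = 0..<n. (if i = \<pi> i then snd q else 0) - entry (a * fst q) i (\<pi> i)))"
  proof (intro continuous_intros)
    fix \<pi> i assume \<pi>: "\<pi> \<in> {\<pi>. \<pi> permutes {0..<n}}" and i: "i \<in> {0..<n}"
    show "continuous_on UNIV (\<lambda>q :: 'a \<times> complex. if i = \<pi> i then snd q else 0)"
      by (cases "i = \<pi> i") (auto intro: continuous_intros)
    have "\<pi> i < n" using \<pi> i permutes_in_image[of \<pi> "{0..<n}" i] by simp
    then show "continuous_on UNIV (\<lambda>q :: 'a \<times> complex. entry (a * fst q) i (\<pi> i))"
      using i by (intro continuous_on_compose2[OF continuous_entry continuous_on_fst[OF continuous_on_id]]) auto
  qed
  ultimately show ?thesis by (simp add: case_prod_unfold)
qed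

text \<open>Rouche's theorem compares \<open>cp x\<close> with \<open>cp 1\<close> on the circle.
  For x of maximal rank every root is simple, so the weighted count is the number of spectral
  points. The disk avoids 0 because \<open>alg_spectrum (x * a)\<close> may contain 0 without its
  being a root of \<open>cp x\<close>.\<close>

lemma multiplicity_count:
  assumes \<mu>: "\<mu> \<in> nonzero_spectrum a" and r: "0 < \<rho>" "alg_spectrum a \<inter> cball \<mu> \<rho> = {\<mu>}" "0 \<notin> cball \<mu> \<rho>"
  obtains \<epsilon> where "0 < \<epsilon>"
    "\<And>x. x \<in> max_rank_set a \<inter> ball 1 \<epsilon> \<Longrightarrow>
      ecard (alg_spectrum (x * a) \<inter> ball \<mu> \<rho>) = enat (Polynomial.order \<mu> (cp 1))"
proof -
  have sp1: "nonzero_spectrum a = {z. z \<noteq> 0 \<and> poly (cp 1) z = 0}" using nonzero_spectrum_eq[of 1] by simp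
  have iso: "z = \<mu>" if "poly (cp 1) z = 0" "z \<in> cball \<mu> \<rho>" for z
  proof -
    have "z \<in> nonzero_spectrum a" unfolding sp1 using that r(3) by auto
    then show ?thesis using r(2) that(2) unfolding nonzero_spectrum_def by blast
  qed
  have roots1: "{z. poly (cp 1) z = 0 \<and> z \<in> ball \<mu> \<rho>} = {\<mu>}"
    using iso \<mu> r(1) unfolding sp1 by (auto simp: less_imp_le)
  have ns: "poly (cp 1) z \<noteq> 0" if "z \<in> sphere \<mu> \<rho>" for z
    using iso[of z] that r(1) by auto
  have "continuous_on (sphere \<mu> \<rho>) (\<lambda>z. cmod (poly (cp 1) z))" by (intro continuous_intros)
  moreover have "sphere \<mu> \<rho> \<noteq> {}" using r(1) by simp
  ultimately obtain z0 where z0: "z0 \<in> sphere \<mu> \<rho>" "\<And>z. z \<in> sphere \<mu> \<rho> \<Longrightarrow> cmod (poly (cp 1) z0) \<le> cmod (poly (cp 1) z)"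
    using continuous_attains_inf[OF compact_sphere] by metis
  \<comment> \<open>Half of the minimum on the circle turns the non-strict bound obtained from
    compactness into the strict inequality of Rouche's theorem.\<close>
  define m where "m = cmod (poly (cp 1) z0) / 2"
  have m: "0 < m" unfolding m_def using ns[OF z0(1)] by simp
  have "continuous_on (UNIV \<times> sphere \<mu> \<rho>) (\<lambda>(x, z). poly (cp x) z)"
    by (rule continuous_on_subset[OF continuous_cp]) simp
  then obtain X where X: "1 \<in> X" "open X"
    "\<forall>x\<in>X \<inter> UNIV. \<forall>z\<in>sphere \<mu> \<rho>. dist (case (x, z) of (x, z) \<Rightarrow> poly (cp x) z) (case (1, z) of (x, z) \<Rightarrow> poly (cp x) z) \<le> m"
    using continuous_on_prod_compactE[OF _ compact_sphere, of UNIV \<mu> \<rho> "\<lambda>(x, z). poly (cp x) z" 1 m] m by blast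
  then obtain \<epsilon> where \<epsilon>: "0 < \<epsilon>" "ball 1 \<epsilon> \<subseteq> X" using openE by blast
  have "ecard (alg_spectrum (x * a) \<inter> ball \<mu> \<rho>) = enat (Polynomial.order \<mu> (cp 1))"
    if x: "x \<in> max_rank_set a \<inter> ball 1 \<epsilon>" for x
  proof -
    have "cmod (poly (cp x) z - poly (cp 1) z) < cmod (poly (cp 1) z)" if z: "z \<in> sphere \<mu> \<rho>" for z
    proof -
      have "dist (poly (cp x) z) (poly (cp 1) z) \<le> m" using X(3) \<epsilon>(2) x z by auto
      also have "m < cmod (poly (cp 1) z)" using z0(2)[OF z] m unfolding m_def by linarith
      finally show ?thesis by (simp add: dist_norm)
    qed
    then have "(\<Sum>z | poly (cp x) z = 0 \<and> z \<in> ball \<mu> \<rho>. Polynomial.order z (cp x)) = Polynomial.order \<mu> (cp 1)"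
      using count_roots_near[OF r(1) char_poly_rep(1) char_poly_rep(1), of \<mu> "a * x" "a * 1"] roots1 by simp
    moreover have "(\<Sum>z | poly (cp x) z = 0 \<and> z \<in> ball \<mu> \<rho>. Polynomial.order z (cp x)) = (\<Sum>z | poly (cp x) z = 0 \<and> z \<in> ball \<mu> \<rho>. 1)"
      using max_rank_set_roots(2)[of x] x by (intro sum.cong) auto
    moreover have "alg_spectrum (x * a) \<inter> ball \<mu> \<rho> = {z. poly (cp x) z = 0 \<and> z \<in> ball \<mu> \<rho>}"
    proof -
      have "alg_spectrum (x * a) \<inter> ball \<mu> \<rho> = nonzero_spectrum (x * a) \<inter> ball \<mu> \<rho>"
        unfolding nonzero_spectrum_def using r(3) by (auto simp: less_imp_le)
      also have "\<dots> = {z. poly (cp x) z = 0 \<and> z \<in> ball \<mu> \<rho>}"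
        unfolding nonzero_spectrum_eq using r(3) by (auto simp: less_imp_le)
      finally show ?thesis .
    qed
    moreover have "finite {z. poly (cp x) z = 0 \<and> z \<in> ball \<mu> \<rho>}"
      by (rule finite_subset[OF _ finite_roots]) auto
    ultimately show ?thesis by (simp add: ecard_def)
  qed
  then show ?thesis using that \<epsilon>(1) by blast
qed

lemma finite_alg_spectrum: "finite (alg_spectrum a)"
proof -
  have "alg_spectrum a \<subseteq> insert 0 {z. poly (cp 1) z = 0}"
    using nonzero_spectrum_eq[of 1] unfolding nonzero_spectrum_def by auto
  then show ?thesis using finite_roots[of 1] finite_subset by blast
qed

lemma spectral_multiplicity_eq:
  assumes \<mu>: "\<mu> \<in> nonzero_spectrum a"
  shows "spectral_multiplicity \<mu> a = Polynomial.order \<mu> (cp 1)"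
proof -
  \<comment> \<open>0 is adjoined so that the chosen disk avoids it even when 0 is not in the
    spectrum of \<open>a\<close>.\<close>
  define S where "S = insert 0 (alg_spectrum a) - {\<mu>}"
  have "finite S" "\<mu> \<notin> S" unfolding S_def using finite_alg_spectrum by auto
  then obtain \<delta> where \<delta>: "0 < \<delta>" "\<And>z. z \<in> S \<Longrightarrow> \<delta> \<le> dist \<mu> z"
    using finite_set_avoid[of S \<mu>] by (metis)
  define \<rho> where "\<rho> = \<delta> / 2"
  have \<mu>': "\<mu> \<noteq> 0" "\<mu> \<in> alg_spectrum a" using \<mu> unfolding nonzero_spectrum_def by auto
  have \<rho>: "0 < \<rho>" "\<And>z. z \<in> S \<Longrightarrow> z \<notin> cball \<mu> \<rho>"
    unfolding \<rho>_def using \<delta> by (auto simp: not_le dest!: \<delta>(2))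
  have "z = \<mu>" if "z \<in> insert 0 (alg_spectrum a)" "z \<in> cball \<mu> \<rho>" for z
    using \<rho>(2)[of z] that unfolding S_def by blast
  then have \<rho>1: "alg_spectrum a \<inter> cball \<mu> \<rho> = {\<mu>}" "0 \<notin> cball \<mu> \<rho>"
    using \<rho>(1) \<mu>' by (auto simp del: mem_cball)
  show ?thesis
    unfolding spectral_multiplicity_def
  proof (rule the_equality)
    obtain \<epsilon> where "0 < \<epsilon>" "\<And>x. x \<in> max_rank_set a \<inter> ball 1 \<epsilon> \<Longrightarrow>
        ecard (alg_spectrum (x * a) \<inter> ball \<mu> \<rho>) = enat (Polynomial.order \<mu> (cp 1))"
      using multiplicity_count[OF \<mu> \<rho>(1) \<rho>1] by blast
    then show "\<exists>r>0. alg_spectrum a \<inter> cball \<mu> r = {\<mu>} \<and> (\<exists>\<epsilon>>0. \<forall>x\<in>max_rank_set a \<inter> ball 1 \<epsilon>.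
        ecard (alg_spectrum (x * a) \<inter> ball \<mu> r) = enat (Polynomial.order \<mu> (cp 1)))"
      using \<rho>(1) \<rho>1(1) by blast
  next
    fix m assume "\<exists>r>0. alg_spectrum a \<inter> cball \<mu> r = {\<mu>} \<and> (\<exists>\<epsilon>>0. \<forall>x\<in>max_rank_set a \<inter> ball 1 \<epsilon>.
        ecard (alg_spectrum (x * a) \<inter> ball \<mu> r) = enat m)"
    then obtain r \<epsilon> where r: "0 < r" "alg_spectrum a \<inter> cball \<mu> r = {\<mu>}" and \<epsilon>: "0 < \<epsilon>"
      "\<And>x. x \<in> max_rank_set a \<inter> ball 1 \<epsilon> \<Longrightarrow> ecard (alg_spectrum (x * a) \<inter> ball \<mu> r) = enat m" by blast
    define \<rho>' where "\<rho>' = min r \<rho>"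
    have pos: "0 < \<rho>'" "\<rho>' \<le> r" "\<rho>' \<le> \<rho>" unfolding \<rho>'_def using r(1) \<rho>(1) by simp_all
    then have "cball \<mu> \<rho>' \<subseteq> cball \<mu> \<rho>" "\<mu> \<in> cball \<mu> \<rho>'" by (simp_all add: subset_cball)
    then have \<rho>': "0 < \<rho>'" "\<rho>' \<le> r" "alg_spectrum a \<inter> cball \<mu> \<rho>' = {\<mu>}" "0 \<notin> cball \<mu> \<rho>'"
      using pos \<rho>1 \<mu>'(2) by blast+
    obtain \<epsilon>1 where \<epsilon>1: "0 < \<epsilon>1" "\<And>x. x \<in> max_rank_set a \<inter> ball 1 \<epsilon>1 \<Longrightarrow>
        ecard (alg_spectrum (x * a) \<inter> ball \<mu> \<rho>') = enat (Polynomial.order \<mu> (cp 1))"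
      using multiplicity_count[OF \<mu> \<rho>'(1,3,4)] by blast
    define K where "K = cball \<mu> r - ball \<mu> \<rho>'"
    have "compact K" unfolding K_def by (simp add: compact_diff)
    moreover have "K \<inter> alg_spectrum a = {}"
    proof (rule equals0I)
      fix z assume "z \<in> K \<inter> alg_spectrum a"
      then have "z = \<mu>" "z \<notin> ball \<mu> \<rho>'" using r(2) unfolding K_def by blast+
      then show False using \<rho>'(1) by simp
    qed
    ultimately obtain \<epsilon>2 where \<epsilon>2: "0 < \<epsilon>2" "\<And>x. x \<in> ball 1 \<epsilon>2 \<Longrightarrow> K \<inter> alg_spectrum (x * a) = {}"
      using spectrum_avoids_compact by blast
    \<comment> \<open>An x of maximal rank at which both counts are taken; if there were none near
      1, the defining condition would hold vacuously for every m.\<close>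
    obtain x where x: "x \<in> ball 1 (min \<epsilon> (min \<epsilon>1 \<epsilon>2))" "ecard (nonzero_spectrum (x * a)) = enat n"
      using dense[of "min \<epsilon> (min \<epsilon>1 \<epsilon>2)"] \<epsilon>(1) \<epsilon>1(1) \<epsilon>2(1) by auto
    then have max: "x \<in> max_rank_set a" unfolding max_rank_set_def spectral_rank_eq by simp
    have "K \<inter> alg_spectrum (x * a) = {}" using \<epsilon>2(2) x(1) by simp
    then have "alg_spectrum (x * a) \<inter> ball \<mu> r = alg_spectrum (x * a) \<inter> ball \<mu> \<rho>'"
    proof -
      have "ball \<mu> r \<subseteq> K \<union> ball \<mu> \<rho>'" "ball \<mu> \<rho>' \<subseteq> ball \<mu> r"
        unfolding K_def using \<rho>'(2) by auto
      then show ?thesis using \<open>K \<inter> alg_spectrum (x * a) = {}\<close> by blast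
    qed
    moreover have "ecard (alg_spectrum (x * a) \<inter> ball \<mu> r) = enat m" using \<epsilon>(2) x(1) max by simp
    moreover have "ecard (alg_spectrum (x * a) \<inter> ball \<mu> \<rho>') = enat (Polynomial.order \<mu> (cp 1))"
      using x(1) max by (intro \<epsilon>1(2)) simp
    ultimately show "m = Polynomial.order \<mu> (cp 1)" by (metis enat.inject)
  qed
qed

text \<open>At nonzero points multiplicity is root order, and the term of 0 vanishes, so this is the
  sum of the roots of \<open>cp 1\<close>, that is, the matrix trace.\<close>

lemma spectral_trace_eq: "spectral_trace a = (\<Sum>i<n. entry a i i)"
proof -
  have sp: "nonzero_spectrum a = {z. z \<noteq> 0 \<and> poly (cp 1) z = 0}" using nonzero_spectrum_eq[of 1] by simp
  have "spectral_trace a = (\<Sum>\<mu>\<in>nonzero_spectrum a. \<mu> * of_nat (spectral_multiplicity \<mu> a))"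
    unfolding spectral_trace_def
    using finite_alg_spectrum by (intro sum.mono_neutral_right) (auto simp: nonzero_spectrum_def)
  also have "\<dots> = (\<Sum>\<mu>\<in>nonzero_spectrum a. \<mu> * of_nat (Polynomial.order \<mu> (cp 1)))"
    by (intro sum.cong refl) (simp add: spectral_multiplicity_eq)
  also have "\<dots> = (\<Sum>z | poly (cp 1) z = 0. z * of_nat (Polynomial.order z (cp 1)))"
    unfolding sp using finite_roots[of 1] by (intro sum.mono_neutral_left) auto
  also have "\<dots> = (\<Sum>i<n. rep a $$ (i, i))"
    using sum_eigenvalues_eq_trace[OF rep_carrier[of a]] by simp
  also have "\<dots> = (\<Sum>i<n. entry a i i)" unfolding rep_def by simp
  finally show ?thesis .
qed

end

text \<open>A small matrix W makes the spectrum simple and nonzero. It lifts to w in the corner, and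
  \<open>x = 1 + b * w\<close> realises it, as \<open>a * x = a + w\<close>. With all
  \<open>r i\<close> equal, every matrix represents some element.\<close>

lemma (in matrix_frame) dense_if_equivalent:
  assumes unit_a: "frame_unit * a = a" and a_b: "a * b = frame_unit"
    and eq: "\<And>i j. i < n \<Longrightarrow> j < n \<Longrightarrow> r i = r j"
    and "0 < \<epsilon>"
  shows "\<exists>x\<in>ball 1 \<epsilon>. card {z. z \<noteq> 0 \<and> poly (char_poly (rep (a * x))) z = 0} = n"
proof -
  \<comment> \<open>Chosen so that entries below \<open>\<epsilon> / M\<close> give
    \<open>norm (b * w)\<close> at most \<open>\<epsilon> / M * (M - 1)\<close>, which is less than
    \<open>\<epsilon>\<close>.\<close>
  define M where "M = 1 + norm b * (\<Sum>i<n. \<Sum>j<n. norm (u i * v j))"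
  have M: "M > 0" unfolding M_def by (intro add_pos_nonneg mult_nonneg_nonneg sum_nonneg) auto
  obtain W where W: "W \<in> carrier_mat n n" "\<And>i j. i < n \<Longrightarrow> j < n \<Longrightarrow> cmod (W $$ (i, j)) < \<epsilon> / M"
    "card {z. z \<noteq> 0 \<and> poly (char_poly (rep a + W)) z = 0} = n"
    using simple_spectrum_perturbation[OF rep_carrier[of a], of "\<epsilon> / M"] \<open>0 < \<epsilon>\<close> M by (metis divide_pos_pos)
  define w where "w = (\<Sum>i<n. \<Sum>j<n. W $$ (i, j) *\<^sub>C (u i * v j))"
  have ent: "entry w k l = W $$ (k, l)" if kl: "k < n" "l < n" for k l
  proof -
    have "entry w k l = (\<Sum>i<n. \<Sum>j<n. W $$ (i, j) * entry (u i * v j) k l)"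
      unfolding w_def using kl by (simp add: entry_sum entry_scaleC)
    also have "\<dots> = (\<Sum>i<n. \<Sum>j<n. if i = k then if j = l then W $$ (k, l) else 0 else 0)"
    proof (intro sum.cong refl)
      fix i j assume "i \<in> {..<n}" "j \<in> {..<n}"
      then have ij: "i < n" "j < n" by simp_all
      show "W $$ (i, j) * entry (u i * v j) k l = (if i = k then if j = l then W $$ (k, l) else 0 else 0)"
        unfolding entry_matrix_unit[OF kl ij eq[OF ij]] by auto
    qed
    also have "\<dots> = (\<Sum>i<n. if i = k then W $$ (k, l) else 0)"
      using kl by (intro sum.cong refl) auto
    finally show ?thesis using kl by simp
  qed
  have uw: "frame_unit * w = w"
    unfolding w_def sum_distrib_left by (intro sum.cong refl) (simp add: mult_scaleC_right mult_eq_assoc[OF unit_u])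
  define x where "x = 1 + b * w"
  have "a * x = a + w" unfolding x_def using uw mult_eq_assoc[OF a_b, of w] by (simp add: distrib_left)
  then have "rep (a * x) = rep a + W"
    unfolding rep_def using W(1) by (intro eq_matI) (auto simp: entry_add ent)
  moreover have "x \<in> ball 1 \<epsilon>"
  proof -
    have "norm w \<le> (\<Sum>i<n. \<Sum>j<n. norm (W $$ (i, j) *\<^sub>C (u i * v j)))"
      unfolding w_def by (intro order_trans[OF norm_sum] sum_mono norm_sum)
    also have "\<dots> \<le> (\<Sum>i<n. \<Sum>j<n. \<epsilon> / M * norm (u i * v j))"
      unfolding norm_scaleC by (intro sum_mono mult_right_mono less_imp_le[OF W(2)]) auto
    also have "\<dots> = \<epsilon> / M * (\<Sum>i<n. \<Sum>j<n. norm (u i * v j))"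
      by (simp add: sum_distrib_left)
    finally have nw: "norm w \<le> \<epsilon> / M * (\<Sum>i<n. \<Sum>j<n. norm (u i * v j))" .
    have "norm (b * w) \<le> norm b * norm w" by (rule norm_mult_ineq)
    also have "\<dots> \<le> norm b * (\<epsilon> / M * (\<Sum>i<n. \<Sum>j<n. norm (u i * v j)))"
      using nw by (intro mult_left_mono) auto
    also have "\<dots> = \<epsilon> / M * (M - 1)" unfolding M_def by simp
    also have "\<dots> < \<epsilon>" using M \<open>0 < \<epsilon>\<close> by (simp add: field_simps)
    finally show ?thesis unfolding x_def by (simp add: dist_norm)
  qed
  ultimately show ?thesis using W(3) by (intro bexI[of _ x]) simp_all
qed

section \<open>Dimension, rank and commutators\<close>

lemma orthogonal_minimal_enumerate:
  assumes "orthogonal_minimal E"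
  obtains e where "bij_betw e {..<card E} E" "\<And>i. i < card E \<Longrightarrow> minimal_idempotent (e i)"
    "\<And>i j. i < card E \<Longrightarrow> j < card E \<Longrightarrow> i \<noteq> j \<Longrightarrow> e i * e j = 0"
proof -
  obtain e where e: "bij_betw e {..<card E} E"
    using ex_bij_betw_nat_finite[OF orthogonal_minimalD(1)[OF assms]] by (auto simp: atLeast0LessThan)
  then have mem: "e i \<in> E" if "i < card E" for i using that bij_betwE by fastforce
  have ne: "e i \<noteq> e j" if "i < card E" "j < card E" "i \<noteq> j" for i j
    using e that unfolding bij_betw_def inj_on_def by blast
  show ?thesis
    by (rule that[OF e]) (use orthogonal_minimalD[OF assms] mem ne in auto)
qed

lemma separated_rank_dim:
  assumes E: "orthogonal_minimal E"
    and sep: "\<And>e f x. e \<in> E \<Longrightarrow> f \<in> E \<Longrightarrow> e \<noteq> f \<Longrightarrow> e * x * f = 0"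
  shows "spectral_rank (\<Sum>E) = enat (card E)" "complex_dim (corner (\<Sum>E)) = enat (card E)"
proof -
  obtain e where e: "bij_betw e {..<card E} E" "\<And>i. i < card E \<Longrightarrow> minimal_idempotent (e i)"
    using orthogonal_minimal_enumerate[OF E] by metis
  have mem: "e i \<in> E" if "i < card E" for i using that e(1) bij_betwE by fastforce
  have inj: "e i = e j \<longleftrightarrow> i = j" if "i < card E" "j < card E" for i j
    using e(1) that unfolding bij_betw_def inj_on_def by blast
  interpret matrix_frame "card E" e e e
    by (rule matrix_frame_diagonal) (use e mem inj sep in auto)
  have "frame_unit = (\<Sum>i<card E. e i)"
    unfolding frame_unit_def using e(2) minimal_idempotentD(2) by (intro sum.cong) auto
  also have "\<dots> = \<Sum>E" using sum.reindex_bij_betw[OF e(1), of "\<lambda>x. x"] by simp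
  finally have unit: "frame_unit = \<Sum>E" .
  have "{(i, j). i < card E \<and> j < card E \<and> e i = e j} = (\<lambda>i. (i, i)) ` {..<card E}"
    using inj by auto
  then have "card {(i, j). i < card E \<and> j < card E \<and> e i = e j} = card E"
    by (simp add: card_image inj_on_def)
  then show "spectral_rank (\<Sum>E) = enat (card E)" "complex_dim (corner (\<Sum>E)) = enat (card E)"
    using spectral_rank_unit complex_dim_corner unfolding unit by simp_all
qed

definition minimal_coeff :: "'a::complex_banach_algebra_1 \<Rightarrow> 'a \<Rightarrow> complex"
  where "minimal_coeff e a = (THE c. e * a * e = c *\<^sub>C e)"

lemma minimal_coeff_eqI:
  assumes "minimal_idempotent e" "e * a * e = c *\<^sub>C e"
  shows "minimal_coeff e a = c"
  unfolding minimal_coeff_def assms(2) using minimal_idempotentD(1)[OF assms(1)]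
  by (auto simp: cvec.scale_cancel_right)

lemma minimal_coeff:
  assumes "minimal_idempotent e"
  shows "e * a * e = minimal_coeff e a *\<^sub>C e"
  using assms minimal_coeff_eqI unfolding minimal_idempotent_def by metis

text \<open>The corner is one-dimensional. This commutation is the interchange behind the cyclicity
  arguments for traces below.\<close>

lemma minimal_corner_commute:
  assumes r: "minimal_idempotent r" and s: "r * s = s" "s * r = s" and t: "r * t = t" "t * r = t"
  shows "s * t = t * s"
proof -
  obtain c d where "s = c *\<^sub>C r" "t = d *\<^sub>C r" using minimal_idempotent_corner[OF r] s t by metis
  then show ?thesis using minimal_idempotentD(2)[OF r] by (simp add: mult_scaleC_left mult_scaleC_right scaleC_scaleC mult.commute)
qed

text \<open>The commutator with a diagonal element multiplies the (e, f) entry by the difference of its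
  diagonal values, so distinct values allow every off-diagonal entry to be recovered.\<close>

lemma zero_diagonal_commutator:
  fixes a :: "'a::complex_banach_algebra_1"
  assumes F: "orthogonal_minimal F" and diag: "\<And>e. e \<in> F \<Longrightarrow> e * a * e = 0"
  shows "\<exists>\<delta>. (\<Sum>e\<in>F. \<delta> e *\<^sub>C e) * (\<Sum>e\<in>F. \<Sum>f\<in>F. inverse (\<delta> e - \<delta> f) *\<^sub>C (e * a * f))
    - (\<Sum>e\<in>F. \<Sum>f\<in>F. inverse (\<delta> e - \<delta> f) *\<^sub>C (e * a * f)) * (\<Sum>e\<in>F. \<delta> e *\<^sub>C e) = \<Sum>F * a * \<Sum>F"
proof -
  obtain k :: "'a \<Rightarrow> nat" where k: "inj_on k F"
    using finite_imp_inj_to_nat_seg[OF orthogonal_minimalD(1)[OF F]] by blast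
  define \<delta> :: "'a \<Rightarrow> complex" where "\<delta> e = of_nat (k e)" for e
  have \<delta>: "\<delta> e - \<delta> f \<noteq> 0" if "e \<in> F" "f \<in> F" "e \<noteq> f" for e f
    using k that unfolding \<delta>_def inj_on_def by auto
  define x where "x = (\<Sum>e\<in>F. \<delta> e *\<^sub>C e)"
  define b where "b = (\<Sum>e\<in>F. \<Sum>f\<in>F. inverse (\<delta> e - \<delta> f) *\<^sub>C (e * a * f))"
  have prod: "e * f = (if e = f then e else 0)" if "e \<in> F" "f \<in> F" for e f
    using orthogonal_minimalD[OF F] minimal_idempotentD(2) that by auto
  have xe: "x * e = \<delta> e *\<^sub>C e" if "e \<in> F" for e
  proof -
    have "x * e = (\<Sum>f\<in>F. if f = e then \<delta> e *\<^sub>C e else 0)"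
      unfolding x_def sum_distrib_right using that by (intro sum.cong) (auto simp: mult_scaleC_left prod)
    then show ?thesis using that orthogonal_minimalD(1)[OF F] by simp
  qed
  have ex: "e * x = \<delta> e *\<^sub>C e" if "e \<in> F" for e
  proof -
    have "e * x = (\<Sum>f\<in>F. if f = e then \<delta> e *\<^sub>C e else 0)"
      unfolding x_def sum_distrib_left using that by (intro sum.cong) (auto simp: mult_scaleC_right prod)
    then show ?thesis using that orthogonal_minimalD(1)[OF F] by simp
  qed
  have "x * b = (\<Sum>e\<in>F. \<Sum>f\<in>F. (inverse (\<delta> e - \<delta> f) * \<delta> e) *\<^sub>C (e * a * f))"
    unfolding b_def sum_distrib_left
    by (intro sum.cong refl) (simp add: mult_scaleC_right mult_scaleC_left mult.assoc[symmetric] xe scaleC_scaleC)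
  moreover have "b * x = (\<Sum>e\<in>F. \<Sum>f\<in>F. (inverse (\<delta> e - \<delta> f) * \<delta> f) *\<^sub>C (e * a * f))"
    unfolding b_def sum_distrib_right
    by (intro sum.cong refl) (simp add: mult_scaleC_right mult_scaleC_left mult.assoc ex scaleC_scaleC)
  ultimately have "x * b - b * x = (\<Sum>e\<in>F. \<Sum>f\<in>F. (inverse (\<delta> e - \<delta> f) * (\<delta> e - \<delta> f)) *\<^sub>C (e * a * f))"
    by (simp only: sum_subtractf[symmetric] cvec.scale_left_diff_distrib[symmetric] right_diff_distrib[symmetric])
  \<comment> \<open>For e = f the coefficient is 0, as \<open>inverse 0 = 0\<close>, and the term
    that it multiplies is 0 by \<open>diag\<close>.\<close>
  also have "\<dots> = (\<Sum>e\<in>F. \<Sum>f\<in>F. e * a * f)"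
    using \<delta> diag by (intro sum.cong refl) (metis cvec.scale_one cvec.scale_zero_right left_inverse)
  also have "\<dots> = \<Sum>F * a * \<Sum>F" by (simp add: sum_distrib_left sum_distrib_right) (rule sum.swap)
  finally show ?thesis unfolding x_def b_def by blast
qed

context semisimple_algebra
begin

definition linked_idempotents :: "'a \<Rightarrow> 'a \<Rightarrow> bool"
  where "linked_idempotents e f \<longleftrightarrow> (\<exists>x. e * x * f \<noteq> 0)"

lemma equivalence_family:
  fixes D :: "'a set"
  assumes min: "\<And>e. e \<in> D \<Longrightarrow> minimal_idempotent e" and r: "minimal_idempotent r"
    and link: "\<And>e. e \<in> D \<Longrightarrow> linked_idempotents e r"
  obtains u v where "\<And>e. e \<in> D \<Longrightarrow> e * u e = u e" "\<And>e. e \<in> D \<Longrightarrow> u e * r = u e"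
    "\<And>e. e \<in> D \<Longrightarrow> r * v e = v e" "\<And>e. e \<in> D \<Longrightarrow> v e * e = v e"
    "\<And>e. e \<in> D \<Longrightarrow> v e * u e = r" "\<And>e. e \<in> D \<Longrightarrow> u e * v e = e"
proof -
  have "\<forall>e\<in>D. \<exists>q. e * fst q = fst q \<and> fst q * r = fst q \<and> r * snd q = snd q \<and>
    snd q * e = snd q \<and> snd q * fst q = r \<and> fst q * snd q = e"
  proof
    fix e assume e: "e \<in> D"
    obtain x where "e * x * r \<noteq> 0" using link[OF e] unfolding linked_idempotents_def by blast
    then obtain u v where "e * u = u" "u * r = u" "r * v = v" "v * e = v" "v * u = r" "u * v = e"
      using minimal_idempotent_equivalence[OF min[OF e] r] by metis
    then show "\<exists>q. e * fst q = fst q \<and> fst q * r = fst q \<and> r * snd q = snd q \<and>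
        snd q * e = snd q \<and> snd q * fst q = r \<and> fst q * snd q = e"
      by (intro exI[of _ "(u, v)"]) simp
  qed
  from bchoice[OF this] obtain q where "\<forall>e\<in>D. e * fst (q e) = fst (q e) \<and> fst (q e) * r = fst (q e) \<and>
    r * snd (q e) = snd (q e) \<and> snd (q e) * e = snd (q e) \<and> snd (q e) * fst (q e) = r \<and> fst (q e) * snd (q e) = e" ..
  then show ?thesis by (intro that[of "\<lambda>e. fst (q e)" "\<lambda>e. snd (q e)"]) blast+
qed

lemma equivalent_frame:
  fixes E :: "'a set"
  assumes E: "orthogonal_minimal E" and f: "minimal_idempotent f"
    and link: "\<And>e. e \<in> E \<Longrightarrow> linked_idempotents e f"
  obtains e u v where "bij_betw e {..<card E} E" "\<And>i. i < card E \<Longrightarrow> minimal_idempotent (e i)"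
    "matrix_frame (card E) (\<lambda>_. f) u v" "\<And>i. i < card E \<Longrightarrow> u i * v i = e i"
proof -
  obtain e where e: "bij_betw e {..<card E} E" "\<And>i. i < card E \<Longrightarrow> minimal_idempotent (e i)"
    "\<And>i j. i < card E \<Longrightarrow> j < card E \<Longrightarrow> i \<noteq> j \<Longrightarrow> e i * e j = 0"
    using orthogonal_minimal_enumerate[OF E] by blast
  have mem: "e i \<in> E" if "i < card E" for i using that e(1) bij_betwE by fastforce
  have "\<exists>x. e i * x * f \<noteq> 0" if "i < card E" for i
    using link[OF mem[OF that]] unfolding linked_idempotents_def .
  from matrix_frame_equivalent[of "card E" e f, OF e(2,3) f this] obtain u v
    where "matrix_frame (card E) (\<lambda>_. f) u v" "\<And>i. i < card E \<Longrightarrow> u i * v i = e i" by blast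
  then show ?thesis using that e(1,2) by blast
qed

lemma equivalent_rank_dim:
  fixes E :: "'a set"
  assumes E: "orthogonal_minimal E" and f: "minimal_idempotent f"
    and link: "\<And>e. e \<in> E \<Longrightarrow> linked_idempotents e f"
  shows "spectral_rank (\<Sum>E) = enat (card E)" "complex_dim (corner (\<Sum>E)) = enat (card E) ^ 2"
proof -
  obtain e u v where e: "bij_betw e {..<card E} E" "\<And>i. i < card E \<Longrightarrow> minimal_idempotent (e i)"
    and uv: "matrix_frame (card E) (\<lambda>_. f) u v" "\<And>i. i < card E \<Longrightarrow> u i * v i = e i"
    using equivalent_frame[OF E f link] by blast
  interpret matrix_frame "card E" "\<lambda>_. f" u v by (rule uv(1))
  have "frame_unit = (\<Sum>i<card E. e i)" unfolding frame_unit_def using uv(2) by simp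
  also have "\<dots> = \<Sum>E" using sum.reindex_bij_betw[OF e(1), of "\<lambda>x. x"] by simp
  finally have unit: "frame_unit = \<Sum>E" .
  have "{(i, j). i < card E \<and> j < card E \<and> f = f} = {..<card E} \<times> {..<card E}" by auto
  then have "card {(i, j). i < card E \<and> j < card E \<and> f = f} = card E * card E"
    by (simp only: card_cartesian_product card_lessThan)
  then show "spectral_rank (\<Sum>E) = enat (card E)" "complex_dim (corner (\<Sum>E)) = enat (card E) ^ 2"
    using spectral_rank_unit complex_dim_corner unfolding unit by (simp_all add: power2_eq_square)
qed

lemma linked_sym:
  assumes e: "minimal_idempotent e" and f: "minimal_idempotent f" and "linked_idempotents e f"
  shows "linked_idempotents f e"
proof -
  obtain x where "e * x * f \<noteq> 0" using assms(3) unfolding linked_idempotents_def by blast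
  then obtain u v where uv: "f * v = v" "v * e = v" "v * u = f"
    using minimal_idempotent_equivalence[OF e f] by metis
  then have "f * v * e \<noteq> 0" using minimal_idempotentD(1)[OF f] by auto
  then show ?thesis unfolding linked_idempotents_def by blast
qed

lemma linked_refl: "minimal_idempotent e \<Longrightarrow> linked_idempotents e e"
  unfolding linked_idempotents_def using minimal_idempotentD(1,2) by (metis mult_1_right)

lemma orthogonal_minimal_pair:
  assumes "minimal_idempotent e" "minimal_idempotent f" "e * f = 0" "f * e = 0"
  shows "orthogonal_minimal {e, f}" "card {e, f} = 2" "\<Sum>{e, f} = e + f"
proof -
  have "e \<noteq> f" using assms minimal_idempotentD(1,2)[OF assms(1)] by auto
  then show "orthogonal_minimal {e, f}" "card {e, f} = 2" "\<Sum>{e, f} = e + f"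
    using assms unfolding orthogonal_minimal_def by auto
qed

lemma projection_sum: "orthogonal_minimal E \<Longrightarrow> projection (\<Sum>E)"
  unfolding projection_def by (rule orthogonal_minimal_sum_idem)

text \<open>If \<open>u = x * e - e * x * e\<close> is nonzero, a left inverse y of u produces a
  second minimal idempotent \<open>f = u * y\<close>, orthogonal and linked to e; then e + f has
  rank 2 but a corner of dimension 4.\<close>

lemma minimal_central:
  fixes e :: 'a
  assumes dim: "\<And>p::'a. projection p \<Longrightarrow> spectral_rank p < \<infinity> \<Longrightarrow> complex_dim (corner p) = spectral_rank p"
    and e: "minimal_idempotent e"
  shows "e * x = x * e"
proof -
  have left: "x * e = e * x * e" for x
  proof (rule ccontr)
    assume ne: "x * e \<noteq> e * x * e"
    define u where "u = x * e - e * x * e"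
    note ee = minimal_idempotentD(2,3)[OF e]
    have u: "u \<noteq> 0" "u * e = u" "e * u = 0"
      unfolding u_def using ne ee by (simp_all add: algebra_simps)
    obtain y0 where y0: "y0 * u = e" "e * y0 = y0" using minimal_left_inverse[OF e u(2,1)] by blast
    define y where "y = y0 * (1 - e)"
    have y: "y * u = e" "e * y = y" "y * e = 0"
      unfolding y_def using y0 u ee by (simp_all add: right_diff_distrib left_diff_distrib mult.assoc mult_eq_assoc[OF y0(2)])
    define f where "f = u * y"
    have f: "minimal_idempotent f" unfolding f_def using minimal_idempotent_transfer[OF e] y u by blast
    have ef: "e * f = 0" "f * e = 0" unfolding f_def using mult_eq_assoc[OF u(3)] y(3) by (simp_all add: mult.assoc)
    note pair = orthogonal_minimal_pair[OF e f ef]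
    have "f * u * e = u" unfolding f_def using y u by (simp add: mult.assoc mult_eq_assoc[OF u(2)])
    then have "linked_idempotents f e" unfolding linked_idempotents_def using u(1) by metis
    then have link: "linked_idempotents g e" if "g \<in> {e, f}" for g using that linked_refl[OF e] by auto
    have rd: "spectral_rank (\<Sum>{e, f}) = enat 2" "complex_dim (corner (\<Sum>{e, f})) = enat 2 ^ 2"
      using equivalent_rank_dim[OF pair(1) e link] unfolding pair(2) by blast+
    have "complex_dim (corner (\<Sum>{e, f})) = spectral_rank (\<Sum>{e, f})"
      by (rule dim[OF projection_sum[OF pair(1)]]) (unfold rd(1), simp)
    then show False unfolding rd by (simp add: power2_eq_square)
  qed
  have right: "e * x = e * x * e"
  proof (rule ccontr)
    assume ne: "e * x \<noteq> e * x * e"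
    define z where "z = e * x - e * x * e"
    have z: "z \<noteq> 0" "e * z = z" "z * e = 0"
      unfolding z_def using ne minimal_idempotentD(2,3)[OF e] by (simp_all add: algebra_simps)
    obtain y where y: "z * y = e" "y * e = y" using minimal_right_inverse[OF e z(2,1)] by blast
    \<comment> \<open>The first half, applied to the right inverse y, moves it into the corner of e,
      and \<open>z * e = 0\<close> then kills the product \<open>z * y\<close>.\<close>
    have "y = e * y * e" using left[of y] y(2) by simp
    then have "z * y = z * e * (y * e)" by (metis mult.assoc)
    then show False using z(3) y(1) minimal_idempotentD(1)[OF e] by simp
  qed
  show ?thesis using left[of x] right by simp
qed

lemma socle_central:
  assumes "\<And>p::'a. projection p \<Longrightarrow> spectral_rank p < \<infinity> \<Longrightarrow> complex_dim (corner p) = spectral_rank p"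
  shows "(socle :: 'a set) \<subseteq> alg_center"
proof
  fix x :: 'a assume "x \<in> socle"
  then show "x \<in> alg_center"
  proof (induction x rule: socle_induct)
    case (minimal e x)
    note c = minimal_central[OF assms minimal(1)]
    have "e * x = x" using c[of x] minimal(2) by simp
    then obtain d where d: "x = d *\<^sub>C e" using minimal_idempotent_corner[OF minimal(1)] minimal(2) by metis
    show ?case unfolding alg_center_def d using c by (simp add: mult_scaleC_left mult_scaleC_right)
  qed (auto simp: alg_center_def distrib_left distrib_right mult_scaleC_left mult_scaleC_right)
qed

lemma dim_eq_rank_if_central:
  assumes cent: "(socle :: 'a set) \<subseteq> alg_center" and p: "projection (p :: 'a)" "spectral_rank p < \<infinity>"
  shows "complex_dim (corner p) = spectral_rank p"
proof -
  obtain E where E: "orthogonal_minimal E" "\<Sum>E = p" using finite_rank_decomposition[OF p] by blast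
  have "e * x * f = 0" if "e \<in> E" "f \<in> E" "e \<noteq> f" for e f x
  proof -
    have "e \<in> alg_center" using cent minimal_in_socle[OF orthogonal_minimalD(2)[OF E(1) that(1)], of 1] by auto
    then have "e * x = x * e" unfolding alg_center_def by blast
    then show ?thesis using orthogonal_minimalD(3)[OF E(1) that] by (simp add: mult.assoc)
  qed
  then show ?thesis using separated_rank_dim[OF E(1)] E(2) by metis
qed

text \<open>Two unlinked minimal idempotents are orthogonal, and their sum has rank 2 and a corner
  of dimension 2 instead of 4.\<close>

lemma all_linked:
  assumes dim: "\<And>p::'a. projection p \<Longrightarrow> spectral_rank p < \<infinity> \<Longrightarrow> complex_dim (corner p) = spectral_rank p ^ 2"
    and e: "minimal_idempotent e" and f: "minimal_idempotent (f :: 'a)"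
  shows "linked_idempotents e f"
proof (rule ccontr)
  assume n: "\<not> linked_idempotents e f"
  then have z: "e * x * f = 0" "f * x * e = 0" for x
    using linked_sym[OF f e] unfolding linked_idempotents_def by blast+
  have "e * f = 0" "f * e = 0" using z[of 1] by simp_all
  note pair = orthogonal_minimal_pair[OF e f this]
  have "spectral_rank (\<Sum>{e, f}) = enat 2" "complex_dim (corner (\<Sum>{e, f})) = enat 2"
    using separated_rank_dim[OF pair(1)] z unfolding pair(2) by auto
  moreover have "complex_dim (corner (\<Sum>{e, f})) = spectral_rank (\<Sum>{e, f}) ^ 2"
    by (rule dim[OF projection_sum[OF pair(1)]]) (simp add: calculation(1))
  ultimately show False by (simp add: power2_eq_square)
qed

section \<open>The trace along a family and its independence of the family\<close>

definition diagonal_trace :: "'a set \<Rightarrow> 'a \<Rightarrow> complex"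
  where "diagonal_trace E a = (\<Sum>e\<in>E. minimal_coeff e a)"

text \<open>Linking puts all of \<open>G\<close> into a single block, where
  \<open>dense_if_equivalent\<close> supplies the density that \<open>regular_frame\<close> asks
  for.\<close>

lemma spectral_trace_eq_diagonal_trace:
  assumes G: "orthogonal_minimal G" and f: "minimal_idempotent f"
    and link: "\<And>e. e \<in> G \<Longrightarrow> linked_idempotents e f"
    and a: "\<Sum>G * a = a" "a * b = \<Sum>G"
  shows "spectral_trace a = diagonal_trace G a"
proof -
  obtain e u v where e: "bij_betw e {..<card G} G" "\<And>i. i < card G \<Longrightarrow> minimal_idempotent (e i)"
    and uv: "matrix_frame (card G) (\<lambda>_. f) u v" "\<And>i. i < card G \<Longrightarrow> u i * v i = e i"
    using equivalent_frame[OF G f link] by blast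
  interpret F: matrix_frame "card G" "\<lambda>_. f" u v by (rule uv(1))
  have "F.frame_unit = (\<Sum>i<card G. e i)" unfolding F.frame_unit_def using uv(2) by simp
  also have "\<dots> = \<Sum>G" using sum.reindex_bij_betw[OF e(1), of "\<lambda>x. x"] by simp
  finally have unit: "F.frame_unit = \<Sum>G" .
  have ua: "F.frame_unit * a = a" "a * b = F.frame_unit" unfolding unit using a by simp_all
  interpret F: regular_frame "card G" "\<lambda>_. f" u v a b
  proof
    fix \<epsilon> :: real assume "0 < \<epsilon>"
    then obtain x where x: "x \<in> ball 1 \<epsilon>" "card {z. z \<noteq> 0 \<and> poly (char_poly (F.rep (a * x))) z = 0} = card G"
      using F.dense_if_equivalent[OF ua] by metis
    have "finite {z. z \<noteq> 0 \<and> poly (char_poly (F.rep (a * x))) z = 0}"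
      using poly_roots_finite[OF F.char_poly_rep(1)[of "a * x"]] by (rule finite_subset[rotated]) auto
    then have "ecard (nonzero_spectrum (x * a)) = enat (card G)"
      unfolding F.nonzero_spectrum_mult_left[OF ua(1)] ecard_def using x(2) by simp
    then show "\<exists>x\<in>ball 1 \<epsilon>. ecard (nonzero_spectrum (x * a)) = enat (card G)" using x(1) by blast
  qed (use ua in auto)
  have "spectral_trace a = (\<Sum>i<card G. F.entry a i i)" by (rule F.spectral_trace_eq)
  also have "\<dots> = (\<Sum>i<card G. minimal_coeff (e i) a)"
    using F.diagonal_entry uv(2) by (intro sum.cong refl minimal_coeff_eqI[symmetric] e(2)) auto
  also have "\<dots> = diagonal_trace G a"
    unfolding diagonal_trace_def by (rule sum.reindex_bij_betw[OF e(1)])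
  finally show ?thesis .
qed

text \<open>Basis independence of the trace: all coefficients are transported to the corner of one
  r, each diagonal coefficient of E is expanded through F, the factors commute in that corner, and
  the double sum is collapsed over E.\<close>

lemma diagonal_trace_cong_unit:
  assumes E: "orthogonal_minimal E" and F: "orthogonal_minimal F" and unit: "\<Sum>E = \<Sum>F"
    and r: "minimal_idempotent r" and link: "\<And>e. e \<in> E \<union> F \<Longrightarrow> linked_idempotents e r"
  shows "diagonal_trace E a = diagonal_trace F a"
proof -
  have "minimal_idempotent e" if "e \<in> E \<union> F" for e
    using that E F orthogonal_minimalD(2) by blast
  from equivalence_family[OF this r link] obtain u v where uv:
    "\<And>e. e \<in> E \<union> F \<Longrightarrow> e * u e = u e" "\<And>e. e \<in> E \<union> F \<Longrightarrow> u e * r = u e"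
    "\<And>e. e \<in> E \<union> F \<Longrightarrow> r * v e = v e" "\<And>e. e \<in> E \<union> F \<Longrightarrow> v e * e = v e"
    "\<And>e. e \<in> E \<union> F \<Longrightarrow> v e * u e = r" "\<And>e. e \<in> E \<union> F \<Longrightarrow> u e * v e = e" by blast
  have tr: "diagonal_trace D a *\<^sub>C r = (\<Sum>e\<in>D. v e * a * u e)"
    if D: "orthogonal_minimal D" "D \<subseteq> E \<union> F" for D
  proof -
    have "minimal_coeff e a *\<^sub>C r = v e * a * u e" if e: "e \<in> D" for e
    proof -
      have e': "e \<in> E \<union> F" using D(2) e by blast
      have "v e * (e * a * e) * u e = minimal_coeff e a *\<^sub>C r"
        unfolding minimal_coeff[OF orthogonal_minimalD(2)[OF D(1) e]]
        using uv(4,5)[OF e'] by (simp add: mult_scaleC_left mult_scaleC_right)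
      moreover have "v e * (e * a * e) * u e = (v e * e) * a * (e * u e)" by (simp only: mult.assoc)
      ultimately show ?thesis using uv(1,4)[OF e'] by simp
    qed
    then show ?thesis unfolding diagonal_trace_def cvec.scale_sum_left by (intro sum.cong) auto
  qed
  have expand: "v d * a * u d = (\<Sum>e\<in>D. (v d * a * u e) * (v e * u d))"
    if D: "orthogonal_minimal D" "D \<subseteq> E \<union> F" "\<Sum>D = \<Sum>E" and d: "d \<in> E \<union> F" for D d
  proof -
    have "\<Sum>E * d = d"
      using d orthogonal_minimal_sum(2)[OF E] orthogonal_minimal_sum(2)[OF F] unit by auto
    then have ud: "\<Sum>D * u d = u d" using uv(1)[OF d] D(3) by (metis mult.assoc)
    have "v d * a * u d = v d * a * (\<Sum>D * u d)" unfolding ud ..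
    also have "\<dots> = (\<Sum>e\<in>D. v d * a * (e * u d))" by (simp add: sum_distrib_left sum_distrib_right)
    also have "\<dots> = (\<Sum>e\<in>D. (v d * a * u e) * (v e * u d))"
    proof (rule sum.cong[OF refl])
      fix e assume "e \<in> D"
      then have "e = u e * v e" using uv(6) D(2) by auto
      then show "v d * a * (e * u d) = (v d * a * u e) * (v e * u d)" by (metis mult.assoc)
    qed
    finally show ?thesis .
  qed
  have comm: "(v d * a * u e) * (v e * u d) = (v e * u d) * (v d * a * u e)" if "d \<in> E \<union> F" "e \<in> E \<union> F" for d e
    using that uv(2,3) by (intro minimal_corner_commute[OF r]) (simp_all add: mult.assoc mult_eq_assoc[OF uv(3)])
  have "diagonal_trace E a *\<^sub>C r = (\<Sum>d\<in>E. \<Sum>e\<in>F. (v d * a * u e) * (v e * u d))"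
    unfolding tr[OF E Un_upper1] by (rule sum.cong[OF refl], rule expand[OF F Un_upper2 unit[symmetric]]) simp
  also have "\<dots> = (\<Sum>d\<in>E. \<Sum>e\<in>F. (v e * u d) * (v d * a * u e))"
    by (intro sum.cong refl comm) auto
  also have "\<dots> = (\<Sum>e\<in>F. \<Sum>d\<in>E. (v e * u d) * (v d * a * u e))" by (rule sum.swap)
  also have "\<dots> = (\<Sum>e\<in>F. v e * a * u e)"
  proof (rule sum.cong[OF refl])
    fix e assume e: "e \<in> F"
    have ve: "v e * \<Sum>E = v e" using uv(4)[of e] orthogonal_minimal_sum(1)[OF F e] e unit by (metis UnI2 mult.assoc)
    have "(\<Sum>d\<in>E. (v e * u d) * (v d * a * u e)) = (\<Sum>d\<in>E. v e * d * (a * u e))"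
    proof (rule sum.cong[OF refl])
      fix d assume "d \<in> E"
      then have "u d * v d = d" using uv(6) by auto
      then show "(v e * u d) * (v d * a * u e) = v e * d * (a * u e)" by (metis mult.assoc)
    qed
    also have "\<dots> = v e * \<Sum>E * (a * u e)" by (simp add: sum_distrib_left sum_distrib_right)
    finally show "(\<Sum>d\<in>E. (v e * u d) * (v d * a * u e)) = v e * a * u e" unfolding ve by (simp add: mult.assoc)
  qed
  also have "\<dots> = diagonal_trace F a *\<^sub>C r" using tr[OF F] by simp
  finally show ?thesis using minimal_idempotentD(1)[OF r] by simp
qed

text \<open>If every vector w in p A r were an eigenvector of p a, then p a p would be a scalar multiple of p,
  and trace zero would force the scalar to be 0. For any other w a functional v with v w = r and
  v a w = 0 exists, and e = w v has the required zero entry.\<close>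

lemma zero_diagonal_step:
  fixes a :: 'a
  assumes E: "orthogonal_minimal E" and r: "r \<in> E"
    and link: "\<And>e. e \<in> E \<Longrightarrow> linked_idempotents e r"
    and tr: "diagonal_trace E a = 0" and nz: "\<exists>e\<in>E. e * a * e \<noteq> 0"
  obtains e where "minimal_idempotent e" "\<Sum>E * e = e" "e * \<Sum>E = e" "e * a * e = 0"
proof -
  define p where "p = \<Sum>E"
  have rm: "minimal_idempotent r" using r orthogonal_minimalD(2)[OF E] by blast
  have pp: "p * p = p" unfolding p_def by (rule orthogonal_minimal_sum_idem[OF E])
  have pe: "p * e = e" "e * p = e" if "e \<in> E" for e
    using orthogonal_minimal_sum[OF E that] unfolding p_def by auto
  have "\<exists>w. p * w = w \<and> w * r = w \<and> (\<forall>c. p * a * w \<noteq> c *\<^sub>C w)"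
  proof (rule ccontr)
    assume "\<not> ?thesis"
    then have scal: "\<exists>c. p * a * w = c *\<^sub>C w" if "p * w = w" "w * r = w" for w using that by blast
    have "minimal_idempotent e" if "e \<in> E" for e using orthogonal_minimalD(2)[OF E that] .
    from equivalence_family[OF this rm link] obtain u v where uv:
      "\<And>e. e \<in> E \<Longrightarrow> e * u e = u e" "\<And>e. e \<in> E \<Longrightarrow> u e * r = u e"
      "\<And>e. e \<in> E \<Longrightarrow> r * v e = v e" "\<And>e. e \<in> E \<Longrightarrow> v e * e = v e"
      "\<And>e. e \<in> E \<Longrightarrow> v e * u e = r" "\<And>e. e \<in> E \<Longrightarrow> u e * v e = e" by blast
    have pu: "p * u e = u e" if "e \<in> E" for e using mult_eq_assoc[OF pe(1)[OF that], of "u e"] uv(1)[OF that] by simp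
    have "\<forall>e\<in>E. \<exists>c. p * a * u e = c *\<^sub>C u e" using scal pu uv(2) by blast
    then obtain c where c: "\<And>e. e \<in> E \<Longrightarrow> p * a * u e = c e *\<^sub>C u e" by metis
    have vu: "v e * u f = 0" if "e \<in> E" "f \<in> E" "e \<noteq> f" for e f
    proof -
      have "v e * u f = (v e * e) * (f * u f)" using uv(1)[OF that(2)] uv(4)[OF that(1)] by simp
      also have "\<dots> = v e * (e * f) * u f" by (simp only: mult.assoc)
      finally show ?thesis using orthogonal_minimalD(3)[OF E that] by simp
    qed
    have const: "c e = c r" if e: "e \<in> E" for e
    proof (cases "e = r")
      case False
      \<comment> \<open>The sum of two eigenvectors is again an eigenvector; applying
        \<open>v e\<close> and \<open>v r\<close> shows that both eigenvalues equal
        \<open>d\<close>.\<close>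
      obtain d where d: "p * a * (u e + u r) = d *\<^sub>C (u e + u r)"
        using scal[of "u e + u r"] pu[OF e] pu[OF r] uv(2)[OF e] uv(2)[OF r] by (auto simp: distrib_left distrib_right)
      then have eq: "c e *\<^sub>C u e + c r *\<^sub>C u r = d *\<^sub>C u e + d *\<^sub>C u r"
        using c[OF e] c[OF r] by (simp add: distrib_left scaleC_add_right)
      have "v e * (c e *\<^sub>C u e + c r *\<^sub>C u r) = c e *\<^sub>C r" "v e * (d *\<^sub>C u e + d *\<^sub>C u r) = d *\<^sub>C r"
        using vu[OF e r False] uv(5)[OF e] by (simp_all add: distrib_left mult_scaleC_right)
      then have 1: "c e = d" using eq minimal_idempotentD(1)[OF rm] by simp
      have "v r * (c e *\<^sub>C u e + c r *\<^sub>C u r) = c r *\<^sub>C r" "v r * (d *\<^sub>C u e + d *\<^sub>C u r) = d *\<^sub>C r"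
        using vu[OF r e] False uv(5)[OF r] by (simp_all add: distrib_left mult_scaleC_right)
      then have "c r = d" using eq minimal_idempotentD(1)[OF rm] by simp
      then show ?thesis using 1 by simp
    qed simp
    have eae: "e * a * e = c r *\<^sub>C e" if e: "e \<in> E" for e
    proof -
      have "e * a * e = e * (p * a * u e) * v e"
        using mult_eq_assoc[OF pe(2)[OF e]] uv(6)[OF e] by (simp add: mult.assoc)
      then show ?thesis unfolding c[OF e] const[OF e] using uv(1,6)[OF e]
        by (simp add: mult_scaleC_left mult_scaleC_right mult.assoc)
    qed
    have "diagonal_trace E a = (\<Sum>e\<in>E. c r)"
      unfolding diagonal_trace_def using eae orthogonal_minimalD(2)[OF E]
      by (intro sum.cong refl minimal_coeff_eqI) auto
    then have "of_nat (card E) * c r = 0" using tr by simp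
    then have "c r = 0" using r orthogonal_minimalD(1)[OF E] by auto
    then show False using eae nz by simp
  qed
  then obtain w where w: "p * w = w" "w * r = w" and ind: "\<And>c. p * a * w \<noteq> c *\<^sub>C w" by blast
  have "w \<noteq> 0" using ind[of 0] by auto
  define y where "y = p * a * w"
  have y: "p * y = y" "y * r = y" unfolding y_def using w(2) by (simp_all add: mult.assoc mult_eq_assoc[OF pp])
  have inv: "\<exists>v. v * z = r \<and> r * v = v \<and> v * p = v" if z: "p * z = z" "z * r = z" "z \<noteq> 0" for z
  proof -
    obtain v where "v * z = r" "r * v = v" using minimal_left_inverse[OF rm z(2,3)] by blast
    then show ?thesis using z pp
      by (intro exI[of _ "v * p"]) (simp add: mult.assoc mult_eq_assoc)
  qed
  obtain v1 where v1: "v1 * w = r" "r * v1 = v1" "v1 * p = v1" using inv[OF w \<open>w \<noteq> 0\<close>] by blast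
  have "r * (v1 * y) = v1 * y" "v1 * y * r = v1 * y" using y(2) by (simp_all add: mult_eq_assoc[OF v1(2)] mult.assoc)
  then obtain c where c: "v1 * y = c *\<^sub>C r" using minimal_idempotent_corner[OF rm] by blast
  \<comment> \<open>The pair \<open>v1\<close>, \<open>v3\<close> becomes dual to the pair
    \<open>w\<close>, \<open>y'\<close>: subtracting \<open>c *\<^sub>C w\<close> puts y' into the
    kernel of \<open>v1\<close>, and the correction in \<open>v3\<close> kills w. Then
    \<open>v1 - c *\<^sub>C v3\<close> takes w to r and y to 0.\<close>
  define y' where "y' = y - c *\<^sub>C w"
  have y': "p * y' = y'" "y' * r = y'" "y' \<noteq> 0"
    unfolding y'_def using y w ind[of c] by (auto simp: right_diff_distrib left_diff_distrib mult_scaleC_left mult_scaleC_right y_def)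
  have v1y': "v1 * y' = 0" unfolding y'_def by (simp add: right_diff_distrib mult_scaleC_right c v1)
  obtain v2 where v2: "v2 * y' = r" "r * v2 = v2" "v2 * p = v2" using inv[OF y'] by blast
  have "r * (v2 * w) = v2 * w" "v2 * w * r = v2 * w" using w(2) by (simp_all add: mult_eq_assoc[OF v2(2)] mult.assoc)
  then obtain d where d: "v2 * w = d *\<^sub>C r" using minimal_idempotent_corner[OF rm] by blast
  define v3 where "v3 = v2 - d *\<^sub>C v1"
  have v3: "v3 * w = 0" "v3 * y' = r" "r * v3 = v3" "v3 * p = v3"
    unfolding v3_def using v1 v2 v1y' d
    by (simp_all add: right_diff_distrib left_diff_distrib mult_scaleC_left mult_scaleC_right)
  have "y = y' + c *\<^sub>C w" unfolding y'_def by simp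
  then have v3y: "v3 * y = r" using v3 by (simp add: distrib_left mult_scaleC_right)
  define v where "v = v1 - c *\<^sub>C v3"
  have v: "v * w = r" "r * v = v" "v * p = v" "v * y = 0"
    unfolding v_def using v1 v3 v3y c
    by (simp_all add: right_diff_distrib left_diff_distrib mult_scaleC_left mult_scaleC_right)
  show ?thesis
  proof (rule that[of "w * v"])
    show "minimal_idempotent (w * v)" by (rule minimal_idempotent_transfer[OF rm v(1) w(2) v(2)])
    show "\<Sum>E * (w * v) = w * v" using mult_eq_assoc[OF w(1)] unfolding p_def by simp
    show "w * v * \<Sum>E = w * v" using v(3) unfolding p_def by (simp add: mult.assoc)
    have "w * v * a * (w * v) = w * (v * p) * a * w * v" unfolding v(3) by (simp only: mult.assoc)
    also have "\<dots> = w * (v * y) * v" unfolding y_def by (simp only: mult.assoc)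
    finally show "w * v * a * (w * v) = 0" unfolding v(4) by simp
  qed
qed

text \<open>Split off one minimal idempotent e with \<open>e * a * e = 0\<close> and decompose the
  rest of the sum. The remaining family has trace 0 because the trace depends only on the sum, and
  one member less because the size is the rank of the sum.\<close>

lemma zero_diagonal:
  fixes a :: 'a
  assumes linked: "\<And>e f :: 'a. minimal_idempotent e \<Longrightarrow> minimal_idempotent f \<Longrightarrow> linked_idempotents e f"
    and "orthogonal_minimal E" "diagonal_trace E a = 0"
  shows "\<exists>F. orthogonal_minimal F \<and> \<Sum>F = \<Sum>E \<and> (\<forall>e\<in>F. e * a * e = 0)"
  using assms(2,3)
proof (induction "card E" arbitrary: E)
  case 0
  then have "E = {}" using orthogonal_minimalD(1) by fastforce
  then show ?case by (intro exI[of _ "{}"]) simp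
next
  case (Suc m)
  note E = Suc.prems(1)
  show ?case
  proof (cases "\<forall>e\<in>E. e * a * e = 0")
    case True
    then show ?thesis using E by blast
  next
    case False
    obtain r where r: "r \<in> E" using Suc.hyps(2) by (metis card.empty equals0I nat.distinct(1))
    then have rm: "minimal_idempotent r" using orthogonal_minimalD(2)[OF E] by blast
    have link: "linked_idempotents e r" if "e \<in> E" for e
      using linked[OF orthogonal_minimalD(2)[OF E that] rm] .
    obtain e where e: "minimal_idempotent e" "\<Sum>E * e = e" "e * \<Sum>E = e" "e * a * e = 0"
      using zero_diagonal_step[OF E r link Suc.prems(2)] False by blast
    define p where "p = \<Sum>E"
    have pp: "p * p = p" unfolding p_def by (rule orthogonal_minimal_sum_idem[OF E])
    note ee = minimal_idempotentD(1,2)[OF e(1)]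
    define h where "h = p - e"
    have h: "h * h = h" "p * h = h" "h * p = h" "h \<noteq> p" "e * h = 0" "h * e = 0" "e + h = p"
      unfolding h_def using pp ee e(2,3) by (simp_all add: p_def[symmetric] right_diff_distrib left_diff_distrib)
    have "ecard (nonzero_spectrum (x * p)) \<le> enat (Suc m)" for x
      using SUP_upper[of x UNIV "\<lambda>x. ecard (nonzero_spectrum (x * p))"] equivalent_rank_dim(1)[OF E rm link]
      unfolding spectral_rank_def p_def Suc.hyps(2)[symmetric] by simp
    then have bound: "finite (nonzero_spectrum (x * p)) \<and> card (nonzero_spectrum (x * p)) \<le> Suc m" for x
      unfolding ecard_def by (metis enat_ord_simps(1) enat_ord_code(5) infinity_ileE)
    obtain E' where E': "orthogonal_minimal E'" "\<Sum>E' = h"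
      using idempotent_decomposition[OF spectrum_bound_split[OF bound h(1-4) pp] h(1)] by blast
    have "e * \<Sum>E' = 0" "\<Sum>E' * e = 0" unfolding E'(2) using h by simp_all
    note ins = orthogonal_minimal_insert[OF E'(1) e(1) this]
    have sum: "\<Sum>(insert e E') = \<Sum>E" unfolding ins(3) E'(2) h(7) p_def ..
    have link': "linked_idempotents f r" if "f \<in> insert e E'" for f
      using linked[OF orthogonal_minimalD(2)[OF ins(1) that] rm] .
    have "diagonal_trace (insert e E') a = diagonal_trace E a"
      by (rule diagonal_trace_cong_unit[OF ins(1) E sum rm]) (use link link' in blast)
    moreover have "minimal_coeff e a = 0" by (rule minimal_coeff_eqI[OF e(1)]) (simp add: e(4))
    ultimately have tr: "diagonal_trace E' a = 0"
      using Suc.prems(2) ins(2) orthogonal_minimalD(1)[OF E'(1)] unfolding diagonal_trace_def by simp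
    have "enat (card (insert e E')) = enat (card E)"
      using equivalent_rank_dim(1)[OF ins(1) rm link'] equivalent_rank_dim(1)[OF E rm link] sum by simp
    then have "m = card E'" using Suc.hyps(2) ins(2) orthogonal_minimalD(1)[OF E'(1)] by simp
    then obtain F where F: "orthogonal_minimal F" "\<Sum>F = \<Sum>E'" "\<forall>e\<in>F. e * a * e = 0"
      using Suc.hyps(1)[OF _ E'(1) tr] by blast
    have "e * \<Sum>F = 0" "\<Sum>F * e = 0" unfolding F(2) E'(2) using h by simp_all
    note insF = orthogonal_minimal_insert[OF F(1) e(1) this]
    have "\<Sum>(insert e F) = \<Sum>E" unfolding insF(3) F(2) E'(2) h(7) p_def ..
    then show ?thesis using insF(1) F(3) e(4) by blast
  qed
qed

text \<open>\<open>G\<close> carries the spectral trace, while the larger \<open>E\<close> has a sum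
  that is a unit for \<open>a\<close> on both sides. The additional members e of \<open>E\<close>
  satisfy \<open>e * a = 0\<close>, so both families give the same trace.\<close>

lemma trace_zero_commutator:
  fixes a :: 'a
  assumes linked: "\<And>e f :: 'a. minimal_idempotent e \<Longrightarrow> minimal_idempotent f \<Longrightarrow> linked_idempotents e f"
    and a: "a \<in> socle" and tr: "spectral_trace a = 0"
  shows "\<exists>x\<in>socle. \<exists>y\<in>socle. a = x * y - y * x"
proof -
  obtain G c where G: "orthogonal_minimal G" "\<Sum>G * a = a" "\<Sum>G = a * c" using socle_regular[OF a] by blast
  obtain E where E: "orthogonal_minimal E" "G \<subseteq> E" "\<Sum>E * a = a" "a * \<Sum>E = a"
    using socle_local_unit[OF a G(1)] by blast
  have trG: "diagonal_trace G a = 0"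
  proof (cases "G = {}")
    case False
    then obtain f where f: "f \<in> G" by blast
    then have fm: "minimal_idempotent f" using orthogonal_minimalD(2)[OF G(1)] by blast
    have "spectral_trace a = diagonal_trace G a"
      using linked orthogonal_minimalD(2)[OF G(1)] fm G by (intro spectral_trace_eq_diagonal_trace[OF G(1) fm]) auto
    then show ?thesis using tr by simp
  qed (simp add: diagonal_trace_def)
  have "minimal_coeff e a = 0" if e: "e \<in> E - G" for e
  proof (rule minimal_coeff_eqI)
    show "minimal_idempotent e" using e orthogonal_minimalD(2)[OF E(1)] by blast
    have "e * \<Sum>G = (\<Sum>g\<in>G. e * g)" by (rule sum_distrib_left)
    also have "\<dots> = 0" using e E(2) orthogonal_minimalD(3)[OF E(1)] by (intro sum.neutral) blast
    finally have "e * a = 0" using G(2) by (metis mult.assoc mult_zero_left)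
    then show "e * a * e = 0 *\<^sub>C e" by simp
  qed
  then have "diagonal_trace E a = diagonal_trace G a"
    unfolding diagonal_trace_def using orthogonal_minimalD(1)[OF E(1)] E(2) by (intro sum.mono_neutral_right) auto
  then obtain F where F: "orthogonal_minimal F" "\<Sum>F = \<Sum>E" "\<forall>e\<in>F. e * a * e = 0"
    using zero_diagonal[OF linked E(1)] trG by metis
  have "e * a * e = 0" if "e \<in> F" for e using F(3) that by blast
  from zero_diagonal_commutator[OF F(1) this] obtain \<delta> where \<delta>:
    "(\<Sum>e\<in>F. \<delta> e *\<^sub>C e) * (\<Sum>e\<in>F. \<Sum>f\<in>F. inverse (\<delta> e - \<delta> f) *\<^sub>C (e * a * f))
    - (\<Sum>e\<in>F. \<Sum>f\<in>F. inverse (\<delta> e - \<delta> f) *\<^sub>C (e * a * f)) * (\<Sum>e\<in>F. \<delta> e *\<^sub>C e) = \<Sum>F * a * \<Sum>F" ..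
  define x where "x = (\<Sum>e\<in>F. \<delta> e *\<^sub>C e)"
  define b where "b = (\<Sum>e\<in>F. \<Sum>f\<in>F. inverse (\<delta> e - \<delta> f) *\<^sub>C (e * a * f))"
  have xb: "x * b - b * x = \<Sum>F * a * \<Sum>F" unfolding x_def b_def by (rule \<delta>)
  have "c * e \<in> socle" if "e \<in> F" for c e using minimal_in_socle orthogonal_minimalD(2)[OF F(1) that] by blast
  note ce = this
  have "x \<in> socle" "b \<in> socle"
    unfolding x_def b_def using ce ce[of _ 1]
    by (auto intro!: cvec.subspace_sum[OF subspace_socle] cvec.subspace_scale[OF subspace_socle])
  moreover have "a = x * b - b * x" unfolding xb F(2) using E(3,4) by simp
  ultimately show ?thesis by blast
qed

text \<open>\<open>e - f\<close> is its own inverse in the corner of \<open>e + f\<close>, and its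
  spectral values 1 and -1 already exhaust the size 2 of the frame. So x = 1 has maximal rank and
  witnesses density at every radius.\<close>

lemma spectral_trace_difference:
  fixes e f :: 'a
  assumes e: "minimal_idempotent e" and f: "minimal_idempotent f"
    and z: "\<And>x. e * x * f = 0" "\<And>x. f * x * e = 0"
  shows "spectral_trace (e - f) = 0"
proof -
  have ef: "e * f = 0" "f * e = 0" using z[of 1] by simp_all
  note ee = minimal_idempotentD(2)[OF e] and ff = minimal_idempotentD(2)[OF f]
  define g where "g i = (if i = 0 then e else f)" for i :: nat
  interpret F: matrix_frame 2 g g g
    by (rule matrix_frame_diagonal) (use e f z in \<open>auto simp: g_def split: if_splits\<close>)
  have unit: "F.frame_unit = e + f" unfolding F.frame_unit_def g_def by (simp add: numeral_2_eq_2 ee ff)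
  define a where "a = e - f"
  have ua: "F.frame_unit * a = a" "a * F.frame_unit = a" "a * a = F.frame_unit"
    unfolding a_def unit using ef ee ff by (simp_all add: algebra_simps)
  have "1 \<in> nonzero_spectrum a"
    by (rule eigenvalue_in_nonzero_spectrum[of a e]) (use ef ee e minimal_idempotentD(1) in \<open>auto simp: a_def left_diff_distrib\<close>)
  moreover have "- 1 \<in> nonzero_spectrum a"
    by (rule eigenvalue_in_nonzero_spectrum[of a f]) (use ef ff f minimal_idempotentD(1) in \<open>auto simp: a_def left_diff_distrib\<close>)
  ultimately have "{1, - 1} \<subseteq> nonzero_spectrum a" by blast
  then have "card {1, - 1 :: complex} \<le> card (nonzero_spectrum a)"
    using F.nonzero_spectrum_bound(1)[OF ua(1,2)] by (intro card_mono)
  then have "card (nonzero_spectrum a) = 2" using F.nonzero_spectrum_bound(2)[OF ua(1,2)] by simp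
  then have "ecard (nonzero_spectrum (1 * a)) = enat 2"
    using F.nonzero_spectrum_bound(1)[OF ua(1,2)] by (simp add: ecard_def)
  then interpret F: regular_frame 2 g g g a a
    by unfold_locales (use ua in \<open>auto intro!: bexI[of _ 1]\<close>)
  have "F.entry a 0 0 = 1" "F.entry a 1 1 = - 1"
    by (rule F.entry_eqI, simp, simp add: g_def a_def ef ee ff algebra_simps)+
  then have "spectral_trace a = 0" unfolding F.spectral_trace_eq by (simp add: numeral_2_eq_2)
  then show ?thesis unfolding a_def .
qed

text \<open>By cyclicity a commutator from the socle has trace 0 on A e. If e and f are unlinked, f
  annihilates A e and has trace 0 there, while e has nonzero trace, so e - f cannot be such a
  commutator.\<close>

lemma linked_if_commutators:
  fixes e f :: 'a
  assumes comm: "\<And>a::'a. a \<in> socle \<Longrightarrow> spectral_trace a = 0 \<Longrightarrow> \<exists>x\<in>socle. \<exists>y\<in>socle. a = x * y - y * x"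
    and e: "minimal_idempotent e" and f: "minimal_idempotent f"
  shows "linked_idempotents e f"
proof (rule ccontr)
  assume "\<not> linked_idempotents e f"
  then have z: "e * x * f = 0" "f * x * e = 0" for x
    using linked_sym[OF f e] unfolding linked_idempotents_def by blast+
  have es: "e \<in> socle" and fs: "f \<in> socle" using minimal_in_socle[of _ 1] e f by simp_all
  then have "e - f \<in> socle" using cvec.subspace_diff[OF subspace_socle] by blast
  then obtain x y where xy: "x \<in> socle" "y \<in> socle" "e - f = x * y - y * x"
    using comm spectral_trace_difference[OF e f z] by blast
  obtain Q1 where Q1: "orthogonal_minimal Q1" "\<Sum>Q1 * x = x"
    using socle_local_unit[OF xy(1) orthogonal_minimal_empty] by blast
  obtain Q2 where Q2: "orthogonal_minimal Q2" "Q1 \<subseteq> Q2" "\<Sum>Q2 * y = y"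
    using socle_local_unit[OF xy(2) Q1(1)] by blast
  \<comment> \<open>The family also has to fix e, because at the end e itself is resolved along
    it.\<close>
  obtain Q where Q: "orthogonal_minimal Q" "Q2 \<subseteq> Q" "\<Sum>Q * e = e"
    using socle_local_unit[OF es Q2(1)] by blast
  have Qx: "\<Sum>Q * x = x" "\<Sum>Q * y = y"
    using mult_eq_assoc[OF orthogonal_minimal_sum_subset(2)[OF Q(1)], of Q1 x]
      mult_eq_assoc[OF orthogonal_minimal_sum_subset(2)[OF Q(1)], of Q2 y] Q1 Q2 Q by auto
  \<comment> \<open>Members outside \<open>J\<close> annihilate A e, so on A e the sum over
    \<open>J\<close> acts like the sum over \<open>Q\<close>.\<close>
  define J where "J = {g \<in> Q. linked_idempotents g e}"
  have JQ: "J \<subseteq> Q" and unlinked: "\<And>g x. g \<in> Q - J \<Longrightarrow> g * x * e = 0"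
    unfolding J_def linked_idempotents_def by auto
  have "minimal_idempotent g" "linked_idempotents g e" if "g \<in> J" for g
    using that JQ orthogonal_minimalD(2)[OF Q(1)] unfolding J_def by blast+
  from equivalence_family[OF this(1) e this(2)] obtain u v where uv:
    "\<And>g. g \<in> J \<Longrightarrow> g * u g = u g" "\<And>g. g \<in> J \<Longrightarrow> u g * e = u g"
    "\<And>g. g \<in> J \<Longrightarrow> e * v g = v g" "\<And>g. g \<in> J \<Longrightarrow> v g * g = v g"
    "\<And>g. g \<in> J \<Longrightarrow> v g * u g = e" "\<And>g. g \<in> J \<Longrightarrow> u g * v g = g" by blast
  \<comment> \<open>The sum over g of v g * s * u g is the trace of s on the module A e.\<close>
  have resolve: "z * e = z \<Longrightarrow> \<Sum>Q * z = z \<Longrightarrow> z = (\<Sum>g\<in>J. u g * (v g * z))" for z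
  proof -
    assume z: "z * e = z" "\<Sum>Q * z = z"
    have "z = (\<Sum>g\<in>Q. g * z)" using z(2) by (simp add: sum_distrib_right)
    also have "\<dots> = (\<Sum>g\<in>J. g * z)"
    proof (rule sum.mono_neutral_right[OF orthogonal_minimalD(1)[OF Q(1)] JQ], rule ballI)
      fix g assume "g \<in> Q - J"
      then show "g * z = 0" using unlinked[of g z] z(1) by (simp add: mult.assoc)
    qed
    also have "\<dots> = (\<Sum>g\<in>J. u g * (v g * z))" using uv(6) by (intro sum.cong) (auto simp: mult.assoc[symmetric])
    finally show ?thesis .
  qed
  have corner: "e * (v g * s * u h) = v g * s * u h" "v g * s * u h * e = v g * s * u h" if "g \<in> J" "h \<in> J" for g h s
    using uv(2)[OF that(2)] by (simp_all add: mult_eq_assoc[OF uv(3)[OF that(1)]] mult.assoc)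
  have T: "(\<Sum>g\<in>J. v g * (s * t) * u g) = (\<Sum>g\<in>J. \<Sum>h\<in>J. (v g * s * u h) * (v h * t * u g))"
    if "\<Sum>Q * t = t" for s t
  proof (rule sum.cong[OF refl])
    fix g assume g: "g \<in> J"
    have "t * u g = (\<Sum>h\<in>J. u h * (v h * (t * u g)))"
      by (rule resolve) (use uv(2)[OF g] that in \<open>simp_all add: mult.assoc mult_eq_assoc\<close>)
    then have "v g * (s * t) * u g = v g * s * (\<Sum>h\<in>J. u h * (v h * (t * u g)))" by (simp add: mult.assoc)
    then show "v g * (s * t) * u g = (\<Sum>h\<in>J. (v g * s * u h) * (v h * t * u g))"
      by (simp add: sum_distrib_left mult.assoc)
  qed
  have "(\<Sum>g\<in>J. v g * (x * y) * u g) = (\<Sum>g\<in>J. \<Sum>h\<in>J. (v h * y * u g) * (v g * x * u h))"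
    unfolding T[OF Qx(2)] using corner by (intro sum.cong refl minimal_corner_commute[OF e]) auto
  also have "\<dots> = (\<Sum>h\<in>J. \<Sum>g\<in>J. (v h * y * u g) * (v g * x * u h))" by (rule sum.swap)
  also have "\<dots> = (\<Sum>g\<in>J. v g * (y * x) * u g)" unfolding T[OF Qx(1)] ..
  finally have "(\<Sum>g\<in>J. v g * (e - f) * u g) = 0"
    unfolding xy(3) by (simp add: right_diff_distrib left_diff_distrib sum_subtractf)
  moreover have "v g * f * u g = 0" if g: "g \<in> J" for g
    using z(2)[of "u g"] z(2)[of 1] z(1)[of 1] uv(2)[OF g] z(2)[of "u g"]
    by (metis mult.assoc mult_zero_right)
  ultimately have "(\<Sum>g\<in>J. v g * e * u g) = 0" by (simp add: right_diff_distrib left_diff_distrib)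
  \<comment> \<open>Exchanging the factors lets e be pulled out in front, so the trace of e becomes
    e times the resolution of e, which is e.\<close>
  moreover have "v g * e * u g = e * u g * (v g * e)" if g: "g \<in> J" for g
  proof -
    note ee = minimal_idempotentD(2,3)[OF e]
    have "v g * e * (e * u g) = e * u g * (v g * e)"
      by (rule minimal_corner_commute[OF e]) (use uv(2,3)[OF g] ee in \<open>simp_all add: mult.assoc mult_eq_assoc[OF uv(3)[OF g]]\<close>)
    then show ?thesis using ee by (simp add: mult.assoc)
  qed
  ultimately have "(\<Sum>g\<in>J. e * u g * (v g * e)) = 0" by simp
  moreover have "(\<Sum>g\<in>J. e * u g * (v g * e)) = e * (\<Sum>g\<in>J. u g * (v g * e))"
    by (simp add: sum_distrib_left mult.assoc)
  moreover have "(\<Sum>g\<in>J. u g * (v g * e)) = e"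
    by (rule resolve[symmetric]) (use minimal_idempotentD(2)[OF e] Q(3) in simp_all)
  ultimately show False using minimal_idempotentD(1,2)[OF e] by simp
qed

lemma dim_eq_square_if_linked:
  assumes linked: "\<And>e f :: 'a. minimal_idempotent e \<Longrightarrow> minimal_idempotent f \<Longrightarrow> linked_idempotents e f"
    and p: "projection (p :: 'a)" "spectral_rank p < \<infinity>"
  shows "complex_dim (corner p) = spectral_rank p ^ 2"
proof -
  obtain E where E: "orthogonal_minimal E" "\<Sum>E = p" using finite_rank_decomposition[OF p] by blast
  show ?thesis
  proof (cases "E = {}")
    case True
    \<comment> \<open>The zero projection offers no reference idempotent; both sides are 0.\<close>
    then show ?thesis using separated_rank_dim[OF E(1)] E(2) by (simp add: zero_enat_def[symmetric])
  next
    case False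
    then obtain f where "f \<in> E" by blast
    then have f: "minimal_idempotent f" using orthogonal_minimalD(2)[OF E(1)] by blast
    show ?thesis
      using equivalent_rank_dim[OF E(1) f linked[OF orthogonal_minimalD(2)[OF E(1)] f]] E(2) by simp
  qed
qed

end

theorem theorem5p8:
  assumes semisimple: "(jacobson_radical :: 'a::complex_banach_algebra_1 set) = {0}"
    and socle_nonzero: "(socle :: 'a set) \<noteq> {0}"
  shows "((\<forall>p::'a. projection p \<and> spectral_rank p < \<infinity> \<longrightarrow>
              complex_dim (corner p) = spectral_rank p)
            \<longleftrightarrow> (socle :: 'a set) \<subseteq> alg_center) \<and>
         ((\<forall>p::'a. projection p \<and> spectral_rank p < \<infinity> \<longrightarrow>
              complex_dim (corner p) = (spectral_rank p)^2)
            \<longleftrightarrow> (\<forall>a\<in>(socle :: 'a set). spectral_trace a = 0 \<longrightarrow>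
                  (\<exists>x\<in>socle. \<exists>y\<in>socle. a = x * y - y * x)))"
proof -
  interpret semisimple_algebra "TYPE('a)" by unfold_locales (rule semisimple)
  show ?thesis
  proof (intro conjI iffI allI impI ballI)
    assume "\<forall>p::'a. projection p \<and> spectral_rank p < \<infinity> \<longrightarrow> complex_dim (corner p) = spectral_rank p"
    then show "(socle :: 'a set) \<subseteq> alg_center" using socle_central by blast
  next
    fix p :: 'a
    assume "(socle :: 'a set) \<subseteq> alg_center" "projection p \<and> spectral_rank p < \<infinity>"
    then show "complex_dim (corner p) = spectral_rank p" using dim_eq_rank_if_central by blast
  next
    fix a :: 'a
    assume "\<forall>p::'a. projection p \<and> spectral_rank p < \<infinity> \<longrightarrow> complex_dim (corner p) = spectral_rank p ^ 2"
      and a: "a \<in> socle" "spectral_trace a = 0"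
    then have "linked_idempotents e f" if "minimal_idempotent e" "minimal_idempotent f" for e f :: 'a
      using all_linked[OF _ that] by blast
    then show "\<exists>x\<in>socle. \<exists>y\<in>socle. a = x * y - y * x" using trace_zero_commutator a by blast
  next
    fix p :: 'a
    assume "\<forall>a\<in>(socle :: 'a set). spectral_trace a = 0 \<longrightarrow> (\<exists>x\<in>socle. \<exists>y\<in>socle. a = x * y - y * x)"
      and p: "projection p \<and> spectral_rank p < \<infinity>"
    then have "linked_idempotents e f" if "minimal_idempotent e" "minimal_idempotent f" for e f :: 'a
      using linked_if_commutators[OF _ that] by blast
    then show "complex_dim (corner p) = spectral_rank p ^ 2" using dim_eq_square_if_linked p by blast
  qed
qed

end
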